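(* Let $s\ge1$. For every $n\ge2$ and every $1\le i\le s$, $$|\mathcal B_n^{s+1,i}|=\sum_{\alpha=1}^{n-1}\ \sum_{i'=i}^{s}|\mathcal B_\alpha^{s+1,i'}|\,|\mathcal B_{n-\alpha}^{s+1}|\binom{n-1}{\alpha-1}^{i}\binom{n-1}{\alpha}\binom{n}{\alpha}^{s-i},$$ where $|\mathcal B_1^{s+1}|=1$, and where for the term $\alpha=1$ the inner sum over $i'$ is replaced by the single factor $|\mathcal B_1^{s+1}|$, i.e. the $\alpha=1$ summand is $|\mathcal B_1^{s+1}|\,|\mathcal B_{n-1}^{s+1}|\binom{n-1}{0}^{i}\binom{n-1}{1}\binom{n}{1}^{s-i}$.
   Context: A vector partition of $[n]$ into $s+1$ components is a tuple $(P,w^1,\ldots,w^s)$ where $P$ is a set partition of $[n]$ and each $w^i$ assigns to every part $B$ of $P$ a label $w^i(B)\subseteq[n]$ (its $i$-th label) with $|w^i(B)|=|B|$, such that the $i$-th labels of all parts form a partition of $[n]$. $\Pi_{n,s+1}$ is the set of these tuples together with an added least element $\hat0$, ordered by $(P,w)\le(P',w')$ iff every part $B'$ of $P'$ is a union of parts of $P$ and, for each $i$, $w^{i\prime}(B')$ is the union of $w^i(B)$ over the parts $B\subseteq B'$ of $P$. Atoms: the elements whose partition is $\{1\},\ldots,\{n\}$; such an atom with $w^i(\{k\})=\{w^i_k\}$ is identified with the word $w^1_1\cdots w^1_n\cdots w^s_1\cdots w^s_n\in[n]^{ns}$, ordered lexicographically. For $x\ne\hat0$, $A(x)$ is the lexicographically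 least atom below $x$; explicitly, if $\{k_1<\cdots<k_p\}$ is a part of $x$ with $i$-th label $\{j_1<\cdots<j_p\}$, then $A(x)$ has $w^i_{k_a}=j_a$. Write $w^i_k(x)$ for the entry $w^i_k$ of $A(x)$. The edge labeling $\lambda$ maps covering relations to $\mathbb Z^3$ ordered lexicographically: - if $x\lessdot y$, $x\ne\hat0$, $A(x)\ne A(y)$: $\lambda(x\lessdot y)=(k,i,j)$ where $(k,i)$ is the lexicographically least pair (first by $k$, then by $i$) with $w^i_k(x)\ne w^i_k(y)$, and $j=w^i_k(y)$; - if $x\lessdot y$, $x\ne\hat0$, $A(x)=A(y)$: $\lambda(x\lessdot y)=(n,\max(I\cup J),0)$ where $I,J$ are the parts of the partition of $x$ merged to form that of $y$; - $\lambda(\hat0\lessdot a)=(n-1,s+m,0)$ where $a$ is the $m$-th atom in lexicographic order. A maximal chain is decreasing if its sequence of edge labels (read from bottom to top) is weakly decreasing. $\mathcal B_n^{s+1}$ denotes the set of decreasing maximal chains of $\Pi_{n,s+1}$. For $n>1$, $\mathcal B_n^{s+1,i}$ denotes the set of decreasing maximal chains of $\Pi_{n,s+1}$ whose highest edge (the covering into $([n],[n],\ldots,[n])$) has label of the form $(k,i,j)$ for some $k,j$. *)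

theory Defs
  imports
    "HOL-Library.Disjoint_Sets"
    "HOL-Library.FuncSet"
    "HOL-Library.List_Lexorder"
    "HOL-Library.Product_Lexorder"
begin

text \<open>
  The poset of vector partitions of \<open>{1..n}\<close> into \<open>s + 1\<close> components. Throughout, the
  parameter \<open>s\<close> is the number of labels, so the number of components is \<open>s + 1\<close>.
  Words (lists) and edge labels (triples) carry the lexicographic orders of
  \<open>List_Lexorder\<close> and \<open>Product_Lexorder\<close>.
\<close>

datatype vpart = Zero_hat | VP (parts: "nat set set") (lab: "nat \<Rightarrow> nat set \<Rightarrow> nat set")

text \<open>
  \<open>w i B\<close> is the \<open>i\<close>-th label of the part \<open>B\<close>. The extensional function spaces make the
  representation unique. The labels, taken as a family indexed by the parts, have to be
  disjoint; hence the injectivity requirement next to \<open>partition_on\<close>, which only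
  speaks about the set of labels.
\<close>

definition is_vector_partition ::
    "nat \<Rightarrow> nat \<Rightarrow> nat set set \<Rightarrow> (nat \<Rightarrow> nat set \<Rightarrow> nat set) \<Rightarrow> bool" where
  "is_vector_partition n s P w \<longleftrightarrow>
     partition_on {1..n} P \<and>
     w \<in> {1..s} \<rightarrow>\<^sub>E (P \<rightarrow>\<^sub>E Pow {1..n}) \<and>
     (\<forall>i\<in>{1..s}. (\<forall>B\<in>P. card (w i B) = card B) \<and>
        inj_on (w i) P \<and> partition_on {1..n} (w i ` P))"

definition vparts :: "nat \<Rightarrow> nat \<Rightarrow> vpart set" where
  "vparts n s = insert Zero_hat {VP P w | P w. is_vector_partition n s P w}"

fun vle :: "nat \<Rightarrow> vpart \<Rightarrow> vpart \<Rightarrow> bool" where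
  "vle s Zero_hat y = True"
| "vle s (VP P w) Zero_hat = False"
| "vle s (VP P w) (VP P' w') =
     (\<forall>B'\<in>P'. (\<exists>S. S \<subseteq> P \<and> B' = \<Union>S) \<and>
        (\<forall>i\<in>{1..s}. w' i B' = (\<Union>B\<in>{B\<in>P. B \<subseteq> B'}. w i B)))"

definition vless :: "nat \<Rightarrow> vpart \<Rightarrow> vpart \<Rightarrow> bool" where
  "vless s x y \<longleftrightarrow> vle s x y \<and> x \<noteq> y"

definition vcovers :: "nat \<Rightarrow> nat \<Rightarrow> vpart \<Rightarrow> vpart \<Rightarrow> bool" where
  "vcovers n s x y \<longleftrightarrow> x \<in> vparts n s \<and> y \<in> vparts n s \<and> vless s x y \<and>
     \<not> (\<exists>z\<in>vparts n s. vless s x z \<and> vless s z y)"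

definition vtop :: "nat \<Rightarrow> nat \<Rightarrow> vpart" where
  "vtop n s = VP {{1..n}} (\<lambda>i\<in>{1..s}. \<lambda>B\<in>{{1..n}}. {1..n})"

definition vatoms :: "nat \<Rightarrow> nat \<Rightarrow> vpart set" where
  "vatoms n s = {a \<in> vparts n s. a \<noteq> Zero_hat \<and> parts a = (\<lambda>k. {k}) ` {1..n}}"

definition atom_entry :: "vpart \<Rightarrow> nat \<Rightarrow> nat \<Rightarrow> nat" where
  "atom_entry a i k = the_elem (lab a i {k})"

definition atom_word :: "nat \<Rightarrow> nat \<Rightarrow> vpart \<Rightarrow> nat list" where
  "atom_word n s a = concat (map (\<lambda>i. map (atom_entry a i) [1..<Suc n]) [1..<Suc s])"

definition least_atom :: "nat \<Rightarrow> nat \<Rightarrow> vpart \<Rightarrow> vpart" where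
  "least_atom n s x = arg_min (atom_word n s) (\<lambda>a. a \<in> vatoms n s \<and> vle s a x)"

definition entry :: "nat \<Rightarrow> nat \<Rightarrow> vpart \<Rightarrow> nat \<Rightarrow> nat \<Rightarrow> nat" where
  "entry n s x i k = atom_entry (least_atom n s x) i k"

definition atom_index :: "nat \<Rightarrow> nat \<Rightarrow> vpart \<Rightarrow> nat" where
  "atom_index n s a = card {b \<in> vatoms n s. atom_word n s b \<le> atom_word n s a}"

definition first_change :: "nat \<Rightarrow> nat \<Rightarrow> vpart \<Rightarrow> vpart \<Rightarrow> nat \<times> nat" where
  "first_change n s x y =
     (LEAST p. p \<in> {1..n} \<times> {1..s} \<and>
        (case p of (k, i) \<Rightarrow> entry n s x i k \<noteq> entry n s y i k))"

definition merged_max :: "vpart \<Rightarrow> vpart \<Rightarrow> nat" where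
  "merged_max x y = (THE m. \<exists>I\<in>parts x. \<exists>J\<in>parts x.
     I \<noteq> J \<and> I \<union> J \<in> parts y \<and> m = Max (I \<union> J))"

text \<open>The edge labeling; its values are only meaningful on covering pairs \<open>(x, y)\<close>.\<close>

definition edge_label :: "nat \<Rightarrow> nat \<Rightarrow> vpart \<Rightarrow> vpart \<Rightarrow> int \<times> int \<times> int" where
  "edge_label n s x y =
     (if x = Zero_hat then (int n - 1, int s + int (atom_index n s y), 0)
      else if least_atom n s x \<noteq> least_atom n s y then
        (case first_change n s x y of (k, i) \<Rightarrow> (int k, int i, int (entry n s y i k)))
      else (int n, int (merged_max x y), 0))"

text \<open>
  Maximal chains are sets of poset elements. Since the poset is finite, consecutive elements
  of a maximal chain are exactly its pairs of elements in covering relation, and consecutive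
  edges are given by \<open>x\<close>, \<open>y\<close>, \<open>z\<close> in the chain with \<open>y\<close> covering \<open>x\<close> and \<open>z\<close> covering \<open>y\<close>.
\<close>

definition maximal_chain :: "nat \<Rightarrow> nat \<Rightarrow> vpart set \<Rightarrow> bool" where
  "maximal_chain n s C \<longleftrightarrow> pred_on.maxchain (vparts n s) (vless s) C"

definition decreasing_chain :: "nat \<Rightarrow> nat \<Rightarrow> vpart set \<Rightarrow> bool" where
  "decreasing_chain n s C \<longleftrightarrow>
     (\<forall>x\<in>C. \<forall>y\<in>C. \<forall>z\<in>C. vcovers n s x y \<longrightarrow> vcovers n s y z \<longrightarrow>
        edge_label n s y z \<le> edge_label n s x y)"

definition decr_max_chains :: "nat \<Rightarrow> nat \<Rightarrow> vpart set set" where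
  "decr_max_chains n s = {C. maximal_chain n s C \<and> decreasing_chain n s C}"

definition decr_max_chains_top :: "nat \<Rightarrow> nat \<Rightarrow> nat \<Rightarrow> vpart set set" where
  "decr_max_chains_top n s i =
     {C \<in> decr_max_chains n s. \<exists>x\<in>C. vcovers n s x (vtop n s) \<and>
        (\<exists>k j. edge_label n s x (vtop n s) = (k, int i, j))}"

end

theory Submission
  imports Defs
begin

text \<open>
  A maximal chain merges parts two at a time, so it is a binary tree whose nodes are the merged parts,
  together with an order of the merges. The edge from the least element has label \<open>(n - 1, s + m, 0)\<close>; hence in a
  decreasing chain no edge keeps the least atom. The first merge of a singleton \<open>{k}\<close>
  into a part with minimum \<open>k\<close> has to change an entry at \<open>k\<close>, because otherwise the least atom is kept.
  By monotonicity every merge of \<open>I\<close> and \<open>J\<close> with \<open>Min I < Min J\<close> has label \<open>(Min I, i, Min (w i J))\<close>,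
  where \<open>i\<close> is the least index with \<open>Min (w i J) < Min (w i I)\<close>.
  A parent then has a smaller label than the right child automatically, and a smaller one than the left child iff the
  index of the parent is at most that of the left child. All labels of a tree are distinct, so sorting recovers
  the order of the merges and decreasing chains correspond to such trees.

  Splitting a tree at its root with index \<open>i\<close> gives the recursion: the part of the left child
  and its labels below \<open>i\<close> have to contain the minimum, the \<open>i\<close>-th label must not, and
  the remaining labels are arbitrary.
\<close>

section \<open>Blocks and states\<close>

text \<open>Decreasing is meant weakly, but consecutive merges cannot share a label
  \<open>(k, i, j)\<close>: the first one has already set the \<open>i\<close>-th entry at
  \<open>k\<close> to \<open>j\<close>, so the second cannot change it to \<open>j\<close>. Labels
  of merges are therefore strictly decreasing, and a chain is the family of cuts of its tree at all
  thresholds; no list of merges is ever sorted. The obstacle is a merge of \<open>I\<close> and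
  \<open>J\<close> in which no label of \<open>J\<close> has the smaller minimum. The entries at
  \<open>Min I\<close> then survive and the label starts beyond \<open>Min I\<close>. If
  \<open>I\<close> is no singleton, it was created by an edge whose label starts with
  \<open>Min I\<close>, which contradicts the decrease; if it is one, nothing changes at all and the
  label starts with \<open>n\<close>, above the edge from the least element. Splitting at the root
  leaves parts and labels that are no initial segments, so trees are counted over an arbitrary total
  \<open>W\<close>, and the count is shown to depend only on the size. The part itself behaves like
  one more label before the \<open>i\<close>-th: hence the exponent \<open>i\<close>, not
  \<open>i - 1\<close>. For \<alpha> = 1 the left child is a leaf; it has no index, so it fits every
  \<open>i\<close>.\<close>

text \<open>
  A part \<open>B\<close> and its labels are bundled into one function \<open>b\<close> with \<open>b 0 = B\<close> and \<open>b i = w i B\<close>,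
  so that the part plays the role of a label with index \<open>0\<close>. The order of vector partitions then becomes
  refinement with respect to the pointwise order of functions, and the least element is the empty state.
\<close>

type_synonym block = "nat \<Rightarrow> nat set"

definition is_block :: "nat \<Rightarrow> block \<Rightarrow> bool" where
  "is_block s b \<longleftrightarrow> b \<in> extensional {..s} \<and> b 0 \<noteq> {} \<and>
     (\<forall>i\<le>s. finite (b i) \<and> card (b 0) = card (b i))"

text \<open>The total \<open>W\<close> is a parameter because a cut of a subtree is a state too,
  with the block of that subtree as its total.\<close>

definition is_state :: "nat \<Rightarrow> block \<Rightarrow> block set \<Rightarrow> bool" where
  "is_state s W X \<longleftrightarrow> (\<forall>b\<in>X. is_block s b) \<and>
     (\<forall>b\<in>X. \<forall>c\<in>X. b \<noteq> c \<longrightarrow> (\<forall>i\<le>s. b i \<inter> c i = {})) \<and>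
     (\<forall>i\<le>s. (\<Union>b\<in>X. b i) = W i)"

text \<open>An empty \<open>X\<close> refines everything and a nonempty one never refines the empty
  set, which is how \<open>Zero_hat\<close> has to behave.\<close>

definition refines :: "block set \<Rightarrow> block set \<Rightarrow> bool" where
  "refines X Y \<longleftrightarrow> (\<forall>b\<in>X. \<exists>c\<in>Y. b \<le> c)"

definition merge :: "block \<Rightarrow> block \<Rightarrow> block set \<Rightarrow> block set" where
  "merge b c X = insert (sup b c) (X - {b, c})"

definition full :: "nat \<Rightarrow> nat \<Rightarrow> block" where
  "full s n = (\<lambda>i\<in>{..s}. {1..n})"

lemma is_block_finite: "is_block s b \<Longrightarrow> i \<le> s \<Longrightarrow> finite (b i)"
  by (simp add: is_block_def)

lemma is_block_card: "is_block s b \<Longrightarrow> i \<le> s \<Longrightarrow> card (b i) = card (b 0)"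
  unfolding is_block_def by metis

lemma is_block_nonempty: "is_block s b \<Longrightarrow> i \<le> s \<Longrightarrow> b i \<noteq> {}"
  unfolding is_block_def by (metis card_0_eq card.empty le0)

lemma is_block_undefined: "is_block s b \<Longrightarrow> \<not> i \<le> s \<Longrightarrow> b i = undefined"
  by (auto simp: is_block_def extensional_def)

lemma is_block_eqI:
  assumes "is_block s b" "is_block s c" "\<And>i. i \<le> s \<Longrightarrow> b i = c i"
  shows "b = c"
proof
  fix i show "b i = c i"
    using assms is_block_undefined[of s b i] is_block_undefined[of s c i] by (cases "i \<le> s") auto
qed

lemma is_block_sup:
  assumes "is_block s b" "is_block s c" "\<And>i. i \<le> s \<Longrightarrow> b i \<inter> c i = {}"
  shows "is_block s (sup b c)"
  using assms by (auto simp: is_block_def extensional_def card_Un_disjoint)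

lemma is_state_block: "is_state s W X \<Longrightarrow> b \<in> X \<Longrightarrow> is_block s b"
  by (simp add: is_state_def)

lemma is_state_unique:
  "is_state s W X \<Longrightarrow> b \<in> X \<Longrightarrow> c \<in> X \<Longrightarrow> i \<le> s \<Longrightarrow> x \<in> b i \<Longrightarrow> x \<in> c i \<Longrightarrow> b = c"
  unfolding is_state_def by blast

lemma is_state_cover:
  "is_state s W X \<Longrightarrow> i \<le> s \<Longrightarrow> x \<in> W i \<Longrightarrow> \<exists>b\<in>X. x \<in> b i"
  unfolding is_state_def by blast

lemma is_state_subset:
  "is_state s W X \<Longrightarrow> b \<in> X \<Longrightarrow> i \<le> s \<Longrightarrow> b i \<subseteq> W i"
  unfolding is_state_def by blast

lemma is_state_inj:
  assumes "is_state s W X" "i \<le> s" shows "inj_on (\<lambda>b. b i) X"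
proof (rule inj_onI)
  fix b c assume *: "b \<in> X" "c \<in> X" "b i = c i"
  then obtain x where "x \<in> b i" using is_block_nonempty[OF is_state_block[OF assms(1)] assms(2)] by blast
  thus "b = c" using * is_state_unique[OF assms(1) _ _ assms(2)] by metis
qed

lemma is_state_finite:
  assumes "is_state s W X" "finite (W 0)" shows "finite X"
proof -
  have "(\<lambda>b. b 0) ` X \<subseteq> Pow (W 0)" using is_state_subset[OF assms(1)] by blast
  thus ?thesis using is_state_inj[OF assms(1), of 0] assms(2)
    by (meson finite_Pow_iff finite_imageD finite_subset le0)
qed

lemma is_state_sum_card:
  assumes "is_state s W X" "finite (W 0)"
  shows "(\<Sum>b\<in>X. card (b 0)) = card (W 0)"
proof -
  have "card (\<Union>b\<in>X. b 0) = (\<Sum>b\<in>X. card (b 0))"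
    using is_state_finite[OF assms] assms(1)
    by (intro card_UN_disjoint) (auto simp: is_state_def is_block_def)
  thus ?thesis using assms(1) by (simp add: is_state_def)
qed

lemma is_state_card_pos:
  assumes "is_state s W X" "b \<in> X" shows "1 \<le> card (b 0)"
  using is_state_block[OF assms] by (auto simp: is_block_def Suc_le_eq card_gt_0_iff)

lemma is_state_card_le:
  assumes "is_state s W X" "finite (W 0)" shows "card X \<le> card (W 0)"
proof -
  have "card X = (\<Sum>b\<in>X. 1)" by simp
  also have "\<dots> \<le> (\<Sum>b\<in>X. card (b 0))" by (rule sum_mono) (use is_state_card_pos[OF assms(1)] in auto)
  finally show ?thesis using is_state_sum_card[OF assms] by simp
qed

text \<open>Equality forces the excesses \<open>card (b 0) - 1\<close>, which are natural numbers,
  to sum to zero. This later identifies the atoms as the states with the largest number of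
  blocks.\<close>

lemma is_state_card_eq_iff:
  assumes "is_state s W X" "finite (W 0)"
  shows "card X = card (W 0) \<longleftrightarrow> (\<forall>b\<in>X. card (b 0) = 1)"
proof
  assume eq: "card X = card (W 0)"
  have "(\<Sum>b\<in>X. card (b 0) - 1) = (\<Sum>b\<in>X. card (b 0)) - (\<Sum>b\<in>X. 1)"
    by (rule sum_subtractf_nat) (use is_state_card_pos[OF assms(1)] in auto)
  also have "\<dots> = 0" using is_state_sum_card[OF assms] eq by simp
  finally have "\<forall>b\<in>X. card (b 0) - 1 = 0" using is_state_finite[OF assms] by simp
  thus "\<forall>b\<in>X. card (b 0) = 1" using is_state_card_pos[OF assms(1)]
    by (metis le_antisym diff_is_0_eq)
next
  assume "\<forall>b\<in>X. card (b 0) = 1"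
  hence "(\<Sum>b\<in>X. card (b 0)) = card X" by simp
  thus "card X = card (W 0)" using is_state_sum_card[OF assms] by simp
qed

section \<open>Refinement of states, merging two blocks, interpolation\<close>

lemma refines_refl: "refines X X" by (auto simp: refines_def)

lemma refines_trans: "refines X Y \<Longrightarrow> refines Y Z \<Longrightarrow> refines X Z"
  unfolding refines_def by (meson order_trans)

text \<open>Some block of \<open>Y\<close> lies above \<open>b\<close>; it shares \<open>x\<close>
  with \<open>d\<close>, and blocks of a state that meet in any component coincide.\<close>

lemma refines_below:
  assumes "is_state s W X" "is_state s W Y" "refines X Y"
    and "b \<in> X" "d \<in> Y" "i \<le> s" "x \<in> b i" "x \<in> d i"
  shows "b \<le> d"
proof -
  obtain c where c: "c \<in> Y" "b \<le> c" using assms(3,4) by (auto simp: refines_def)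
  hence "x \<in> c i" using assms(7) by (auto simp: le_fun_def)
  thus ?thesis using is_state_unique[OF assms(2) c(1) assms(5,6)] assms(8) c(2) by auto
qed

lemma refines_Union:
  assumes "is_state s W X" "is_state s W Y" "refines X Y" "d \<in> Y" "i \<le> s"
  shows "d i = (\<Union>b\<in>{b\<in>X. b \<le> d}. b i)"
proof
  show "d i \<subseteq> (\<Union>b\<in>{b\<in>X. b \<le> d}. b i)"
  proof
    fix x assume x: "x \<in> d i"
    then obtain b where b: "b \<in> X" "x \<in> b i"
      using is_state_subset[OF assms(2,4,5)] is_state_cover[OF assms(1,5)] by blast
    thus "x \<in> (\<Union>b\<in>{b\<in>X. b \<le> d}. b i)"
      using refines_below[OF assms(1-3) b(1) assms(4,5) b(2) x] by blast
  qed
qed (auto simp: le_fun_def)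

text \<open>Each block goes to the block above it. Every block of \<open>Y\<close> is hit because
  its points are covered by \<open>X\<close>. If the map is injective, a point of
  \<open>f b i\<close> lies in some block \<open>c\<close> with \<open>f c = f b\<close>, hence in
  \<open>b\<close> itself, so nothing grows.\<close>

lemma refines_map:
  assumes "is_state s W X" "is_state s W Y" "refines X Y" "finite (W 0)"
  obtains f where "\<And>b. b \<in> X \<Longrightarrow> b \<le> f b" "f ` X = Y" "inj_on f X \<Longrightarrow> X = Y"
proof -
  obtain f where f: "\<And>b. b \<in> X \<Longrightarrow> f b \<in> Y \<and> b \<le> f b"
    using assms(3) unfolding refines_def by metis
  have sub: "x \<in> f b i" if "b \<in> X" "x \<in> b i" for b i x using f[OF that(1)] that(2) by (auto simp: le_fun_def)
  have im: "f ` X = Y"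
  proof
    show "Y \<subseteq> f ` X"
    proof
      fix d assume d: "d \<in> Y"
      then obtain x where x: "x \<in> d 0" using is_state_block[OF assms(2)] by (auto simp: is_block_def)
      then obtain b where b: "b \<in> X" "x \<in> b 0"
        using is_state_subset[OF assms(2) d, of 0] is_state_cover[OF assms(1), of 0] by blast
      have "f b = d" using is_state_unique[OF assms(2) _ d, of "f b" 0 x] f b sub x by auto
      thus "d \<in> f ` X" using b by auto
    qed
  qed (use f in auto)
  have "X = Y" if inj: "inj_on f X"
  proof -
    have "f b = b" if b: "b \<in> X" for b
    proof (rule is_block_eqI)
      show "is_block s b" "is_block s (f b)"
        using b f is_state_block[OF assms(1)] is_state_block[OF assms(2)] by auto
      fix i assume i: "i \<le> s"
      have "x \<in> b i" if x: "x \<in> f b i" for x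
      proof -
        obtain c where c: "c \<in> X" "x \<in> c i"
          using x f b i is_state_subset[OF assms(2)] is_state_cover[OF assms(1)] by (metis subset_iff)
        have "f c = f b" using is_state_unique[OF assms(2) _ _ i, of "f c" "f b" x] f b c x sub by auto
        thus ?thesis using inj b c by (auto dest: inj_onD)
      qed
      thus "f b i = b i" using sub[OF b] by auto
    qed
    thus ?thesis using im by force
  qed
  thus ?thesis using that f im by blast
qed

lemma refines_card:
  assumes "is_state s W X" "is_state s W Y" "refines X Y" "finite (W 0)"
  shows "card Y \<le> card X" and "card X = card Y \<Longrightarrow> X = Y"
proof -
  obtain f where f: "f ` X = Y" "inj_on f X \<Longrightarrow> X = Y" using refines_map[OF assms] by metis
  note fin = is_state_finite[OF assms(1,4)]
  show "card Y \<le> card X" using f(1) fin card_image_le by blast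
  show "card X = card Y \<Longrightarrow> X = Y" using f fin eq_card_imp_inj_on by metis
qed

lemma merge_refines: "refines X (merge b c X)"
  unfolding refines_def merge_def by (metis Diff_iff insertCI insertE singletonD order_refl sup_ge1 sup_ge2)

lemma merge_state:
  assumes "is_state s W X" "b \<in> X" "c \<in> X" "b \<noteq> c"
  shows "is_state s W (merge b c X)"
proof -
  have dis: "\<And>b c i. b \<in> X \<Longrightarrow> c \<in> X \<Longrightarrow> b \<noteq> c \<Longrightarrow> i \<le> s \<Longrightarrow> b i \<inter> c i = {}"
    using assms(1) by (simp add: is_state_def)
  have un: "(\<Union>d\<in>merge b c X. d i) = (\<Union>d\<in>X. d i)" for i
    using assms(2,3) by (auto simp: merge_def)
  have "is_block s (sup b c)"
    using assms dis by (intro is_block_sup) (auto simp: is_state_def)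
  hence "\<forall>d\<in>merge b c X. is_block s d" using assms(1) by (auto simp: merge_def is_state_def)
  moreover have "d i \<inter> e i = {}" if "d \<in> merge b c X" "e \<in> merge b c X" "d \<noteq> e" "i \<le> s" for d e i
    using that dis assms(2,3) by (auto simp: merge_def; blast)
  ultimately show ?thesis using un assms(1) by (simp add: is_state_def)
qed

lemma sup_notin_state:
  assumes "is_state s W X" "b \<in> X" "c \<in> X" "b \<noteq> c" shows "sup b c \<notin> X"
proof
  assume *: "sup b c \<in> X"
  obtain x y where xy: "x \<in> b 0" "y \<in> c 0"
    using is_block_nonempty[OF is_state_block[OF assms(1)]] assms(2,3) by blast
  have "sup b c = b" using is_state_unique[OF assms(1) * assms(2), of 0 x] xy by simp
  moreover have "sup b c = c" using is_state_unique[OF assms(1) * assms(3), of 0 y] xy by simp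
  ultimately show False using assms(4) by simp
qed

lemma merge_card:
  assumes "is_state s W X" "b \<in> X" "c \<in> X" "b \<noteq> c" "finite (W 0)"
  shows "Suc (card (merge b c X)) = card X"
proof -
  have fin: "finite X" using is_state_finite assms by blast
  hence "2 \<le> card X" using assms(2-4) by (metis card_2_iff card_mono empty_subsetI insert_subset)
  thus ?thesis using fin assms sup_notin_state[OF assms(1-4)]
    by (simp add: merge_def card_Diff_subset)
qed

text \<open>The map to the coarser state is not injective, and two blocks with the same image can be
  merged without leaving that image.\<close>

lemma refines_merge:
  assumes "is_state s W X" "is_state s W Y" "refines X Y" "finite (W 0)" "X \<noteq> Y"
  obtains b c where "b \<in> X" "c \<in> X" "b \<noteq> c" "refines (merge b c X) Y"
proof -
  obtain f where f: "\<And>b. b \<in> X \<Longrightarrow> b \<le> f b" "f ` X = Y" "inj_on f X \<Longrightarrow> X = Y"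
    using refines_map[OF assms(1-4)] by metis
  then obtain b c where bc: "b \<in> X" "c \<in> X" "b \<noteq> c" "f b = f c" using assms(5) by (auto simp: inj_on_def)
  have "refines (merge b c X) Y" unfolding refines_def merge_def
  proof
    fix d assume "d \<in> insert (sup b c) (X - {b, c})"
    then consider "d = sup b c" | "d \<in> X" by blast
    thus "\<exists>c\<in>Y. d \<le> c"
    proof cases
      case 1
      have "sup b c \<le> f b" using f(1) bc by (metis le_sup_iff)
      thus ?thesis using 1 bc(1) f(2) by blast
    next
      case 2 thus ?thesis using f by blast
    qed
  qed
  thus ?thesis using bc that by blast
qed

text \<open>Merges lower the number of blocks by one at a time, so every intermediate number is
  reached. This makes the poset graded by the number of blocks.\<close>

lemma refines_interpolate:
  assumes "is_state s W X" "is_state s W Y" "refines X Y" "finite (W 0)" "card Y \<le> m" "m \<le> card X"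
  shows "\<exists>Z. is_state s W Z \<and> refines X Z \<and> refines Z Y \<and> card Z = m"
  using assms
proof (induction "card X" arbitrary: X rule: less_induct)
  case less
  show ?case
  proof (cases "m = card X")
    case True thus ?thesis using less.prems refines_refl by blast
  next
    case False
    hence "X \<noteq> Y" using less.prems by auto
    then obtain b c where bc: "b \<in> X" "c \<in> X" "b \<noteq> c" "refines (merge b c X) Y"
      using refines_merge less.prems by metis
    have cd: "Suc (card (merge b c X)) = card X" using merge_card less.prems bc by blast
    have "\<exists>Z. is_state s W Z \<and> refines (merge b c X) Z \<and> refines Z Y \<and> card Z = m"
      using cd False less.prems bc merge_state by (intro less.hyps) auto
    thus ?thesis using merge_refines refines_trans by blast
  qed
qed

section \<open>Vector partitions as states\<close>

primrec blocks :: "nat \<Rightarrow> vpart \<Rightarrow> block set" where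
  "blocks s Zero_hat = {}"
| "blocks s (VP P w) = (\<lambda>B. \<lambda>i\<in>{..s}. if i = 0 then B else w i B) ` P"

lemma blocks_state:
  assumes "x \<in> vparts n s" "x \<noteq> Zero_hat"
  shows "is_state s (full s n) (blocks s x)"
proof -
  obtain P w where x: "x = VP P w" "is_vector_partition n s P w" using assms by (auto simp: vparts_def)
  have P: "partition_on {1..n} P" using x by (simp add: is_vector_partition_def)
  have w: "card (w i B) = card B" "inj_on (w i) P" "partition_on {1..n} (w i ` P)"
    if "1 \<le> i" "i \<le> s" "B \<in> P" for i B using x that by (auto simp: is_vector_partition_def)
  have fin: "finite B" "B \<noteq> {}" if "B \<in> P" for B
    using P that finite_subset[of B "{1..n}"] by (auto simp: partition_on_def)
  have finw: "finite (w i B)" if "B \<in> P" "1 \<le> i" "i \<le> s" for i B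
    using w(1)[OF that(2,3,1)] fin[OF that(1)] by (metis card_gt_0_iff)
  have blk: "\<forall>b\<in>blocks s x. is_block s b"
    using fin finw w(1) by (auto simp: x is_block_def)
  have "\<forall>b\<in>blocks s x. \<forall>c\<in>blocks s x. b \<noteq> c \<longrightarrow> (\<forall>i\<le>s. b i \<inter> c i = {})"
  proof (intro ballI impI allI)
    fix b c i assume bc: "b \<in> blocks s x" "c \<in> blocks s x" "b \<noteq> c" and i: "i \<le> s"
    then obtain B C where BC: "B \<in> P" "C \<in> P" "b = (\<lambda>i\<in>{..s}. if i = 0 then B else w i B)"
      "c = (\<lambda>i\<in>{..s}. if i = 0 then C else w i C)" by (auto simp: x)
    with bc have ne: "B \<noteq> C" by auto
    show "b i \<inter> c i = {}"
    proof (cases "i = 0")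
      case True thus ?thesis using P BC ne by (auto simp: partition_on_def disjoint_def)
    next
      case False
      hence "w i B \<noteq> w i C" using w(2)[of i B] BC i ne by (auto dest: inj_onD)
      thus ?thesis using w(3)[of i B] BC i False by (auto simp: partition_on_def disjoint_def)
    qed
  qed
  moreover have "\<forall>i\<le>s. (\<Union>b\<in>blocks s x. b i) = full s n i"
  proof (intro allI impI)
    fix i assume i: "i \<le> s"
    show "(\<Union>b\<in>blocks s x. b i) = full s n i"
    proof (cases "i = 0")
      case True thus ?thesis using P by (auto simp: x full_def partition_on_def)
    next
      case False
      show ?thesis
      proof (cases "P = {}")
        case True thus ?thesis using P i by (auto simp: x full_def partition_on_def)
      next
        case ne: False
        then obtain B where "B \<in> P" by blast
        hence "\<Union>(w i ` P) = {1..n}" using w(3)[of i B] i False by (auto simp: partition_on_def)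
        thus ?thesis using i False by (simp add: x full_def)
      qed
    qed
  qed
  ultimately show ?thesis using blk by (simp add: is_state_def)
qed

text \<open>For \<open>n = 0\<close> the empty vector partition would have the empty state as well;
  positivity of \<open>n\<close> separates it from \<open>Zero_hat\<close>.\<close>

lemma blocks_eq_empty_iff:
  assumes "x \<in> vparts n s" "0 < n" shows "blocks s x = {} \<longleftrightarrow> x = Zero_hat"
  using assms by (auto simp: vparts_def is_vector_partition_def partition_on_def)

lemma blocks_inj:
  assumes "0 < n" shows "inj_on (blocks s) (vparts n s)"
proof (rule inj_onI)
  fix x y assume xy: "x \<in> vparts n s" "y \<in> vparts n s" "blocks s x = blocks s y"
  show "x = y"
  proof (cases "x = Zero_hat")
    case True thus ?thesis using xy blocks_eq_empty_iff[OF _ assms, of y s] by simp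
  next
    case False
    hence "y \<noteq> Zero_hat" using xy blocks_eq_empty_iff[OF _ assms] by auto
    then obtain P w P' w' where x: "x = VP P w" "is_vector_partition n s P w"
      and y: "y = VP P' w'" "is_vector_partition n s P' w'" using xy False by (auto simp: vparts_def)
    have P: "P = (\<lambda>b. b 0) ` blocks s x" "P' = (\<lambda>b. b 0) ` blocks s y" by (auto simp: x y image_image)
    hence PP: "P' = P" using xy by simp
    have "w' i B = w i B" if "i \<in> {1..s}" "B \<in> P" for i B
    proof -
      have "(\<lambda>i\<in>{..s}. if i = 0 then B else w i B) \<in> blocks s y" using xy that by (auto simp: x)
      then obtain C where C: "(\<lambda>i\<in>{..s}. if i = 0 then B else w i B) = (\<lambda>i\<in>{..s}. if i = 0 then C else w' i C)"
        by (auto simp: y)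
      from fun_cong[OF C, of 0] fun_cong[OF C, of i] that show ?thesis by auto
    qed
    moreover have "w \<in> {1..s} \<rightarrow>\<^sub>E (P \<rightarrow>\<^sub>E Pow {1..n})" "w' \<in> {1..s} \<rightarrow>\<^sub>E (P \<rightarrow>\<^sub>E Pow {1..n})"
      using x y PP by (auto simp: is_vector_partition_def)
    moreover have "w i \<in> P \<rightarrow>\<^sub>E Pow {1..n}" "w' i \<in> P \<rightarrow>\<^sub>E Pow {1..n}" if "i \<in> {1..s}" for i
      using calculation(2,3) that by (blast intro: PiE_mem)+
    ultimately have "w i = w' i" if "i \<in> {1..s}" for i using that by (metis PiE_ext)
    hence "w = w'" using \<open>w \<in> _\<close> \<open>w' \<in> _\<close> by (intro PiE_ext) auto
    thus ?thesis using x y PP by simp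
  qed
qed

text \<open>A block is determined by its part, so inverting \<open>\<lambda>b. b 0\<close> on
  \<open>X\<close> recovers the labels of each part.\<close>

lemma blocks_surj:
  assumes "is_state s (full s n) X"
  shows "\<exists>x\<in>vparts n s. x \<noteq> Zero_hat \<and> blocks s x = X"
proof -
  define P where "P = (\<lambda>b. b 0) ` X"
  define g where "g = inv_into X (\<lambda>b. b 0)"
  define w where "w = (\<lambda>i\<in>{1..s}. \<lambda>B\<in>P. g B i)"
  have inj: "inj_on (\<lambda>b. b i) X" if "i \<le> s" for i using is_state_inj[OF assms that] .
  have g: "g (b 0) = b" if "b \<in> X" for b unfolding g_def using inv_into_f_f[OF inj[of 0] that] by simp
  have full: "full s n i = {1..n}" if "i \<le> s" for i using that by (simp add: full_def)
  have part: "partition_on {1..n} ((\<lambda>b. b i) ` X)" if i: "i \<le> s" for i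
    unfolding partition_on_def
  proof (intro conjI)
    show "\<Union> ((\<lambda>b. b i) ` X) = {1..n}" using assms i full[OF i] by (simp add: is_state_def)
    show "disjoint ((\<lambda>b. b i) ` X)" unfolding disjoint_def using assms i
      unfolding is_state_def by (metis (no_types, lifting) imageE)
    show "{} \<notin> (\<lambda>b. b i) ` X" using is_block_nonempty[OF is_state_block[OF assms]] i by (auto; metis)
  qed
  have wi: "w i ` P = (\<lambda>b. b i) ` X" "inj_on (w i) P" if i: "i \<in> {1..s}" for i
  proof -
    have e: "w i (b 0) = b i" if "b \<in> X" for b using g[OF that] i that by (simp add: w_def P_def)
    show "w i ` P = (\<lambda>b. b i) ` X" using e by (auto simp: P_def image_image)
    show "inj_on (w i) P"
    proof (rule inj_onI)
      fix A B assume "A \<in> P" "B \<in> P" and eq: "w i A = w i B"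
      then obtain a b where ab: "a \<in> X" "b \<in> X" "A = a 0" "B = b 0" by (auto simp: P_def)
      hence "a i = b i" using e eq by simp
      hence "a = b" using inj[of i] ab i by (auto dest: inj_onD)
      thus "A = B" using ab by simp
    qed
  qed
  have "is_vector_partition n s P w" unfolding is_vector_partition_def
  proof (intro conjI ballI)
    show "partition_on {1..n} P" using part[of 0] by (simp add: P_def)
    show "w \<in> {1..s} \<rightarrow>\<^sub>E (P \<rightarrow>\<^sub>E Pow {1..n})"
      using is_state_subset[OF assms] g full by (fastforce simp: w_def P_def)
    fix i assume i: "i \<in> {1..s}"
    show "inj_on (w i) P" "partition_on {1..n} (w i ` P)" using wi[OF i] part[of i] i by auto
    fix B assume "B \<in> P"
    then obtain b where b: "b \<in> X" "B = b 0" by (auto simp: P_def)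
    hence "w i B = b i" using i g by (simp add: w_def P_def)
    moreover have "card (b i) = card (b 0)" using i by (intro is_block_card[OF is_state_block[OF assms b(1)]]) simp
    ultimately show "card (w i B) = card B" using b(2) by metis
  qed
  moreover have "blocks s (VP P w) = X"
  proof -
    have "(\<lambda>i\<in>{..s}. if i = 0 then b 0 else w i (b 0)) = b" if b: "b \<in> X" for b
    proof
      fix i show "(\<lambda>i\<in>{..s}. if i = 0 then b 0 else w i (b 0)) i = b i"
        using g[OF b] b is_block_undefined[OF is_state_block[OF assms b]] by (auto simp: w_def P_def)
    qed
    thus ?thesis by (simp add: P_def image_image)
  qed
  ultimately show ?thesis by (intro bexI[of _ "VP P w"]) (auto simp: vparts_def)
qed

text \<open>\<open>vle\<close> asks for equality of each label with a union, \<open>refines\<close>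
  only for inclusion. The two agree because both states cover the same total, so
  \<open>refines_Union\<close> turns inclusion into equality.\<close>

lemma vle_iff_refines:
  assumes "x \<in> vparts n s" "y \<in> vparts n s" "0 < n"
  shows "vle s x y \<longleftrightarrow> refines (blocks s x) (blocks s y)"
proof (cases "x = Zero_hat \<or> y = Zero_hat")
  case True
  thus ?thesis using blocks_eq_empty_iff[OF assms(1,3)] blocks_eq_empty_iff[OF assms(2,3)]
    by (cases x; cases y) (auto simp: refines_def)
next
  case False
  then obtain P w P' w' where x: "x = VP P w" and y: "y = VP P' w'" using assms(1,2) by (auto simp: vparts_def)
  note sx = blocks_state[OF assms(1)] and sy = blocks_state[OF assms(2)]
  define bx where "bx = (\<lambda>B. \<lambda>i\<in>{..s}. if i = 0 then B else w i B)"
  define by' where "by' = (\<lambda>B. \<lambda>i\<in>{..s}. if i = 0 then B else w' i B)"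
  have X: "blocks s x = bx ` P" "blocks s y = by' ` P'" by (auto simp: x y bx_def by'_def)
  have b0: "bx B 0 = B" "by' B 0 = B" for B by (auto simp: bx_def by'_def)
  have bi: "bx B i = w i B" "by' B i = w' i B" if "i \<in> {1..s}" for B i using that by (auto simp: bx_def by'_def)
  show ?thesis
  proof
    assume le: "vle s x y"
    show "refines (blocks s x) (blocks s y)" unfolding refines_def
    proof
      fix b assume b: "b \<in> blocks s x"
      then obtain B where B: "B \<in> P" "b = bx B" using X by auto
      obtain k where k: "k \<in> B" using is_block_nonempty[OF is_state_block[OF sx b], of 0] B False b0 by auto
      have "k \<in> full s n 0" using is_state_subset[OF sx b, of 0] k B b0 False by auto
      then obtain d where d: "d \<in> blocks s y" "k \<in> d 0" using is_state_cover[OF sy, of 0] False by auto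
      then obtain B' where B': "B' \<in> P'" "d = by' B'" "k \<in> B'" using X b0 by auto
      obtain S where S: "S \<subseteq> P" "B' = \<Union>S" and w': "\<forall>i\<in>{1..s}. w' i B' = (\<Union>B\<in>{B\<in>P. B \<subseteq> B'}. w i B)"
        using le B'(1) by (auto simp: x y)
      obtain B2 where B2: "B2 \<in> S" "k \<in> B2" using S B' by auto
      have "bx B2 = b" using is_state_unique[OF sx _ b, of "bx B2" 0 k] X S B2 b0 B k False by auto
      hence "B2 = B" using B b0 by metis
      hence BB: "B \<subseteq> B'" using B2 S by auto
      have "b \<le> d"
      proof (rule le_funI)
        fix i
        consider "i = 0" | "i \<in> {1..s}" | "\<not> i \<le> s" by fastforce
        thus "b i \<le> d i"
        proof cases
          case 1 thus ?thesis using BB B(2) B'(2) b0 by simp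
        next
          case 2
          have "w' i B' = (\<Union>B\<in>{B\<in>P. B \<subseteq> B'}. w i B)" using w' 2 by blast
          hence "w i B \<subseteq> w' i B'" using BB B(1) by blast
          thus ?thesis using 2 B(2) B'(2) bi by simp
        next
          case 3 thus ?thesis by (simp add: B(2) B'(2) bx_def by'_def)
        qed
      qed
      thus "\<exists>c\<in>blocks s y. b \<le> c" using d by blast
    qed
  next
    assume r: "refines (blocks s x) (blocks s y)"
    have "(\<exists>S\<subseteq>P. B' = \<Union>S) \<and> (\<forall>i\<in>{1..s}. w' i B' = (\<Union>B\<in>{B\<in>P. B \<subseteq> B'}. w i B))" if B': "B' \<in> P'" for B'
    proof -
      have d: "by' B' \<in> blocks s y" using B' X by auto
      have sub: "bx B \<le> by' B' \<longleftrightarrow> B \<subseteq> B'" if B: "B \<in> P" for B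
      proof
        assume "bx B \<le> by' B'" thus "B \<subseteq> B'" using b0 by (metis le_funD)
      next
        assume "B \<subseteq> B'"
        moreover obtain k where "k \<in> B" using is_block_nonempty[OF is_state_block[OF sx, of "bx B"], of 0] B False b0 X by auto
        ultimately show "bx B \<le> by' B'"
          using refines_below[OF sx sy r _ d, of "bx B" 0 k] False X B b0 by auto
      qed
      have u: "by' B' i = (\<Union>B\<in>{B\<in>P. B \<subseteq> B'}. bx B i)" if "i \<le> s" for i
        using refines_Union[OF sx sy r d that] False sub X by auto
      have e: "{B\<in>P. B \<subseteq> B'} \<subseteq> P" by blast
      have e1: "B' = (\<Union>B\<in>{B\<in>P. B \<subseteq> B'}. B)" using u[of 0, OF le0] unfolding b0 .
      have e2: "\<forall>i\<in>{1..s}. w' i B' = (\<Union>B\<in>{B\<in>P. B \<subseteq> B'}. w i B)"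
      proof
        fix i assume i: "i \<in> {1..s}"
        hence "i \<le> s" by simp
        from u[OF this] show "w' i B' = (\<Union>B\<in>{B\<in>P. B \<subseteq> B'}. w i B)" unfolding bi[OF i] .
      qed
      have "\<exists>S\<subseteq>P. B' = \<Union>S"
        by (rule exI[of _ "{B\<in>P. B \<subseteq> B'}"], rule conjI[OF e]) (use e1 in \<open>unfold image_ident\<close>)
      thus ?thesis using e2 by (rule conjI)
    qed
    thus "vle s x y" unfolding x y vle.simps by (rule ballI)
  qed
qed

section \<open>Least atoms and edge labels\<close>

lemma map_le_map_lex:
  fixes f g :: "'a \<Rightarrow> 'b::linorder"
  assumes "\<And>ys x zs. xs = ys @ x # zs \<Longrightarrow> (\<forall>y\<in>set ys. f y = g y) \<Longrightarrow> f x \<le> g x"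
  shows "map f xs \<le> map g xs"
  using assms
proof (induction xs)
  case (Cons a xs)
  have a: "f a \<le> g a" using Cons.prems[of "[]"] by simp
  show ?case
  proof (cases "f a = g a")
    case True
    have "map f xs \<le> map g xs"
    proof (rule Cons.IH)
      fix ys x zs assume "xs = ys @ x # zs" "\<forall>y\<in>set ys. f y = g y"
      thus "f x \<le> g x" using Cons.prems[of "a # ys" x zs] True by simp
    qed
    thus ?thesis using True by simp
  qed (use a in simp)
qed simp

text \<open>Both functions, applied to the sorted list of \<open>A\<close>, give the sorted list of
  the common image.\<close>

lemma strict_mono_on_image_unique:
  fixes f g :: "nat \<Rightarrow> nat"
  assumes "finite A" "strict_mono_on A f" "strict_mono_on A g" "f ` A = g ` A" "x \<in> A"
  shows "f x = g x"
proof -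
  let ?l = "sorted_list_of_set A"
  have s: "sorted_wrt (<) (map h ?l)" if "strict_mono_on A h" for h :: "nat \<Rightarrow> nat"
    unfolding sorted_wrt_map
    by (rule sorted_wrt_mono_rel[OF _ strict_sorted_list_of_set[of A]])
       (use that assms(1) in \<open>auto simp: strict_mono_on_def\<close>)
  have "map f ?l = map g ?l"
    by (rule strict_sorted_equal[OF s[OF assms(3)] s[OF assms(2)]]) (use assms in simp)
  thus ?thesis using assms(1,5) by simp
qed

lemma strict_mono_on_exists:
  fixes A B :: "nat set"
  assumes "finite A" "finite B" "card A = card B"
  shows "\<exists>f. strict_mono_on A f \<and> f ` A = B"
  using assms
proof (induction A arbitrary: B rule: finite_linorder_max_induct)
  case empty thus ?case by (auto simp: strict_mono_on_def)
next
  case (insert a A)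
  have a: "a \<notin> A" using insert.hyps by auto
  hence "card B = Suc (card A)" using insert by simp
  hence "B \<noteq> {}" by auto
  hence B: "B \<noteq> {}" "Max B \<in> B" using insert.prems by auto
  have "card A = card (B - {Max B})" using B insert.prems a insert.hyps by simp
  then obtain f where f: "strict_mono_on A f" "f ` A = B - {Max B}"
    using insert.IH[of "B - {Max B}"] insert.prems by auto
  have lt: "f x < Max B" if "x \<in> A" for x
  proof -
    have "f x \<in> B" "f x \<noteq> Max B" using f(2) that by auto
    thus ?thesis using insert.prems Max_ge[of B "f x"] le_neq_trans by blast
  qed
  have "strict_mono_on (insert a A) (f(a := Max B))"
    using f(1) lt insert.hyps a unfolding strict_mono_on_def by (auto dest: less_asym)
  moreover have "(f(a := Max B)) ` insert a A = B" using f(2) a B by auto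
  ultimately show ?case by blast
qed

lemma strict_mono_on_image_Min:
  fixes f :: "nat \<Rightarrow> nat"
  assumes "strict_mono_on A f" "finite A" "A \<noteq> {}"
  shows "f (Min A) = Min (f ` A)"
proof -
  have "f (Min A) \<le> f x" if "x \<in> A" for x
    using strict_mono_onD[OF assms(1) Min_in[OF assms(2,3)] that] Min_le[OF assms(2) that]
    by (cases "Min A = x") (auto intro: less_imp_le simp del: Min_le_iff Min_less_iff)
  thus ?thesis using assms by (intro Min_eqI[symmetric]) auto
qed

text \<open>The value \<open>g k\<close> equals \<open>f l\<close> for some \<open>l\<close>, and
  \<open>l < k\<close> is impossible since \<open>g\<close> has already used
  \<open>f l = g l\<close> there. So the increasing enumeration is smallest at the first place of
  difference.\<close>

lemma strict_mono_on_greedy: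
  fixes f g :: "nat \<Rightarrow> nat"
  assumes f: "strict_mono_on A f" "f ` A = B" and g: "inj_on g A" "g ` A \<subseteq> B"
    and "k \<in> A" "\<And>l. l \<in> A \<Longrightarrow> l < k \<Longrightarrow> f l = g l"
  shows "f k \<le> g k"
proof -
  have "g k \<in> f ` A" using g f assms by auto
  then obtain l where l: "l \<in> A" "g k = f l" by auto
  have "\<not> l < k"
  proof
    assume "l < k"
    hence "g l = g k" using l assms(6) by auto
    hence "l = k" using inj_onD[OF g(1) _ l(1) assms(5)] by simp
    thus False using \<open>l < k\<close> by simp
  qed
  thus ?thesis using f(1) l assms(5) unfolding strict_mono_on_def
    by (cases "k = l") (auto intro: less_imp_le)
qed

section \<open>Atoms and the least atom below an element\<close>

definition atom_state :: "nat \<Rightarrow> nat \<Rightarrow> (nat \<Rightarrow> nat \<Rightarrow> nat) \<Rightarrow> block set" where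
  "atom_state n s e = (\<lambda>k. \<lambda>i\<in>{..s}. {if i = 0 then k else e i k}) ` {1..n}"

lemma full_simps: "i \<le> s \<Longrightarrow> full s n i = {1..n}" "finite (full s n 0)" "card (full s n 0) = n"
  by (simp_all add: full_def)

lemma atom_state_is_state:
  assumes "\<And>i. i \<in> {1..s} \<Longrightarrow> bij_betw (e i) {1..n} {1..n}"
  shows "is_state s (full s n) (atom_state n s e)"
  unfolding is_state_def
proof (intro conjI ballI impI allI)
  fix b assume "b \<in> atom_state n s e"
  thus "is_block s b" by (auto simp: atom_state_def is_block_def)
next
  fix b c i assume bc: "b \<in> atom_state n s e" "c \<in> atom_state n s e" "b \<noteq> c" and i: "i \<le> s"
  then obtain k l where kl: "k \<in> {1..n}" "l \<in> {1..n}" "b = (\<lambda>i\<in>{..s}. {if i = 0 then k else e i k})"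
    "c = (\<lambda>i\<in>{..s}. {if i = 0 then l else e i l})" by (auto simp: atom_state_def)
  hence "k \<noteq> l" using bc by auto
  thus "b i \<inter> c i = {}" using kl i assms[of i]
    by (cases "i = 0") (auto simp: bij_betw_def dest: inj_onD)
next
  fix i assume i: "i \<le> s"
  have "(\<Union>b\<in>atom_state n s e. b i) = (\<lambda>k. if i = 0 then k else e i k) ` {1..n}"
    using i by (auto simp: atom_state_def)
  also have "\<dots> = {1..n}" using assms[of i] i by (cases "i = 0") (auto simp: bij_betw_def)
  finally show "(\<Union>b\<in>atom_state n s e. b i) = full s n i" using i by (simp add: full_def)
qed

lemma vatoms_iff:
  assumes "0 < n" shows "a \<in> vatoms n s \<longleftrightarrow> a \<in> vparts n s \<and> card (blocks s a) = n"
proof (cases "a \<in> vparts n s \<and> a \<noteq> Zero_hat")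
  case False
  thus ?thesis using blocks_eq_empty_iff[OF _ assms, of a s] assms by (auto simp: vatoms_def)
next
  case True
  then obtain P w where a: "a = VP P w" by (auto simp: vparts_def)
  note st = blocks_state[OF conjunct1[OF True] conjunct2[OF True]]
  have P: "P = (\<lambda>b. b 0) ` blocks s a" by (auto simp: a image_image)
  have "card (blocks s a) = n \<longleftrightarrow> (\<forall>B\<in>P. card B = 1)"
    using is_state_card_eq_iff[OF st full_simps(2)] unfolding P full_simps by simp
  also have "\<dots> \<longleftrightarrow> P = (\<lambda>k. {k}) ` {1..n}"
  proof
    assume *: "\<forall>B\<in>P. card B = 1"
    show "P = (\<lambda>k. {k}) ` {1..n}"
    proof (intro equalityI subsetI)
      fix B assume B: "B \<in> P"
      then obtain k where "B = {k}" using * by (metis card_1_singletonE)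
      moreover have "B \<subseteq> {1..n}" using B P is_state_subset[OF st, of _ 0] full_simps(1)[of 0] by auto
      ultimately show "B \<in> (\<lambda>k. {k}) ` {1..n}" by auto
    next
      fix B assume "B \<in> (\<lambda>k. {k}) ` {1..n}"
      then obtain k where k: "k \<in> {1..n}" "B = {k}" by auto
      then obtain b where b: "b \<in> blocks s a" "k \<in> b 0" using is_state_cover[OF st, of 0 k] full_simps(1)[of 0] by auto
      hence "b 0 \<in> P" using P by auto
      hence "b 0 = B" using * b k by (metis card_1_singletonE singletonD)
      thus "B \<in> P" using \<open>b 0 \<in> P\<close> by simp
    qed
  qed auto
  finally show ?thesis using True by (auto simp: vatoms_def a)
qed

lemma blocks_vatoms:
  assumes "0 < n" "a \<in> vatoms n s" shows "blocks s a = atom_state n s (atom_entry a)"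
proof -
  have a: "a \<in> vparts n s" "a \<noteq> Zero_hat" "parts a = (\<lambda>k. {k}) ` {1..n}" using assms(2) by (auto simp: vatoms_def)
  then obtain P w where aw: "a = VP P w" by (auto simp: vparts_def)
  have P: "P = (\<lambda>k. {k}) ` {1..n}" using a aw by simp
  note st = blocks_state[OF a(1,2)]
  have "w i {k} = {atom_entry a i k}" if "i \<in> {1..s}" "k \<in> {1..n}" for i k
  proof -
    have "(\<lambda>i\<in>{..s}. if i = 0 then {k} else w i {k}) \<in> blocks s a" using that by (auto simp: aw P)
    note bk = is_state_block[OF st this]
    have "i \<le> s" "i \<noteq> 0" using that by auto
    with is_block_card[OF bk \<open>i \<le> s\<close>] have "card (w i {k}) = 1" by simp
    then obtain l where "w i {k} = {l}" by (rule card_1_singletonE)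
    thus ?thesis by (simp add: atom_entry_def aw)
  qed
  hence "(\<lambda>i\<in>{..s}. if i = 0 then {k} else w i {k}) = (\<lambda>i\<in>{..s}. {if i = 0 then k else atom_entry a i k})"
    if "k \<in> {1..n}" for k using that by (auto simp: restrict_def fun_eq_iff)
  hence "(\<lambda>k. \<lambda>i\<in>{..s}. if i = 0 then {k} else w i {k}) ` {1..n} = atom_state n s (atom_entry a)"
    unfolding atom_state_def by (rule image_cong[OF refl])
  thus ?thesis by (simp add: aw P image_image)
qed

lemma atom_entry_inj:
  assumes "0 < n" "a \<in> vatoms n s" "i \<in> {1..s}"
  shows "inj_on (atom_entry a i) {1..n}"
proof (rule inj_onI)
  fix k l assume kl: "k \<in> {1..n}" "l \<in> {1..n}" "atom_entry a i k = atom_entry a i l"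
  have st: "is_state s (full s n) (atom_state n s (atom_entry a))"
    using blocks_state[of a n s] assms blocks_vatoms[OF assms(1,2)] by (auto simp: vatoms_def)
  let ?b = "\<lambda>k. \<lambda>i\<in>{..s}. {if i = 0 then k else atom_entry a i k}"
  have "?b k = ?b l" using kl assms(3)
    by (intro is_state_unique[OF st, of _ _ i "atom_entry a i k"]) (auto simp: atom_state_def)
  from fun_cong[OF this, of 0] show "k = l" by simp
qed

lemma vatoms_vle_iff:
  assumes "0 < n" "a \<in> vatoms n s" "x \<in> vparts n s" "x \<noteq> Zero_hat"
  shows "vle s a x \<longleftrightarrow> (\<forall>b\<in>blocks s x. \<forall>k\<in>b 0. \<forall>i\<in>{1..s}. atom_entry a i k \<in> b i)"
proof -
  let ?b = "\<lambda>k. \<lambda>i\<in>{..s}. {if i = 0 then k else atom_entry a i k}"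
  have a: "a \<in> vparts n s" using assms(2) by (simp add: vatoms_def)
  note st = blocks_state[OF assms(3,4)]
  have iff: "?b k \<le> b \<longleftrightarrow> k \<in> b 0 \<and> (\<forall>i\<in>{1..s}. atom_entry a i k \<in> b i)" if b: "b \<in> blocks s x" for b k
  proof
    assume le: "?b k \<le> b"
    have "?b k i \<subseteq> b i" for i using le by (simp add: le_fun_def)
    from this[of 0] this show "k \<in> b 0 \<and> (\<forall>i\<in>{1..s}. atom_entry a i k \<in> b i)" by fastforce
  next
    assume r: "k \<in> b 0 \<and> (\<forall>i\<in>{1..s}. atom_entry a i k \<in> b i)"
    show "?b k \<le> b"
    proof (rule le_funI)
      fix i
      show "?b k i \<le> b i"
        using r is_block_undefined[OF is_state_block[OF st b], of i] by (cases "i = 0"; cases "i \<le> s") auto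
    qed
  qed
  have "vle s a x \<longleftrightarrow> (\<forall>k\<in>{1..n}. \<exists>b\<in>blocks s x. ?b k \<le> b)"
    by (simp add: vle_iff_refines[OF a assms(3,1)] refines_def blocks_vatoms[OF assms(1,2)] atom_state_def)
  also have "\<dots> \<longleftrightarrow> (\<forall>b\<in>blocks s x. \<forall>k\<in>b 0. \<forall>i\<in>{1..s}. atom_entry a i k \<in> b i)"
  proof
    assume *: "\<forall>k\<in>{1..n}. \<exists>b\<in>blocks s x. ?b k \<le> b"
    show "\<forall>b\<in>blocks s x. \<forall>k\<in>b 0. \<forall>i\<in>{1..s}. atom_entry a i k \<in> b i"
    proof (intro ballI)
      fix b k i assume b: "b \<in> blocks s x" "k \<in> b 0" "i \<in> {1..s}"
      have "k \<in> {1..n}" using is_state_subset[OF st b(1), of 0] b(2) full_simps(1)[of 0] by auto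
      then obtain c where c: "c \<in> blocks s x" "?b k \<le> c" using * by blast
      hence "c = b" using iff[OF c(1)] is_state_unique[OF st c(1) b(1), of 0 k] b(2) by simp
      thus "atom_entry a i k \<in> b i" using iff[OF c(1)] c b(3) by blast
    qed
  next
    assume *: "\<forall>b\<in>blocks s x. \<forall>k\<in>b 0. \<forall>i\<in>{1..s}. atom_entry a i k \<in> b i"
    show "\<forall>k\<in>{1..n}. \<exists>b\<in>blocks s x. ?b k \<le> b"
    proof
      fix k assume "k \<in> {1..n}"
      then obtain b where b: "b \<in> blocks s x" "k \<in> b 0" using is_state_cover[OF st, of 0 k] full_simps(1)[of 0] by auto
      thus "\<exists>b\<in>blocks s x. ?b k \<le> b" using iff * by blast
    qed
  qed
  finally show ?thesis .
qed

text \<open>The positions of the word become a sorted list of pairs, so that an earlier position is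
  simply a smaller pair.\<close>

lemma atom_word_alt:
  "atom_word n s a = map (\<lambda>(i, k). atom_entry a i k) (List.product [1..<Suc s] [1..<Suc n])"
proof -
  have "concat (map (\<lambda>i. map (atom_entry a i) ks) is) = map (\<lambda>(i, k). atom_entry a i k) (List.product is ks)"
    for "is" ks by (induction "is") auto
  thus ?thesis by (simp only: atom_word_def)
qed

lemma sorted_product:
  fixes xs :: "'a::linorder list" and ys :: "'b::linorder list"
  assumes "sorted_wrt (<) xs" "sorted_wrt (<) ys"
  shows "sorted_wrt (<) (List.product xs ys)"
  using assms by (induction xs) (auto simp: sorted_wrt_append sorted_wrt_map)

text \<open>The increasing enumerations of all labels are glued to functions \<open>e i\<close> on
  the whole ground set; they define an atom \<open>a\<close> below \<open>x\<close>, and the greedy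
  argument shows that its word is least.\<close>

lemma least_atom_props:
  assumes "0 < n" "x \<in> vparts n s" "x \<noteq> Zero_hat"
  shows "least_atom n s x \<in> vatoms n s" and "vle s (least_atom n s x) x"
    and "b \<in> blocks s x \<Longrightarrow> i \<in> {1..s} \<Longrightarrow>
      strict_mono_on (b 0) (entry n s x i) \<and> entry n s x i ` b 0 = b i"
proof -
  note st = blocks_state[OF assms(2,3)]
  have "\<exists>f. strict_mono_on (b 0) f \<and> f ` b 0 = b i" if "b \<in> blocks s x" "i \<le> s" for b i
  proof -
    note bk = is_state_block[OF st that(1)]
    show ?thesis
      by (rule strict_mono_on_exists[OF is_block_finite[OF bk le0] is_block_finite[OF bk that(2)]
        is_block_card[OF bk that(2), symmetric]])
  qed
  then obtain h where h: "\<And>b i. b \<in> blocks s x \<Longrightarrow> i \<le> s \<Longrightarrow> strict_mono_on (b 0) (h b i) \<and> h b i ` b 0 = b i"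
    by metis
  define B where "B k = (THE b. b \<in> blocks s x \<and> k \<in> b 0)" for k
  define e where "e i k = h (B k) i k" for i k
  have B: "B k = b" if "b \<in> blocks s x" "k \<in> b 0" for b k
    unfolding B_def
  proof (rule the_equality)
    fix c assume "c \<in> blocks s x \<and> k \<in> c 0"
    thus "c = b" using is_state_unique[OF st _ that(1) le0 _ that(2)] by blast
  qed (use that in simp)
  have e: "strict_mono_on (b 0) (e i)" "e i ` b 0 = b i" if "b \<in> blocks s x" "i \<le> s" for b i
    using h[OF that] B[OF that(1)] by (auto simp: e_def strict_mono_on_def)
  have bij: "bij_betw (e i) {1..n} {1..n}" if i: "i \<in> {1..s}" for i
  proof -
    have "e i ` {1..n} = e i ` (\<Union>b\<in>blocks s x. b 0)" using st by (simp add: is_state_def full_def)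
    also have "\<dots> = (\<Union>b\<in>blocks s x. b i)" using e(2)[of _ i] i by (simp add: image_UN)
    also have "\<dots> = {1..n}" using st i by (simp add: is_state_def full_def)
    finally show ?thesis by (simp add: bij_betw_def eq_card_imp_inj_on)
  qed
  obtain a where a: "a \<in> vparts n s" "blocks s a = atom_state n s e"
    using blocks_surj[OF atom_state_is_state[of s e n]] bij by blast
  have "inj_on (\<lambda>k. \<lambda>i\<in>{..s}. {if i = 0 then k else e i k}) {1..n}"
    by (rule inj_onI, drule fun_cong[of _ _ 0]) simp
  hence "card (blocks s a) = n" by (simp add: a(2) atom_state_def card_image)
  hence at: "a \<in> vatoms n s" using a vatoms_iff[OF assms(1)] by blast
  have ae: "atom_entry a i k = e i k" if "i \<in> {1..s}" "k \<in> {1..n}" for i k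
  proof -
    have "(\<lambda>i\<in>{..s}. {if i = 0 then k else atom_entry a i k}) \<in> atom_state n s e"
      using blocks_vatoms[OF assms(1) at] a(2) that by (auto simp: atom_state_def)
    then obtain l where l: "(\<lambda>i\<in>{..s}. {if i = 0 then k else atom_entry a i k}) = (\<lambda>i\<in>{..s}. {if i = 0 then l else e i l})"
      by (auto simp: atom_state_def)
    from fun_cong[OF l, of 0] fun_cong[OF l, of i] that show ?thesis by simp
  qed
  have sub: "b 0 \<subseteq> {1..n}" if "b \<in> blocks s x" for b
    using is_state_subset[OF st that, of 0] full_simps(1)[of 0] by simp
  have ax: "vle s a x" unfolding vatoms_vle_iff[OF assms(1) at assms(2,3)]
  proof (intro ballI)
    fix b k i assume bki: "b \<in> blocks s x" "k \<in> b 0" "i \<in> {1..s}"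
    hence "k \<in> {1..n}" using sub by blast
    hence "atom_entry a i k = e i k" using ae bki by blast
    thus "atom_entry a i k \<in> b i" using e(2)[of b i] bki by auto
  qed
  have min: "atom_word n s a \<le> atom_word n s a'" if a': "a' \<in> vatoms n s" "vle s a' x" for a'
    unfolding atom_word_alt
  proof (rule map_le_map_lex, clarify)
    fix ys i k zs
    assume dec: "List.product [1..<Suc s] [1..<Suc n] = ys @ (i, k) # zs"
      and eq: "\<forall>y\<in>set ys. (case y of (i, k) \<Rightarrow> atom_entry a i k) = (case y of (i, k) \<Rightarrow> atom_entry a' i k)"
    have "(i, k) \<in> set (List.product [1..<Suc s] [1..<Suc n])" unfolding dec by simp
    hence ik: "i \<in> {1..s}" "k \<in> {1..n}" by auto
    hence ile: "i \<le> s" by simp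
    have sorted: "sorted_wrt (<) (ys @ (i, k) # zs)" unfolding dec[symmetric]
      by (intro sorted_product sorted_wrt_upt)
    \<comment> \<open>Agreement at all earlier positions includes the smaller elements for the same
      label, which is all that the greedy comparison needs.\<close>
    have prev: "atom_entry a i l = atom_entry a' i l" if "l \<in> {1..n}" "l < k" for l
    proof -
      have "(i, l) \<in> set (ys @ (i, k) # zs)" unfolding dec[symmetric] using ik that by auto
      moreover have "(i, l) \<notin> set ((i, k) # zs)" using sorted that(2) by (auto simp: sorted_wrt_append)
      ultimately have "(i, l) \<in> set ys" by auto
      thus ?thesis using eq by auto
    qed
    obtain b where b: "b \<in> blocks s x" "k \<in> b 0" using is_state_cover[OF st, of 0 k] full_simps(1)[of 0] ik by auto
    have "e i k \<le> atom_entry a' i k"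
    proof (rule strict_mono_on_greedy[OF e[OF b(1) ile]])
      show "k \<in> b 0" by (rule b(2))
      show "inj_on (atom_entry a' i) (b 0)" using inj_on_subset[OF atom_entry_inj[OF assms(1) a'(1) ik(1)] sub[OF b(1)]] .
      show "atom_entry a' i ` b 0 \<subseteq> b i" using a' vatoms_vle_iff[OF assms(1) a'(1) assms(2,3)] b(1) ik by auto
      fix l assume l: "l \<in> b 0" "l < k"
      thus "e i l = atom_entry a' i l" using prev[of l] ae[of i l] ik sub[OF b(1)] by auto
    qed
    thus "atom_entry a i k \<le> atom_entry a' i k" using ae ik by simp
  qed
  \<comment> \<open>\<open>arg_min\<close> chooses some minimizer. It has the same word as
    \<open>a\<close>, and equal words mean equal entries, so the choice does not matter.\<close>
  have arg: "is_arg_min (atom_word n s) (\<lambda>a. a \<in> vatoms n s \<and> vle s a x) (least_atom n s x)"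
    unfolding least_atom_def arg_min_def
    by (rule someI[of _ a]) (use at ax min in \<open>auto simp: is_arg_min_def not_less\<close>)
  thus L: "least_atom n s x \<in> vatoms n s" "vle s (least_atom n s x) x" by (auto simp: is_arg_min_def)
  have "atom_word n s a = atom_word n s (least_atom n s x)"
    using arg at ax min[OF L] by (auto simp: is_arg_min_def not_less)
  hence en: "entry n s x i k = e i k" if "i \<in> {1..s}" "k \<in> {1..n}" for i k
    using that ae[OF that] unfolding atom_word_alt entry_def by (auto simp del: upt_Suc)
  show "strict_mono_on (b 0) (entry n s x i) \<and> entry n s x i ` b 0 = b i"
    if b: "b \<in> blocks s x" "i \<in> {1..s}" for b i
  proof -
    have "entry n s x i k = e i k" if "k \<in> b 0" for k using en sub[OF b(1)] b(2) that by auto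
    thus ?thesis using e[OF b(1), of i] b(2) by (auto simp: strict_mono_on_def)
  qed
qed

section \<open>Edge labels of merges\<close>

lemma least_atom_eqI:
  assumes "0 < n" "x \<in> vparts n s" "x \<noteq> Zero_hat" "y \<in> vparts n s" "y \<noteq> Zero_hat"
    and "\<And>i k. i \<in> {1..s} \<Longrightarrow> k \<in> {1..n} \<Longrightarrow> entry n s x i k = entry n s y i k"
  shows "least_atom n s x = least_atom n s y"
proof -
  note lx = least_atom_props(1)[OF assms(1-3)] and ly = least_atom_props(1)[OF assms(1,4,5)]
  have "blocks s (least_atom n s x) = blocks s (least_atom n s y)"
    unfolding blocks_vatoms[OF assms(1) lx] blocks_vatoms[OF assms(1) ly] atom_state_def
    using assms(6) by (intro image_cong refl) (auto simp: restrict_def fun_eq_iff entry_def)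
  thus ?thesis using blocks_inj[OF assms(1), of s] lx ly by (auto simp: vatoms_def dest: inj_onD)
qed

lemma first_change_props:
  assumes "0 < n" "x \<in> vparts n s" "x \<noteq> Zero_hat" "y \<in> vparts n s" "y \<noteq> Zero_hat"
    and "least_atom n s x \<noteq> least_atom n s y" "first_change n s x y = (k, i)"
  shows "k \<in> {1..n}" "i \<in> {1..s}" "entry n s x i k \<noteq> entry n s y i k"
proof -
  let ?P = "\<lambda>p. p \<in> {1..n} \<times> {1..s} \<and> (case p of (k, i) \<Rightarrow> entry n s x i k \<noteq> entry n s y i k)"
  have "\<exists>p. ?P p" using least_atom_eqI[OF assms(1-5)] assms(6) by fastforce
  hence "?P (first_change n s x y)" unfolding first_change_def by (rule LeastI_ex)
  thus "k \<in> {1..n}" "i \<in> {1..s}" "entry n s x i k \<noteq> entry n s y i k" using assms(7) by auto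
qed

text \<open>A common label \<open>(k, i, j)\<close> would say that the entry at
  \<open>(k, i)\<close> is \<open>j\<close> in \<open>y\<close> and also in \<open>z\<close>,
  although the second edge changes it. Only labels of edges that keep the least atom, which start
  with \<open>n\<close>, can repeat.\<close>

lemma edge_label_repeat:
  assumes "0 < n" "{x, y, z} \<subseteq> vparts n s" "Zero_hat \<notin> {x, y, z}"
    and "edge_label n s x y = edge_label n s y z"
  shows "fst (edge_label n s x y) = int n"
proof (rule ccontr)
  assume *: "fst (edge_label n s x y) \<noteq> int n"
  have eq: "least_atom n s x = least_atom n s y \<Longrightarrow> fst (edge_label n s x y) = int n"
    if "x \<noteq> Zero_hat" for x y using that by (simp add: edge_label_def)
  have ne: "least_atom n s x \<noteq> least_atom n s y" "least_atom n s y \<noteq> least_atom n s z"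
    using eq[of x y] eq[of y z] assms(3) * *[unfolded assms(4)] by blast+
  obtain k i where ki: "first_change n s x y = (k, i)" by fastforce
  obtain k' i' where ki': "first_change n s y z = (k', i')" by fastforce
  have "entry n s y i' k' \<noteq> entry n s z i' k'"
    using first_change_props(3)[OF _ _ _ _ _ ne(2) ki'] assms by auto
  thus False using assms(3,4) ne ki ki' by (auto simp: edge_label_def)
qed

context
  fixes n s x y b c
  assumes n: "0 < n" and x: "x \<in> vparts n s" and x0: "x \<noteq> Zero_hat" and y: "y \<in> vparts n s"
    and b: "b \<in> blocks s x" and c: "c \<in> blocks s x" and lt: "Min (b 0) < Min (c 0)"
    and Y: "blocks s y = merge b c (blocks s x)"
begin

private lemma y0: "y \<noteq> Zero_hat"
  using Y by (auto simp: merge_def)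

private lemma blk: "is_block s b" "is_block s c"
  using is_state_block[OF blocks_state[OF x x0]] b c by auto

private lemma sub: "b 0 \<subseteq> {1..n}" "c 0 \<subseteq> {1..n}"
  using is_state_subset[OF blocks_state[OF x x0], of _ 0] full_simps(1)[of 0] b c by auto

private lemma supY: "sup b c \<in> blocks s y"
  using Y by (simp add: merge_def)

private lemma fin: "i \<le> s \<Longrightarrow> finite (b i) \<and> finite (c i) \<and> b i \<noteq> {} \<and> c i \<noteq> {}"
  using blk is_block_finite is_block_nonempty by blast

private lemma Min0: "Min (b 0 \<union> c 0) = Min (b 0)"
  using lt fin[of 0] by (simp add: Min_Un)

private lemma minI: "Min (b 0) \<in> {1..n}" "Min (c 0) \<in> {1..n}"
  using sub fin[of 0] Min_in by (meson le0 subsetD)+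

private lemma unchanged:
  assumes "i \<in> {1..s}" "k \<in> {1..n}" "k \<notin> b 0" "k \<notin> c 0"
  shows "entry n s x i k = entry n s y i k"
proof -
  obtain d where d: "d \<in> blocks s x" "k \<in> d 0"
    using is_state_cover[OF blocks_state[OF x x0], of 0 k] full_simps(1)[of 0] assms by auto
  hence dy: "d \<in> blocks s y" using Y assms by (auto simp: merge_def)
  have "finite (d 0)" using is_state_block[OF blocks_state[OF x x0] d(1)] is_block_finite by blast
  thus ?thesis
    using strict_mono_on_image_unique[of "d 0" "entry n s x i" "entry n s y i" k] d
      least_atom_props(3)[OF n x x0 d(1) assms(1)] least_atom_props(3)[OF n y y0 dy assms(1)] by simp
qed

private lemma changed_ge:
  assumes "i \<in> {1..s}" "k \<in> {1..n}" "entry n s x i k \<noteq> entry n s y i k"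
  shows "Min (b 0) \<le> k"
proof -
  have "k \<in> b 0 \<or> k \<in> c 0" using unchanged assms by blast
  thus ?thesis using lt Min_le[of "b 0" k] Min_le[of "c 0" k] fin[of 0] by auto
qed

private lemma entry_Min:
  assumes "i \<in> {1..s}"
  shows "entry n s x i (Min (b 0)) = Min (b i)"
    "entry n s y i (Min (b 0)) = min (Min (b i)) (Min (c i))"
proof -
  have i: "i \<le> s" using assms by simp
  show "entry n s x i (Min (b 0)) = Min (b i)"
    using least_atom_props(3)[OF n x x0 b assms] strict_mono_on_image_Min[of "b 0" "entry n s x i"] fin[of 0] by simp
  have "entry n s y i (Min (b 0 \<union> c 0)) = Min (b i \<union> c i)"
    using least_atom_props(3)[OF n y y0 supY assms]
      strict_mono_on_image_Min[of "b 0 \<union> c 0" "entry n s y i"] fin[of 0] by simp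
  thus "entry n s y i (Min (b 0)) = min (Min (b i)) (Min (c i))"
    using fin[OF i] by (simp add: Min0 Min_Un)
qed

text \<open>Entries outside the two merged parts stay, so no change occurs before
  \<open>Min (b 0)\<close>. There the entries are the minima of the labels, and the first to drop is
  the \<open>i\<close>-th.\<close>

lemma edge_label_merge:
  assumes "i \<in> {1..s}" "Min (c i) < Min (b i)" "\<And>j. j \<in> {1..<i} \<Longrightarrow> \<not> Min (c j) < Min (b j)"
  shows "edge_label n s x y = (int (Min (b 0)), int i, int (Min (c i)))"
proof -
  have ch: "entry n s x i (Min (b 0)) \<noteq> entry n s y i (Min (b 0))"
    using entry_Min[OF assms(1)] assms(2) by simp
  have "first_change n s x y = (Min (b 0), i)" unfolding first_change_def
  proof (rule Least_equality)
    show "(Min (b 0), i) \<in> {1..n} \<times> {1..s} \<and>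
      (case (Min (b 0), i) of (k, i) \<Rightarrow> entry n s x i k \<noteq> entry n s y i k)"
      using minI assms(1) ch by simp
  next
    fix p assume p: "p \<in> {1..n} \<times> {1..s} \<and> (case p of (k, i) \<Rightarrow> entry n s x i k \<noteq> entry n s y i k)"
    obtain k j where kj: "p = (k, j)" by fastforce
    have le: "Min (b 0) \<le> k" using p kj changed_ge[of j k] by auto
    moreover have "i \<le> j" if "k = Min (b 0)"
    proof (rule ccontr)
      assume "\<not> i \<le> j"
      hence "\<not> Min (c j) < Min (b j)" using p kj assms(3) by auto
      thus False using p kj entry_Min[of j] that by auto
    qed
    ultimately show "(Min (b 0), i) \<le> p" unfolding kj less_eq_prod_simp by linarith
  qed
  moreover have "least_atom n s x \<noteq> least_atom n s y" using ch by (auto simp: entry_def)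
  ultimately show ?thesis using x0 entry_Min[OF assms(1)] assms(2) by (simp add: edge_label_def)
qed

text \<open>All minima stay in the labels of \<open>b\<close>, so the entries at
  \<open>Min (b 0)\<close> are kept and a first change, if any, comes later. This rules out such
  merges in decreasing chains: the first claim for a composite \<open>b\<close>, the second for a
  singleton.\<close>

lemma edge_label_late:
  assumes "\<And>i. i \<in> {1..s} \<Longrightarrow> \<not> Min (c i) < Min (b i)"
  shows "int (Min (b 0)) < fst (edge_label n s x y)"
    and "card (b 0) = 1 \<Longrightarrow> fst (edge_label n s x y) = int n"
proof -
  obtain k i where ki: "first_change n s x y = (k, i)" by fastforce
  have k: "Min (b 0) < k" if "least_atom n s x \<noteq> least_atom n s y"
  proof -
    note fc = first_change_props[OF n x x0 y y0 that ki]
    have "k \<noteq> Min (b 0)" using fc(3) entry_Min[OF fc(2)] assms[OF fc(2)] by auto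
    thus ?thesis using changed_ge[OF fc(2,1,3)] by simp
  qed
  have "Min (b 0) < n" using lt minI by simp
  thus "int (Min (b 0)) < fst (edge_label n s x y)" using k x0 ki by (auto simp: edge_label_def)
  assume card: "card (b 0) = 1"
  have "least_atom n s x = least_atom n s y"
  proof (rule ccontr)
    assume *: "least_atom n s x \<noteq> least_atom n s y"
    note fc = first_change_props[OF n x x0 y y0 * ki]
    have i: "i \<le> s" using fc(2) by simp
    define m where "m = Min (b 0)"
    have single: "B = {Min B}" if "card B = 1" for B :: "nat set"
      using that by (metis Min_singleton card_1_singletonE)
    have b0: "b 0 = {m}" unfolding m_def by (rule single[OF card])
    have bi: "b i = {Min (b i)}" by (rule single) (use card is_block_card[OF blk(1) i] in \<open>rule trans[rotated]\<close>)
    have px: "strict_mono_on (c 0) (entry n s x i)" "entry n s x i ` c 0 = c i"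
      using least_atom_props(3)[OF n x x0 c fc(2)] by auto
    have py: "strict_mono_on (b 0 \<union> c 0) (entry n s y i)" "entry n s y i ` (b 0 \<union> c 0) = b i \<union> c i"
      using least_atom_props(3)[OF n y y0 supY fc(2)] by auto
    have xm: "entry n s x i m = Min (b i)" using entry_Min(1)[OF fc(2)] by (simp add: m_def)
    have st: "is_state s (full s n) (blocks s x)" using blocks_state[OF x x0] .
    have bc: "b \<noteq> c" using lt by auto
    have "Min (b i) \<noteq> Min (c i)"
    proof
      assume "Min (b i) = Min (c i)"
      hence "Min (b i) \<in> b i \<inter> c i" using fin[OF i] Min_in by (metis IntI)
      thus False using is_state_unique[OF st b c i] bc by blast
    qed
    hence l: "Min (b i) < Min (c i)" using assms[OF fc(2)] by simp
    \<comment> \<open>The only element of \<open>b 0\<close> precedes \<open>c 0\<close> and its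
      entry precedes \<open>c i\<close>. Thus the old enumerations, put together, already are the
      increasing enumeration used by \<open>y\<close>.\<close>
    have "strict_mono_on (b 0 \<union> c 0) (entry n s x i)" unfolding strict_mono_on_def
    proof (intro allI impI)
      fix r t assume rt: "r \<in> b 0 \<union> c 0 \<and> t \<in> b 0 \<union> c 0 \<and> r < t"
      have "m \<le> k" if "k \<in> c 0" for k using lt Min_le[of "c 0" k] fin[of 0] that by (auto simp: m_def)
      hence t: "t \<in> c 0" using rt b0 by fastforce
      hence ti: "entry n s x i t \<in> c i" using px by auto
      show "entry n s x i r < entry n s x i t"
      proof (cases "r = m")
        case True
        thus ?thesis using xm l ti Min_le[of "c i" "entry n s x i t"] fin[OF i] by simp
      next
        case False
        thus ?thesis using px(1) rt t b0 by (auto simp: strict_mono_on_def)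
      qed
    qed
    moreover have "entry n s x i ` (b 0 \<union> c 0) = b i \<union> c i"
      by (subst bi, subst b0) (simp add: image_Un px(2) xm)
    moreover have "k \<in> b 0 \<union> c 0" using unchanged[OF fc(2,1)] fc(3) by blast
    ultimately have "entry n s x i k = entry n s y i k"
      using py fin[of 0] by (intro strict_mono_on_image_unique[of "b 0 \<union> c 0"]) auto
    thus False using fc(3) by simp
  qed
  thus "fst (edge_label n s x y) = int n" using x0 by (simp add: edge_label_def)
qed

end

section \<open>Covers and maximal chains\<close>

lemma blocks_cases:
  assumes "0 < n" "x \<in> vparts n s"
  obtains "x = Zero_hat" "blocks s x = {}"
  | "x \<noteq> Zero_hat" "blocks s x \<noteq> {}" "is_state s (full s n) (blocks s x)"
  using blocks_state[OF assms(2)] blocks_eq_empty_iff[OF assms(2,1)] by auto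

lemma finite_blocks:
  assumes "0 < n" "x \<in> vparts n s" shows "finite (blocks s x)"
  using assms by (cases rule: blocks_cases) (auto intro: is_state_finite full_simps(2))

lemma card_blocks_le:
  assumes "0 < n" "x \<in> vparts n s" shows "card (blocks s x) \<le> n"
  using is_state_card_le[OF blocks_state[OF assms(2)] full_simps(2)] assms(2)
  by (cases "x = Zero_hat") (simp_all add: full_simps)

lemma card_blocks_eq_0_iff:
  assumes "0 < n" "x \<in> vparts n s" shows "card (blocks s x) = 0 \<longleftrightarrow> x = Zero_hat"
  using finite_blocks[OF assms] blocks_eq_empty_iff[OF assms(2,1)] by simp

lemma vle_card:
  assumes "0 < n" "x \<in> vparts n s" "y \<in> vparts n s" "x \<noteq> Zero_hat" "vle s x y"
  shows "card (blocks s y) \<le> card (blocks s x)" "y \<noteq> Zero_hat"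
proof -
  show y: "y \<noteq> Zero_hat" using assms(4,5) by (cases x; cases y) auto
  show "card (blocks s y) \<le> card (blocks s x)"
    using refines_card(1)[OF blocks_state[OF assms(2,4)] blocks_state[OF assms(3) y]]
      assms vle_iff_refines[OF assms(2,3,1)] full_simps(2) by blast
qed

lemma vle_card_eq:
  assumes "0 < n" "x \<in> vparts n s" "y \<in> vparts n s" "vle s x y" "card (blocks s x) = card (blocks s y)"
  shows "x = y"
proof (cases "x = Zero_hat")
  case True thus ?thesis using assms card_blocks_eq_0_iff by metis
next
  case False
  note y = vle_card(2)[OF assms(1-3) False assms(4)]
  have "blocks s x = blocks s y"
    using refines_card(2)[OF blocks_state[OF assms(2) False] blocks_state[OF assms(3) y]]
      assms vle_iff_refines[OF assms(2,3,1)] full_simps(2) by blast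
  thus ?thesis using blocks_inj[OF assms(1)] assms(2,3) by (auto dest: inj_onD)
qed

lemma vless_card:
  assumes "0 < n" "x \<in> vparts n s" "y \<in> vparts n s" "x \<noteq> Zero_hat" "vless s x y"
  shows "card (blocks s y) < card (blocks s x)"
proof -
  have "vle s x y" "x \<noteq> y" using assms(5) by (auto simp: vless_def)
  thus ?thesis using vle_card(1)[OF assms(1-4)] vle_card_eq[OF assms(1-3)] by (metis le_neq_implies_less)
qed

text \<open>Some merge of two blocks of \<open>x\<close> still refines \<open>y\<close>, and a cover
  leaves no room between them. The minima differ by disjointness and \<open>merge\<close> is
  symmetric, so the orientation can be chosen.\<close>

lemma vcovers_merge:
  assumes "0 < n" "vcovers n s x y" "x \<noteq> Zero_hat"
  obtains b c where "b \<in> blocks s x" "c \<in> blocks s x" "Min (b 0) < Min (c 0)"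
    "blocks s y = merge b c (blocks s x)"
proof -
  have xy: "x \<in> vparts n s" "y \<in> vparts n s" "vle s x y" "x \<noteq> y"
    and btw: "\<And>z. z \<in> vparts n s \<Longrightarrow> vless s x z \<Longrightarrow> \<not> vless s z y"
    using assms(2) by (auto simp: vcovers_def vless_def)
  have y0: "y \<noteq> Zero_hat" using vle_card(2) assms xy by blast
  note sx = blocks_state[OF xy(1) assms(3)] and sy = blocks_state[OF xy(2) y0]
  have ref: "refines (blocks s x) (blocks s y)" using vle_iff_refines xy assms(1) by blast
  have ne: "blocks s x \<noteq> blocks s y" using blocks_inj[OF assms(1)] xy by (auto dest: inj_onD)
  obtain b c where bc: "b \<in> blocks s x" "c \<in> blocks s x" "b \<noteq> c" "refines (merge b c (blocks s x)) (blocks s y)"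
    using refines_merge[OF sx sy ref full_simps(2) ne] by blast
  obtain z where z: "z \<in> vparts n s" "blocks s z = merge b c (blocks s x)"
    using blocks_surj[OF merge_state[OF sx bc(1-3)]] by blast
  have "vle s x z" using vle_iff_refines[OF xy(1) z(1) assms(1)] merge_refines z(2) by simp
  moreover have "x \<noteq> z" using merge_card[OF sx bc(1-3) full_simps(2)] z(2) by auto
  ultimately have "\<not> vless s z y" using btw z(1) by (simp add: vless_def)
  hence eq: "blocks s y = merge b c (blocks s x)"
    using vle_iff_refines[OF z(1) xy(2) assms(1)] bc(4) z(2) by (auto simp: vless_def)
  have "Min (b 0) \<noteq> Min (c 0)"
  proof
    assume *: "Min (b 0) = Min (c 0)"
    have "Min (b 0) \<in> b 0" "Min (c 0) \<in> c 0"
      using is_state_block[OF sx] bc(1,2) by (auto simp: is_block_def intro!: Min_in)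
    thus False using is_state_unique[OF sx bc(1,2) le0] * bc(3) by simp
  qed
  moreover have "merge b c (blocks s x) = merge c b (blocks s x)"
    by (simp add: merge_def sup_commute insert_commute)
  ultimately show ?thesis using bc eq that by (metis linorder_neqE_nat)
qed

lemma vcovers_card:
  assumes "0 < n" "vcovers n s x y" "x \<noteq> Zero_hat"
  shows "card (blocks s x) = Suc (card (blocks s y))"
proof -
  obtain b c where bc: "b \<in> blocks s x" "c \<in> blocks s x" "Min (b 0) < Min (c 0)"
    "blocks s y = merge b c (blocks s x)" using vcovers_merge[OF assms] by blast
  have x: "x \<in> vparts n s" using assms(2) by (simp add: vcovers_def)
  have "b \<noteq> c" using bc by auto
  from merge_card[OF blocks_state[OF x assms(3)] bc(1,2) this full_simps(2)] bc(4)
  show ?thesis by simp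
qed

lemma vcoversI:
  assumes "0 < n" "x \<in> vparts n s" "y \<in> vparts n s" "vle s x y"
    and "card (blocks s x) = Suc (card (blocks s y))"
  shows "vcovers n s x y"
  unfolding vcovers_def
proof (intro conjI notI)
  have x0: "x \<noteq> Zero_hat" using assms(5) by auto
  show "vless s x y" using assms(4,5) by (auto simp: vless_def)
  assume "\<exists>z\<in>vparts n s. vless s x z \<and> vless s z y"
  then obtain z where z: "z \<in> vparts n s" "vless s x z" "vless s z y" by blast
  hence "z \<noteq> Zero_hat" using vle_card(2)[OF assms(1,2) z(1) x0] by (simp add: vless_def)
  hence "card (blocks s y) < card (blocks s z)" using vless_card assms(1,3) z by blast
  moreover have "card (blocks s z) < card (blocks s x)" using vless_card[OF assms(1,2) z(1) x0 z(2)] .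
  ultimately show False using assms(5) by simp
qed (use assms in auto)

text \<open>The least atom below \<open>y\<close> would otherwise lie strictly between.\<close>

lemma vcovers_Zero_hat:
  assumes "0 < n" "vcovers n s Zero_hat y" shows "y \<in> vatoms n s"
proof -
  have y: "y \<in> vparts n s" "y \<noteq> Zero_hat" using assms(2) by (auto simp: vcovers_def vless_def)
  note L = least_atom_props(1,2)[OF assms(1) y]
  have "least_atom n s y \<in> vparts n s" "least_atom n s y \<noteq> Zero_hat" using L(1) by (auto simp: vatoms_def)
  hence "least_atom n s y = y" using assms(2) L(2) by (auto simp: vcovers_def vless_def)
  thus ?thesis using L(1) by simp
qed

lemma vcovers_Zero_hatI:
  assumes "0 < n" "a \<in> vatoms n s" shows "vcovers n s Zero_hat a"
  unfolding vcovers_def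
proof (intro conjI notI)
  have a: "a \<in> vparts n s" "a \<noteq> Zero_hat" "card (blocks s a) = n"
    using assms vatoms_iff by (auto simp: vatoms_def)
  show "a \<in> vparts n s" "Zero_hat \<in> vparts n s" "vless s Zero_hat a" using a by (auto simp: vparts_def vless_def)
  assume "\<exists>z\<in>vparts n s. vless s Zero_hat z \<and> vless s z a"
  then obtain z where z: "z \<in> vparts n s" "vless s Zero_hat z" "vless s z a" by blast
  hence "z \<noteq> Zero_hat" by (auto simp: vless_def)
  thus False using vless_card[OF assms(1) z(1) a(1) _ z(3)] card_blocks_le[OF assms(1) z(1)] a(3) by simp
qed

lemma vtop_props:
  assumes "0 < n"
  shows "vtop n s \<in> vparts n s" "blocks s (vtop n s) = {full s n}"
proof -
  show "vtop n s \<in> vparts n s"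
    using assms by (auto simp: vtop_def vparts_def is_vector_partition_def partition_on_def)
  show "blocks s (vtop n s) = {full s n}" by (auto simp: vtop_def full_def restrict_def fun_eq_iff)
qed

lemma full_is_block: "0 < n \<Longrightarrow> is_block s (full s n)"
  by (auto simp: is_block_def full_def)

lemma state_le_full:
  assumes "is_state s W X" "is_block s W" "b \<in> X" shows "b \<le> W"
proof (rule le_funI)
  fix i
  show "b i \<le> W i" using is_state_subset[OF assms(1,3), of i]
      is_block_undefined[OF assms(2), of i] is_block_undefined[OF is_state_block[OF assms(1,3)], of i]
    by (cases "i \<le> s") auto
qed

lemma vle_vtop:
  assumes "0 < n" "x \<in> vparts n s" shows "vle s x (vtop n s)"
proof (cases "x = Zero_hat")
  case False
  show ?thesis unfolding vle_iff_refines[OF assms(2) vtop_props(1)[OF assms(1)] assms(1)] vtop_props(2)[OF assms(1)]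
    using state_le_full[OF blocks_state[OF assms(2) False] full_is_block[OF assms(1)]] by (simp add: refines_def)
qed simp

definition vcomp :: "nat \<Rightarrow> vpart \<Rightarrow> vpart \<Rightarrow> bool" where
  "vcomp s x y \<longleftrightarrow> vle s x y \<or> vle s y x"

lemma vle_refl: "0 < n \<Longrightarrow> x \<in> vparts n s \<Longrightarrow> vle s x x"
  by (simp add: vle_iff_refines refines_refl)

lemma vle_trans:
  assumes "0 < n" "x \<in> vparts n s" "y \<in> vparts n s" "z \<in> vparts n s" "vle s x y" "vle s y z"
  shows "vle s x z"
  using assms(5,6) refines_trans
  unfolding vle_iff_refines[OF assms(2,3,1)] vle_iff_refines[OF assms(3,4,1)] vle_iff_refines[OF assms(2,4,1)]
  by blast

lemma chain_iff:
  assumes "0 < n"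
  shows "pred_on.chain (vparts n s) (vless s) C \<longleftrightarrow> C \<subseteq> vparts n s \<and> (\<forall>x\<in>C. \<forall>y\<in>C. vcomp s x y)"
  unfolding pred_on.chain_def vcomp_def vless_def using vle_refl[OF assms, of _ s] by (auto; blast)

lemma card_comparable:
  assumes "0 < n" "x \<in> vparts n s" "y \<in> vparts n s" "vcomp s x y" "x \<noteq> Zero_hat"
    "card (blocks s y) \<le> card (blocks s x)" "y \<noteq> Zero_hat"
  shows "vle s x y"
proof (cases "vle s x y")
  case False
  hence yx: "vle s y x" using assms(4) by (simp add: vcomp_def)
  hence "card (blocks s x) = card (blocks s y)" using vle_card[OF assms(1,3,2,7) yx] assms(6) by simp
  hence "y = x" using vle_card_eq[OF assms(1,3,2) yx] by simp
  thus ?thesis using vle_refl assms by simp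
qed simp

lemma vparts_interpolate:
  assumes "0 < n" "x \<in> vparts n s" "y \<in> vparts n s" "x \<noteq> Zero_hat" "vle s x y"
    "card (blocks s y) \<le> m" "m \<le> card (blocks s x)"
  obtains z where "z \<in> vparts n s" "vle s x z" "vle s z y" "card (blocks s z) = m"
proof -
  note y0 = vle_card(2)[OF assms(1-5)]
  obtain Z where Z: "is_state s (full s n) Z" "refines (blocks s x) Z" "refines Z (blocks s y)" "card Z = m"
    using refines_interpolate[OF blocks_state[OF assms(2,4)] blocks_state[OF assms(3) y0] _ full_simps(2) assms(6,7)]
      vle_iff_refines[OF assms(2,3,1)] assms(5) by blast
  obtain z where "z \<in> vparts n s" "blocks s z = Z" using blocks_surj[OF Z(1)] by blast
  thus ?thesis using that Z vle_iff_refines assms(1-3) by metis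
qed

text \<open>Comparable elements with equally many blocks coincide, so a chain meeting all levels
  cannot be enlarged. Conversely, a missing level can be filled by interpolation.\<close>

lemma maximal_chain_iff:
  assumes n: "0 < n"
  shows "maximal_chain n s C \<longleftrightarrow> C \<subseteq> vparts n s \<and> (\<forall>x\<in>C. \<forall>y\<in>C. vcomp s x y) \<and>
    (\<forall>m\<le>n. \<exists>x\<in>C. card (blocks s x) = m)"
proof (intro iffI conjI)
  assume *: "C \<subseteq> vparts n s \<and> (\<forall>x\<in>C. \<forall>y\<in>C. vcomp s x y) \<and> (\<forall>m\<le>n. \<exists>x\<in>C. card (blocks s x) = m)"
  have False if chD: "pred_on.chain (vparts n s) (vless s) D" and CD: "C \<subset> D" for D
  proof -
    have D: "D \<subseteq> vparts n s" "\<And>x y. x \<in> D \<Longrightarrow> y \<in> D \<Longrightarrow> vcomp s x y" using chD chain_iff[OF n] by auto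
    obtain z where z: "z \<in> D" "z \<notin> C" using CD by blast
    obtain x where x: "x \<in> C" "card (blocks s x) = card (blocks s z)"
      using * card_blocks_le[OF n, of z s] z D by blast
    have "vcomp s x z" using D x z CD by blast
    hence "x = z" using vle_card_eq[OF n, of x s z] vle_card_eq[OF n, of z s x] x z D CD by (auto simp: vcomp_def)
    thus False using x z by simp
  qed
  thus "maximal_chain n s C" unfolding maximal_chain_def pred_on.maxchain_def using * chain_iff[OF n] by blast
next
  assume "maximal_chain n s C"
  hence ch: "pred_on.chain (vparts n s) (vless s) C" and mx: "\<And>D. pred_on.chain (vparts n s) (vless s) D \<Longrightarrow> \<not> C \<subset> D"
    by (auto simp: maximal_chain_def pred_on.maxchain_def)
  show sub: "C \<subseteq> vparts n s" and comp: "\<forall>x\<in>C. \<forall>y\<in>C. vcomp s x y" using ch chain_iff[OF n] by auto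
  have ext: "z \<in> C" if "z \<in> vparts n s" "\<And>x. x \<in> C \<Longrightarrow> vcomp s x z" for z
  proof -
    have "pred_on.chain (vparts n s) (vless s) (insert z C)" unfolding chain_iff[OF n]
      using that sub comp vle_refl[OF n that(1)] by (auto simp: vcomp_def)
    thus ?thesis using mx by blast
  qed
  have zero: "Zero_hat \<in> C" by (rule ext) (auto simp: vparts_def vcomp_def)
  have top: "vtop n s \<in> C"
    by (rule ext[OF vtop_props(1)[OF n]]) (use vle_vtop[OF n] sub in \<open>auto simp: vcomp_def\<close>)
  have fin: "finite ((\<lambda>x. card (blocks s x)) ` D)" if "D \<subseteq> C" for D
  proof -
    have "(\<lambda>x. card (blocks s x)) ` D \<subseteq> {..n}" using card_blocks_le[OF n] sub that by auto
    thus ?thesis using finite_subset by blast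
  qed
  show "\<forall>m\<le>n. \<exists>x\<in>C. card (blocks s x) = m"
  proof (intro allI impI)
    fix m assume m: "m \<le> n"
    show "\<exists>x\<in>C. card (blocks s x) = m"
    proof (rule ccontr)
      assume no: "\<not> (\<exists>x\<in>C. card (blocks s x) = m)"
      let ?c = "\<lambda>x. card (blocks s x)"
      \<comment> \<open>Fewer blocks means higher in the order: \<open>U\<close> lies above the
        missing level and \<open>L\<close> below it. \<open>Zero_hat\<close> has no blocks although
        it is the bottom, so it is kept out of both.\<close>
      define U where "U = {x\<in>C. x \<noteq> Zero_hat \<and> ?c x < m}"
      define L where "L = {x\<in>C. x \<noteq> Zero_hat \<and> m < ?c x}"
      have split: "x = Zero_hat \<or> x \<in> U \<or> x \<in> L" if "x \<in> C" for x
        using that no by (auto simp: U_def L_def)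
      have "m \<noteq> 0" using no zero by force
      have "vtop n s \<in> U"
      proof -
        have "?c (vtop n s) = 1" by (simp add: vtop_props(2)[OF n])
        hence "m \<noteq> 1" using no top by auto
        thus ?thesis using \<open>m \<noteq> 0\<close> top \<open>?c (vtop n s) = 1\<close> by (auto simp: U_def vtop_def)
      qed
      hence "?c ` U \<noteq> {}" "finite (?c ` U)" using fin[of U] by (auto simp: U_def)
      then obtain y where y: "y \<in> U" "\<And>u. u \<in> U \<Longrightarrow> ?c u \<le> ?c y"
        using Max_in[of "?c ` U"] Max_ge[of "?c ` U"] by (metis (no_types, lifting) imageE image_eqI)
      have yv: "y \<in> vparts n s" "y \<noteq> Zero_hat" "y \<in> C" "?c y < m" using y(1) sub by (auto simp: U_def)
      have yU: "vle s y u" if "u \<in> U" for u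
        using card_comparable[OF n yv(1), of u] that y(2)[OF that] yv sub comp by (auto simp: U_def)
      \<comment> \<open>The lower end for the interpolation is the highest element of
        \<open>L\<close>. If \<open>L\<close> is empty, the least atom below \<open>y\<close> takes
        its place; it has \<open>n\<close> blocks.\<close>
      obtain x where x: "x \<in> vparts n s" "x \<noteq> Zero_hat" "vle s x y" "m \<le> ?c x" "\<And>l. l \<in> L \<Longrightarrow> vle s l x"
      proof (cases "L = {}")
        case True
        note at = least_atom_props(1,2)[OF n yv(1,2)]
        thus ?thesis using that[of "least_atom n s y"] m True vatoms_iff[OF n, of "least_atom n s y" s]
          by (auto simp: vatoms_def)
      next
        case False
        hence "?c ` L \<noteq> {}" "finite (?c ` L)" using fin[of L] by (auto simp: L_def)
        then obtain x where x: "x \<in> L" "\<And>l. l \<in> L \<Longrightarrow> ?c x \<le> ?c l"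
          using Min_in[of "?c ` L"] Min_le[of "?c ` L"] by (metis (no_types, lifting) imageE image_eqI)
        have xv: "x \<in> vparts n s" "x \<noteq> Zero_hat" "x \<in> C" "m < ?c x" using x(1) sub by (auto simp: L_def)
        have "vle s l x" if "l \<in> L" for l
          using card_comparable[OF n _ xv(1), of l] that x(2)[OF that] xv sub comp by (auto simp: L_def)
        moreover have "vle s x y" using card_comparable[OF n xv(1) yv(1)] xv yv comp by simp
        ultimately show ?thesis using that xv by simp
      qed
      obtain z where z: "z \<in> vparts n s" "vle s x z" "vle s z y" "?c z = m"
        using vparts_interpolate[OF n x(1) yv(1) x(2,3) _ x(4)] yv(4) by (metis less_imp_le)
      have "z \<in> C"
      proof (rule ext[OF z(1)])
        fix w assume w: "w \<in> C"
        then consider "w = Zero_hat" | "w \<in> U" | "w \<in> L" using split by blast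
        thus "vcomp s w z"
        proof cases
          case 1 thus ?thesis by (simp add: vcomp_def)
        next
          case 2 thus ?thesis using vle_trans[OF n z(1) yv(1) _ z(3) yU] w sub by (auto simp: vcomp_def)
        next
          case 3 thus ?thesis using vle_trans[OF n _ x(1) z(1) x(5) z(2)] w sub by (auto simp: vcomp_def)
        qed
      qed
      thus False using no z(4) by blast
    qed
  qed
qed

section \<open>Merge trees\<close>

datatype tree = Leaf block | Node tree tree

primrec is_leaf :: "tree \<Rightarrow> bool" where
  "is_leaf (Leaf b) = True"
| "is_leaf (Node l r) = False"

primrec blk :: "tree \<Rightarrow> block" where
  "blk (Leaf b) = b"
| "blk (Node l r) = sup (blk l) (blk r)"

text \<open>The index of a merge is the label whose minimum moves to the left. At a leaf the value 0
  is only a default, so \<open>valid\<close> and \<open>left_trees\<close> treat leaves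
  separately.\<close>

primrec lidx :: "tree \<Rightarrow> nat" where
  "lidx (Leaf b) = 0"
| "lidx (Node l r) = (LEAST i. 1 \<le> i \<and> Min (blk r i) < Min (blk l i))"

primrec lbl :: "tree \<Rightarrow> int \<times> int \<times> int" where
  "lbl (Leaf b) = (0, 0, 0)"
| "lbl (Node l r) = (int (Min (blk l 0)), int (lidx (Node l r)), int (Min (blk r (lidx (Node l r)))))"

primrec valid :: "nat \<Rightarrow> tree \<Rightarrow> bool" where
  "valid s (Leaf b) = (is_block s b \<and> card (b 0) = 1)"
| "valid s (Node l r) = (valid s l \<and> valid s r \<and> (\<forall>i\<le>s. blk l i \<inter> blk r i = {}) \<and>
     Min (blk l 0) < Min (blk r 0) \<and> (\<exists>i\<in>{1..s}. Min (blk r i) < Min (blk l i)) \<and>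
     (is_leaf l \<or> lidx (Node l r) \<le> lidx l))"

primrec labels :: "tree \<Rightarrow> (int \<times> int \<times> int) set" where
  "labels (Leaf b) = {}"
| "labels (Node l r) = insert (lbl (Node l r)) (labels l \<union> labels r)"

text \<open>The blocks of the state that is reached once all merges with a label \<open>\<ge> \<theta>\<close> are done.\<close>

primrec cut :: "int \<times> int \<times> int \<Rightarrow> tree \<Rightarrow> block set" where
  "cut \<theta> (Leaf b) = {b}"
| "cut \<theta> (Node l r) = (if \<theta> \<le> lbl (Node l r) then {blk (Node l r)} else cut \<theta> l \<union> cut \<theta> r)"

declare lbl.simps(2) [simp del] lidx.simps(2) [simp del]

lemma valid_block: "valid s t \<Longrightarrow> is_block s (blk t)"
  by (induction t) (auto intro: is_block_sup)

lemma lidx_props: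
  assumes "valid s (Node l r)"
  shows "lidx (Node l r) \<in> {1..s}" "Min (blk r (lidx (Node l r))) < Min (blk l (lidx (Node l r)))"
    "\<And>j. j \<in> {1..<lidx (Node l r)} \<Longrightarrow> \<not> Min (blk r j) < Min (blk l j)"
proof -
  let ?P = "\<lambda>i. 1 \<le> i \<and> Min (blk r i) < Min (blk l i)"
  obtain i where i: "i \<in> {1..s}" "Min (blk r i) < Min (blk l i)" using assms by auto
  hence "?P i" by simp
  hence "?P (lidx (Node l r))" "lidx (Node l r) \<le> i"
    unfolding lidx.simps by (rule LeastI, rule Least_le)
  thus "lidx (Node l r) \<in> {1..s}" "Min (blk r (lidx (Node l r))) < Min (blk l (lidx (Node l r)))"
    using i by auto
  show "\<not> Min (blk r j) < Min (blk l j)" if "j \<in> {1..<lidx (Node l r)}" for j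
    using not_less_Least[of j ?P] that by (simp add: lidx.simps)
qed

lemma lidx_eqI:
  assumes "1 \<le> i" "Min (blk r i) < Min (blk l i)" "\<And>j. j \<in> {1..<i} \<Longrightarrow> \<not> Min (blk r j) < Min (blk l j)"
  shows "lidx (Node l r) = i"
  unfolding lidx.simps using assms by (intro Least_equality) (auto simp: not_le[symmetric])

lemma Min_sup:
  assumes "is_block s b" "is_block s c" "i \<le> s"
  shows "Min (sup b c i) = min (Min (b i)) (Min (c i))"
  using assms by (auto simp: is_block_finite is_block_nonempty Min_Un)

lemma Min_blk_Node:
  assumes "valid s (Node l r)" "i \<le> s"
  shows "Min (blk (Node l r) i) = min (Min (blk l i)) (Min (blk r i))"
  using assms Min_sup valid_block by (metis blk.simps(2) valid.simps(2))

text \<open>Both labels start with the same minimum, that of the leftmost part. If the indices agree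
  as well, the third coordinates decide: the minimum of the \<open>i\<close>-th label of
  \<open>l\<close> sits in the right child of \<open>l\<close>, and \<open>r\<close> goes below
  it.\<close>

lemma lbl_left:
  assumes v: "valid s (Node l r)" and "\<not> is_leaf l" shows "lbl (Node l r) < lbl l"
proof -
  obtain a b where l: "l = Node a b" using assms(2) by (cases l) auto
  have vl: "valid s (Node a b)" using v l by simp
  have m0: "Min (blk l 0) = Min (blk a 0)" using vl Min_blk_Node[OF vl, of 0] by (simp add: l)
  let ?i = "lidx (Node l r)" and ?j = "lidx (Node a b)"
  have j: "?j \<in> {1..s}" "Min (blk b ?j) < Min (blk a ?j)" using lidx_props[OF vl] by auto
  hence mj: "Min (blk l ?j) = Min (blk b ?j)" using Min_blk_Node[OF vl, of ?j] by (simp add: l)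
  have "?i \<le> ?j" using v assms(2) l by simp
  moreover have "Min (blk r ?i) < Min (blk b ?j)" if "?i = ?j"
    using lidx_props(2)[OF v] mj that by simp
  ultimately show ?thesis using m0 by (cases "?i = ?j") (simp_all add: l lbl.simps)
qed

text \<open>The first coordinates decide, since the part of \<open>r\<close> has the larger
  minimum.\<close>

lemma lbl_right:
  assumes v: "valid s (Node l r)" and "\<not> is_leaf r" shows "lbl (Node l r) < lbl r"
proof -
  obtain a b where r: "r = Node a b" using assms(2) by (cases r) auto
  have vr: "valid s (Node a b)" using v r by simp
  have "Min (blk r 0) = Min (blk a 0)" using vr Min_blk_Node[OF vr, of 0] by (simp add: r)
  thus ?thesis using v by (auto simp: r lbl.simps)
qed

lemma lbl_le: "valid s t \<Longrightarrow> \<mu> \<in> labels t \<Longrightarrow> lbl t \<le> \<mu>"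
proof (induction t arbitrary: \<mu>)
  case (Node l r)
  have "is_leaf l \<Longrightarrow> labels l = {}" "is_leaf r \<Longrightarrow> labels r = {}" by (cases l; simp; fail) (cases r; simp)
  hence "lbl (Node l r) < \<mu>" if "\<mu> \<in> labels l \<union> labels r"
    using that lbl_left[OF Node.prems(1)] lbl_right[OF Node.prems(1)] Node.IH Node.prems(1)
    by (metis Un_iff empty_iff order_less_le_trans valid.simps(2))
  thus ?case using Node.prems by (auto intro: less_imp_le)
qed simp

lemma lbl_less:
  assumes "valid s (Node l r)" "\<mu> \<in> labels l \<union> labels r" shows "lbl (Node l r) < \<mu>"
proof -
  have "is_leaf l \<Longrightarrow> labels l = {}" "is_leaf r \<Longrightarrow> labels r = {}" by (cases l; simp; fail) (cases r; simp)
  thus ?thesis using assms lbl_left[OF assms(1)] lbl_right[OF assms(1)] lbl_le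
    by (metis Un_iff empty_iff order_less_le_trans valid.simps(2))
qed

text \<open>The second element \<open>k'\<close> makes \<open>k\<close> smaller than the maximum of
  the part, hence \<open>k < n\<close> on the whole set; this is the bound needed against the edge
  from the least element.\<close>

lemma labels_bounds:
  assumes "valid s t" "\<mu> \<in> labels t"
  shows "\<exists>k\<in>blk t 0. \<exists>k'\<in>blk t 0. k < k' \<and> (\<exists>i\<in>{1..s}. \<exists>j. \<mu> = (int k, int i, j))"
  using assms
proof (induction t)
  case (Node l r)
  show ?case
  proof (cases "\<mu> = lbl (Node l r)")
    case True
    have "Min (blk l 0) \<in> blk l 0" "Min (blk r 0) \<in> blk r 0"
      using Node.prems(1) valid_block[of s l] valid_block[of s r] by (auto intro!: Min_in simp: is_block_def)
    moreover have "Min (blk l 0) < Min (blk r 0)" using Node.prems(1) by simp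
    ultimately show ?thesis using True lidx_props(1)[OF Node.prems(1)] unfolding lbl.simps by auto
  next
    case False
    hence "\<mu> \<in> labels l \<or> \<mu> \<in> labels r" using Node.prems by simp
    thus ?thesis using Node.IH Node.prems(1) by fastforce
  qed
qed simp

lemma finite_labels: "finite (labels t)"
  by (induction t) auto

text \<open>The first coordinate of a label is an element of the part of its subtree, and the two
  parts are disjoint.\<close>

lemma labels_disjoint:
  assumes "valid s (Node l r)" shows "labels l \<inter> labels r = {}"
proof -
  have "blk l 0 \<inter> blk r 0 = {}" using assms by simp
  moreover have ex: "\<exists>k\<in>blk t 0. fst \<mu> = int k" if "valid s t" "\<mu> \<in> labels t" for t \<mu>
    using labels_bounds[OF that] by auto
  moreover have "valid s l" "valid s r" using assms by auto
  ultimately have False if \<mu>: "\<mu> \<in> labels l" "\<mu> \<in> labels r" for \<mu>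
    using ex[OF \<open>valid s l\<close> \<mu>(1)] ex[OF \<open>valid s r\<close> \<mu>(2)] by auto
  thus ?thesis by blast
qed

lemma card_labels: "valid s t \<Longrightarrow> Suc (card (labels t)) = card (blk t 0)"
proof (induction t)
  case (Node l r)
  have "lbl (Node l r) \<notin> labels l \<union> labels r" using lbl_less[OF Node.prems] by blast
  hence "card (labels (Node l r)) = Suc (card (labels l) + card (labels r))"
    using finite_labels labels_disjoint[OF Node.prems] by (simp add: card_Un_disjoint)
  moreover have "card (blk (Node l r) 0) = card (blk l 0) + card (blk r 0)"
    using Node.prems valid_block[of s l] valid_block[of s r] by (auto simp: is_block_finite intro!: card_Un_disjoint)
  ultimately show ?case using Node.IH Node.prems by simp
qed simp

section \<open>Cutting a merge tree at a threshold\<close>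

lemma is_state_Un:
  assumes "is_state s V X" "is_state s U Y" "\<forall>i\<le>s. V i \<inter> U i = {}"
  shows "is_state s (sup V U) (X \<union> Y)"
proof -
  have "b i \<inter> c i = {}" if "b \<in> X" "c \<in> Y" "i \<le> s" for b c i
    using is_state_subset[OF assms(1) that(1,3)] is_state_subset[OF assms(2) that(2,3)] assms(3) that(3) by blast
  hence "b i \<inter> c i = {}" if "b \<in> X \<union> Y" "c \<in> X \<union> Y" "b \<noteq> c" "i \<le> s" for b c i
    using assms(1,2) that unfolding is_state_def by (metis Int_commute Un_iff)
  thus ?thesis using assms(1,2) by (auto simp: is_state_def)
qed

lemma is_state_singleton: "is_block s b \<Longrightarrow> is_state s b {b}"
  by (simp add: is_state_def)

lemma cut_state: "valid s t \<Longrightarrow> is_state s (blk t) (cut \<theta> t)"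
proof (induction t)
  case (Leaf b) thus ?case by (simp add: is_state_singleton)
next
  case (Node l r)
  have "is_state s (sup (blk l) (blk r)) (cut \<theta> l \<union> cut \<theta> r)"
    using Node by (intro is_state_Un) auto
  thus ?case using is_state_singleton[OF valid_block[OF Node.prems]] by (simp add: sup_fun_def)
qed

lemma cut_disjoint:
  assumes "valid s (Node l r)" shows "cut \<theta> l \<inter> cut \<theta>' r = {}"
proof -
  have "False" if "b \<in> cut \<theta> l" "b \<in> cut \<theta>' r" for b
  proof -
    note sl = cut_state[of s l \<theta>] and sr = cut_state[of s r \<theta>']
    have "b 0 \<subseteq> blk l 0" "b 0 \<subseteq> blk r 0" "b 0 \<noteq> {}"
      using sl sr assms that is_state_subset[of s _ _ b 0] is_state_block by (auto simp: is_block_def; blast)+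
    thus False using assms by fastforce
  qed
  thus ?thesis by blast
qed

lemma cut_le_blk: "b \<in> cut \<theta> t \<Longrightarrow> b \<le> blk t"
  by (induction t) (auto split: if_splits intro: le_supI1 le_supI2)

lemma refines_Un: "refines X Y \<Longrightarrow> refines X' Y' \<Longrightarrow> refines (X \<union> X') (Y \<union> Y')"
  unfolding refines_def by blast

lemma cut_refines: "\<theta> \<le> \<theta>' \<Longrightarrow> refines (cut \<theta>' t) (cut \<theta> t)"
proof (induction t)
  case (Node l r)
  show ?case
  proof (cases "\<theta> \<le> lbl (Node l r)")
    case True
    hence "cut \<theta> (Node l r) = {blk (Node l r)}" by simp
    thus ?thesis using cut_le_blk[of _ \<theta>' "Node l r"] unfolding refines_def by blast
  next
    case False
    hence "\<not> \<theta>' \<le> lbl (Node l r)" using Node.prems by auto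
    thus ?thesis using False Node refines_Un by simp
  qed
qed (simp add: refines_refl)

lemma cut_all: "\<forall>\<mu>\<in>labels t. \<theta> \<le> \<mu> \<Longrightarrow> cut \<theta> t = {blk t}"
  by (cases t) auto

text \<open>Each merge that is still pending, that is, with a label below \<theta>, accounts for one
  more block. Pending merges are closed under passing to ancestors because labels grow downwards in
  the tree.\<close>

lemma card_cut: "valid s t \<Longrightarrow> card (cut \<theta> t) = Suc (card {\<mu>\<in>labels t. \<mu> < \<theta>})"
proof (induction t)
  case (Node l r)
  show ?case
  proof (cases "\<theta> \<le> lbl (Node l r)")
    case True
    hence e: "{\<mu>\<in>labels (Node l r). \<mu> < \<theta>} = {}" using lbl_le[OF Node.prems] by fastforce
    have "cut \<theta> (Node l r) = {blk (Node l r)}" using True by simp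
    thus ?thesis unfolding e by simp
  next
    case False
    have "{\<mu>\<in>labels (Node l r). \<mu> < \<theta>} =
        insert (lbl (Node l r)) ({\<mu>\<in>labels l. \<mu> < \<theta>} \<union> {\<mu>\<in>labels r. \<mu> < \<theta>})" using False by auto
    moreover have "lbl (Node l r) \<notin> {\<mu>\<in>labels l. \<mu> < \<theta>} \<union> {\<mu>\<in>labels r. \<mu> < \<theta>}"
      using lbl_less[OF Node.prems] by blast
    moreover have "{\<mu>\<in>labels l. \<mu> < \<theta>} \<inter> {\<mu>\<in>labels r. \<mu> < \<theta>} = {}" using labels_disjoint[OF Node.prems] by blast
    ultimately have "card {\<mu>\<in>labels (Node l r). \<mu> < \<theta>} =
        Suc (card {\<mu>\<in>labels l. \<mu> < \<theta>} + card {\<mu>\<in>labels r. \<mu> < \<theta>})"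
      using finite_labels by (simp add: card_Un_disjoint)
    moreover have "finite (cut \<theta> t)" for t by (induction t) auto
    hence "card (cut \<theta> (Node l r)) = card (cut \<theta> l) + card (cut \<theta> r)"
      using False cut_disjoint[OF Node.prems] by (simp add: card_Un_disjoint)
    ultimately show ?thesis using Node by simp
  qed
qed simp

lemma cut_cong:
  "valid s t \<Longrightarrow> {\<nu>\<in>labels t. \<theta> \<le> \<nu> \<and> \<nu> < \<theta>'} = {} \<Longrightarrow> \<theta> \<le> \<theta>' \<Longrightarrow> cut \<theta>' t = cut \<theta> t"
proof (induction t)
  case (Node l r)
  have "\<theta>' \<le> lbl (Node l r) \<longleftrightarrow> \<theta> \<le> lbl (Node l r)" using Node.prems by fastforce
  thus ?case using Node by auto
qed simp

lemma merge_Un: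
  assumes "b \<notin> Y" "c \<notin> Y" shows "merge b c (X \<union> Y) = merge b c X \<union> Y"
  using assms by (auto simp: merge_def)

lemma disjoint_Un_eq_singleton:
  assumes "A \<union> B = {x}" "A \<inter> B = {}"
  shows "A = {x} \<and> B = {} \<or> A = {} \<and> B = {x}"
proof -
  have "A \<subseteq> {x}" "B \<subseteq> {x}" using assms(1) by (metis Un_upper1, metis Un_upper2)
  thus ?thesis using assms by (auto simp: subset_singleton_iff)
qed

text \<open>If the root is already merged at \<theta>, its label must be the only one in the
  interval, and both children are complete at \<theta>'. Otherwise the label lies in exactly one
  child, while the cut of the other child stays the same.\<close>

lemma cut_step:
  "valid s t \<Longrightarrow> {\<nu>\<in>labels t. \<theta> \<le> \<nu> \<and> \<nu> < \<theta>'} = {\<mu>} \<Longrightarrow> \<theta> \<le> \<theta>' \<Longrightarrow>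
    \<exists>l r. valid s (Node l r) \<and> lbl (Node l r) = \<mu> \<and> blk l \<in> cut \<theta>' t \<and> blk r \<in> cut \<theta>' t \<and>
      cut \<theta> t = merge (blk l) (blk r) (cut \<theta>' t)"
proof (induction t)
  case (Node l r)
  let ?L = "\<lambda>t. {\<nu>\<in>labels t. \<theta> \<le> \<nu> \<and> \<nu> < \<theta>'}"
  have \<mu>: "\<mu> \<in> labels (Node l r)" "\<theta> \<le> \<mu>" "\<mu> < \<theta>'" using Node.prems(2) by blast+
  have v: "valid s l" "valid s r" using Node.prems(1) by auto
  consider "\<theta> \<le> lbl (Node l r)" | "lbl (Node l r) < \<theta>" by fastforce
  thus ?case
  proof cases
    case 1
    have "lbl (Node l r) \<in> ?L (Node l r)" using 1 \<mu> lbl_le[OF Node.prems(1) \<mu>(1)] by auto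
    hence eq: "lbl (Node l r) = \<mu>" using Node.prems(2) by blast
    have ge: "\<theta>' \<le> \<nu>" if "\<nu> \<in> labels l \<union> labels r" for \<nu>
    proof (rule ccontr)
      assume no: "\<not> \<theta>' \<le> \<nu>"
      have less: "\<mu> < \<nu>" using lbl_less[OF Node.prems(1) that] unfolding eq .
      have "\<nu> \<in> labels (Node l r)" using that by simp
      moreover have "\<theta> \<le> \<nu>" using order_trans[OF \<mu>(2) less_imp_le[OF less]] .
      moreover have "\<nu> < \<theta>'" using no unfolding not_le .
      ultimately have "\<nu> \<in> ?L (Node l r)" by (intro CollectI conjI)
      hence "\<nu> = \<mu>" unfolding Node.prems(2) by (rule singletonD)
      thus False using less by (metis order_less_irrefl)
    qed
    have "cut \<theta>' l = {blk l}" "cut \<theta>' r = {blk r}" using ge by (auto intro!: cut_all)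
    hence c': "cut \<theta>' (Node l r) = {blk l, blk r}" using eq \<mu> by auto
    have "cut \<theta> (Node l r) = merge (blk l) (blk r) (cut \<theta>' (Node l r))"
      using 1 unfolding c' by (simp add: merge_def)
    thus ?thesis using Node.prems(1) eq c' by blast
  next
    case 2
    hence 3: "lbl (Node l r) < \<theta>'" using Node.prems(3) by simp
    have c: "cut \<theta> (Node l r) = cut \<theta> l \<union> cut \<theta> r" "cut \<theta>' (Node l r) = cut \<theta>' l \<union> cut \<theta>' r" using 2 3 by auto
    have "?L (Node l r) = ?L l \<union> ?L r" using 2 by auto
    hence U: "?L l \<union> ?L r = {\<mu>}" using Node.prems(2) by simp
    have D: "?L l \<inter> ?L r = {}" using labels_disjoint[OF Node.prems(1)] by blast
    consider "?L l = {\<mu>}" "?L r = {}" | "?L l = {}" "?L r = {\<mu>}" using disjoint_Un_eq_singleton[OF U D] by argo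
    thus ?thesis
    proof cases
      case 1
      then obtain l' r' where lr: "valid s (Node l' r')" "lbl (Node l' r') = \<mu>" "blk l' \<in> cut \<theta>' l"
        "blk r' \<in> cut \<theta>' l" "cut \<theta> l = merge (blk l') (blk r') (cut \<theta>' l)"
        using Node.IH(1)[OF v(1) _ Node.prems(3)] by blast
      have r: "cut \<theta>' r = cut \<theta> r" using cut_cong[OF v(2) 1(2) Node.prems(3)] .
      have "blk l' \<notin> cut \<theta>' r" "blk r' \<notin> cut \<theta>' r" using lr cut_disjoint[OF Node.prems(1)] by blast+
      hence "cut \<theta> (Node l r) = merge (blk l') (blk r') (cut \<theta>' (Node l r))"
        unfolding c lr(5) by (simp add: merge_Un r)
      thus ?thesis using lr c by blast
    next
      case 2
      then obtain l' r' where lr: "valid s (Node l' r')" "lbl (Node l' r') = \<mu>" "blk l' \<in> cut \<theta>' r"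
        "blk r' \<in> cut \<theta>' r" "cut \<theta> r = merge (blk l') (blk r') (cut \<theta>' r)"
        using Node.IH(2)[OF v(2) _ Node.prems(3)] by blast
      have l: "cut \<theta>' l = cut \<theta> l" using cut_cong[OF v(1) 2(1) Node.prems(3)] .
      have "blk l' \<notin> cut \<theta>' l" "blk r' \<notin> cut \<theta>' l" using lr cut_disjoint[OF Node.prems(1)] by blast+
      hence "cut \<theta> (Node l r) = merge (blk l') (blk r') (cut \<theta>' (Node l r))"
        unfolding c lr(5) using merge_Un[of "blk l'" "cut \<theta>' l" "blk r'" "cut \<theta>' r"] by (simp add: l Un_commute)
      thus ?thesis using lr c by blast
    qed
  qed
qed simp

section \<open>Decreasing chains and merge trees\<close>

definition trees :: "nat \<Rightarrow> block \<Rightarrow> tree set" where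
  "trees s W = {t. valid s t \<and> blk t = W}"

text \<open>Letting \<theta> range over all triples gives all intermediate states without naming the
  order of the merges.\<close>

definition chain_of :: "nat \<Rightarrow> nat \<Rightarrow> tree \<Rightarrow> vpart set" where
  "chain_of n s t = {x \<in> vparts n s. x = Zero_hat \<or> (\<exists>\<theta>. blocks s x = cut \<theta> t)}"

text \<open>Lowering the threshold to the largest label below it removes exactly that label.\<close>

lemma ex_threshold:
  fixes L :: "'a::linorder set"
  assumes "finite L" "\<forall>\<mu>\<in>L. \<mu> < u" "d \<le> card L"
  shows "\<exists>\<theta>. card {\<mu>\<in>L. \<mu> < \<theta>} = card L - d"
  using assms(3)
proof (induction d)
  case 0
  have "{\<mu>\<in>L. \<mu> < u} = L" using assms(2) by auto
  thus ?case by (metis diff_zero)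
next
  case (Suc d)
  then obtain \<theta> where \<theta>: "card {\<mu>\<in>L. \<mu> < \<theta>} = card L - d" by auto
  let ?S = "{\<mu>\<in>L. \<mu> < \<theta>}"
  have fin: "finite ?S" using assms(1) by simp
  moreover have "?S \<noteq> {}" using \<theta> Suc.prems by (metis card.empty diff_is_0_eq not_less_eq_eq)
  ultimately have M: "Max ?S \<in> ?S" "\<And>\<mu>. \<mu> \<in> ?S \<Longrightarrow> \<mu> \<le> Max ?S" by (auto simp del: mem_Collect_eq)
  have "{\<mu>\<in>L. \<mu> < Max ?S} = ?S - {Max ?S}"
  proof (intro equalityI subsetI)
    fix \<mu> assume "\<mu> \<in> {\<mu>\<in>L. \<mu> < Max ?S}"
    thus "\<mu> \<in> ?S - {Max ?S}" using M(1) by auto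
  next
    fix \<mu> assume "\<mu> \<in> ?S - {Max ?S}"
    thus "\<mu> \<in> {\<mu>\<in>L. \<mu> < Max ?S}" using M(2)[of \<mu>] by auto
  qed
  hence "card {\<mu>\<in>L. \<mu> < Max ?S} = card L - Suc d" using M(1) fin \<theta> by (simp add: card_Diff_singleton)
  thus ?case by blast
qed

text \<open>The atom counts itself, and the set is finite, so its cardinality is not the default 0.
  This puts the second coordinate of the edge from \<open>Zero_hat\<close> above
  \<open>s\<close>.\<close>

lemma atom_index_pos:
  assumes a: "a \<in> vatoms n s" shows "1 \<le> atom_index n s a"
proof -
  have "finite (vparts n s)"
  proof -
    let ?F = "\<lambda>P. {1..s} \<rightarrow>\<^sub>E (P \<rightarrow>\<^sub>E Pow {1..n})"
    have "vparts n s \<subseteq> insert Zero_hat (\<Union>P\<in>Pow (Pow {1..n}). VP P ` ?F P)"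
      by (auto simp: vparts_def is_vector_partition_def partition_on_def)
    moreover have "finite (?F P)" if "P \<in> Pow (Pow {1..n})" for P
      using that by (intro finite_PiE) (auto intro: finite_subset)
    ultimately show ?thesis by (meson finite_Pow_iff finite_UN_I finite_atLeastAtMost finite_imageI finite_insert finite_subset)
  qed
  hence "finite {b \<in> vatoms n s. atom_word n s b \<le> atom_word n s a}" by (simp add: vatoms_def)
  moreover have "a \<in> {b \<in> vatoms n s. atom_word n s b \<le> atom_word n s a}" using a by simp
  ultimately show ?thesis unfolding atom_index_def by (metis One_nat_def Suc_leI card_gt_0_iff empty_iff)
qed

context
  fixes n s :: nat and t :: tree
  assumes n: "0 < n" and t: "t \<in> trees s (full s n)"
begin

private lemma v: "valid s t" "blk t = full s n"
  using t by (auto simp: trees_def)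

private lemma cut_full: "is_state s (full s n) (cut \<theta> t)"
  using cut_state[OF v(1)] v(2) by metis

lemma chain_of_blocks: "x \<in> chain_of n s t \<Longrightarrow> x \<noteq> Zero_hat \<Longrightarrow> \<exists>\<theta>. blocks s x = cut \<theta> t"
  by (simp add: chain_of_def)

lemma ex_chain_of_cut: "\<exists>x\<in>chain_of n s t. x \<noteq> Zero_hat \<and> blocks s x = cut \<theta> t"
  using blocks_surj[OF cut_full] unfolding chain_of_def by blast

private lemma bounds:
  assumes "\<mu> \<in> labels t"
  shows "\<exists>k i j. \<mu> = (int k, int i, j) \<and> k < n \<and> i \<le> s"
  using labels_bounds[OF v(1) assms] full_simps(1)[of 0 s n] unfolding v(2) by fastforce

lemma maximal_chain_of: "maximal_chain n s (chain_of n s t)"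
  unfolding maximal_chain_iff[OF n]
proof (intro conjI ballI allI impI)
  show "chain_of n s t \<subseteq> vparts n s" by (auto simp: chain_of_def)
next
  fix x y assume xy: "x \<in> chain_of n s t" "y \<in> chain_of n s t"
  show "vcomp s x y"
  proof (cases "x = Zero_hat \<or> y = Zero_hat")
    case True thus ?thesis by (auto simp: vcomp_def)
  next
    case False
    obtain \<theta> where "blocks s x = cut \<theta> t" using chain_of_blocks[OF xy(1)] False by metis
    moreover obtain \<theta>' where "blocks s y = cut \<theta>' t" using chain_of_blocks[OF xy(2)] False by metis
    moreover have "x \<in> vparts n s" "y \<in> vparts n s" using xy by (auto simp: chain_of_def)
    ultimately show ?thesis using cut_refines[of \<theta> \<theta>' t] cut_refines[of \<theta>' \<theta> t] n linorder_linear[of \<theta> \<theta>']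
      unfolding vcomp_def by (auto simp: vle_iff_refines)
  qed
next
  fix m assume m: "m \<le> n"
  show "\<exists>x\<in>chain_of n s t. card (blocks s x) = m"
  proof (cases "m = 0")
    case True
    have "Zero_hat \<in> chain_of n s t" by (simp add: chain_of_def vparts_def)
    thus ?thesis using True by force
  next
    case False
    have "Suc (card (labels t)) = n" using card_labels[OF v(1)] v(2) by (simp add: full_simps)
    \<comment> \<open>Above all labels, so the threshold at which no merge has been done
      yet.\<close>
    moreover have "\<forall>\<mu>\<in>labels t. \<mu> < (int n, 0, 0)" using bounds by fastforce
    ultimately obtain \<theta> where "card {\<mu>\<in>labels t. \<mu> < \<theta>} = m - 1"
      using ex_threshold[OF finite_labels, of t "(int n, 0, 0)" "n - m"] m False by force
    hence "card (cut \<theta> t) = m" using card_cut[OF v(1)] False by simp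
    thus ?thesis using ex_chain_of_cut by metis
  qed
qed

text \<open>A cover loses one block, so by \<open>card_cut\<close> exactly one label lies between
  the two thresholds. The step between the cuts is the merge with that label, and
  \<open>edge_label_merge\<close> reads it off.\<close>

lemma edge_label_chain_of:
  assumes "vcovers n s x y" "x \<noteq> Zero_hat" "blocks s x = cut \<theta>' t" "blocks s y = cut \<theta> t"
  shows "\<theta> \<le> \<theta>'" "{\<nu>\<in>labels t. \<theta> \<le> \<nu> \<and> \<nu> < \<theta>'} = {edge_label n s x y}"
proof -
  have xy: "x \<in> vparts n s" "y \<in> vparts n s" using assms(1) by (auto simp: vcovers_def)
  let ?L = "\<lambda>\<theta>. {\<nu>\<in>labels t. \<nu> < \<theta>}"
  have fin: "finite (?L \<theta>)" for \<theta> using finite_labels by simp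
  have card: "card (?L \<theta>') = Suc (card (?L \<theta>))"
    using vcovers_card[OF n assms(1,2)] card_cut[OF v(1)] assms(3,4) by simp
  show le: "\<theta> \<le> \<theta>'"
  proof (rule ccontr)
    assume "\<not> \<theta> \<le> \<theta>'"
    hence "?L \<theta>' \<subseteq> ?L \<theta>" by auto
    hence "card (?L \<theta>') \<le> card (?L \<theta>)" using fin by (rule card_mono[rotated])
    thus False using card by simp
  qed
  have sub: "?L \<theta> \<subseteq> ?L \<theta>'" using le by auto
  have "{\<nu>\<in>labels t. \<theta> \<le> \<nu> \<and> \<nu> < \<theta>'} = ?L \<theta>' - ?L \<theta>" by auto
  hence "card {\<nu>\<in>labels t. \<theta> \<le> \<nu> \<and> \<nu> < \<theta>'} = 1" using card sub fin by (simp add: card_Diff_subset)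
  then obtain \<mu> where \<mu>: "{\<nu>\<in>labels t. \<theta> \<le> \<nu> \<and> \<nu> < \<theta>'} = {\<mu>}" by (rule card_1_singletonE)
  obtain l r where lr: "valid s (Node l r)" "lbl (Node l r) = \<mu>" "blk l \<in> cut \<theta>' t" "blk r \<in> cut \<theta>' t"
    "cut \<theta> t = merge (blk l) (blk r) (cut \<theta>' t)" using cut_step[OF v(1) \<mu> le] by blast
  have "edge_label n s x y = (int (Min (blk l 0)), int (lidx (Node l r)), int (Min (blk r (lidx (Node l r)))))"
    using lr assms(3,4) by (intro edge_label_merge[OF n xy(1) assms(2) xy(2)] lidx_props[OF lr(1)]) auto
  hence "edge_label n s x y = \<mu>" using lr(2) by (simp add: lbl.simps)
  thus "{\<nu>\<in>labels t. \<theta> \<le> \<nu> \<and> \<nu> < \<theta>'} = {edge_label n s x y}" using \<mu> by simp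
qed

lemma decreasing_chain_of: "decreasing_chain n s (chain_of n s t)"
  unfolding decreasing_chain_def
proof (intro ballI impI)
  fix x y z assume xyz: "x \<in> chain_of n s t" "y \<in> chain_of n s t" "z \<in> chain_of n s t"
    and c: "vcovers n s x y" "vcovers n s y z"
  have nz: "y \<noteq> Zero_hat" "z \<noteq> Zero_hat"
    using c vle.simps(2) by (auto simp: vcovers_def vless_def) (metis vle.simps(2) vpart.exhaust)+
  obtain \<theta>y \<theta>z where \<theta>: "blocks s y = cut \<theta>y t" "blocks s z = cut \<theta>z t"
    using chain_of_blocks xyz nz by metis
  have m: "edge_label n s y z \<in> labels t" "edge_label n s y z < \<theta>y"
    using edge_label_chain_of(2)[OF c(2) nz(1) \<theta>] by blast+
  show "edge_label n s y z \<le> edge_label n s x y"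
  proof (cases "x = Zero_hat")
    case True
    \<comment> \<open>A merge label has first coordinate at most \<open>n - 1\<close> and second at
      most \<open>s\<close>; the edge from \<open>Zero_hat\<close> has \<open>n - 1\<close> followed
      by at least \<open>s + 1\<close>.\<close>
    have "y \<in> vatoms n s" using vcovers_Zero_hat[OF n] c(1) True by simp
    hence "1 \<le> atom_index n s y" by (rule atom_index_pos)
    moreover obtain k i j where "edge_label n s y z = (int k, int i, j)" "k < n" "i \<le> s"
      using bounds[OF m(1)] by blast
    ultimately show ?thesis by (auto simp: edge_label_def[of n s Zero_hat] True)
  next
    case False
    then obtain \<theta>x where "blocks s x = cut \<theta>x t" using chain_of_blocks xyz by metis
    hence "\<theta>y \<le> edge_label n s x y" using edge_label_chain_of(2)[OF c(1) False _ \<theta>(1)] by blast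
    thus ?thesis using m(2) by (meson less_imp_le less_le_trans)
  qed
qed

lemma decr_chain_of: "chain_of n s t \<in> decr_max_chains n s"
  by (simp add: decr_max_chains_def maximal_chain_of decreasing_chain_of)

text \<open>The root has the least label, so it is the last merge, and the chain element with two
  blocks supplies this edge. For \<open>n = 1\<close> the tree is a leaf and the top is itself an
  atom.\<close>

lemma chain_of_top_iff:
  assumes "2 \<le> n"
  shows "chain_of n s t \<in> decr_max_chains_top n s i \<longleftrightarrow> lidx t = i"
proof -
  obtain l r where lr: "t = Node l r"
  proof (cases t)
    case (Leaf b)
    hence "card (full s n 0) = 1" using v by simp
    thus ?thesis using assms by (simp add: full_simps)
  qed (use that in simp)
  note top = vtop_props[OF n, of s]
  have top_cut: "blocks s (vtop n s) = cut (lbl t) t" using lr v(2) top(2) by simp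
  have label: "edge_label n s x (vtop n s) = lbl t" if x: "x \<in> chain_of n s t" "vcovers n s x (vtop n s)" for x
  proof -
    have "x \<noteq> Zero_hat"
    proof
      assume "x = Zero_hat"
      hence "vtop n s \<in> vatoms n s" using x(2) vcovers_Zero_hat[OF n] by simp
      thus False using vatoms_iff[OF n] top(2) assms by auto
    qed
    moreover then obtain \<theta> where "blocks s x = cut \<theta> t" using x chain_of_blocks by blast
    ultimately have e: "{\<nu>\<in>labels t. lbl t \<le> \<nu> \<and> \<nu> < \<theta>} = {edge_label n s x (vtop n s)}"
      using edge_label_chain_of(2)[OF x(2) _ _ top_cut] by blast
    hence "lbl t \<le> edge_label n s x (vtop n s)" "edge_label n s x (vtop n s) < \<theta>" by blast+
    hence "lbl t < \<theta>" by (rule le_less_trans)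
    hence "lbl t \<in> {\<nu>\<in>labels t. lbl t \<le> \<nu> \<and> \<nu> < \<theta>}" by (simp add: lr)
    thus ?thesis unfolding e by simp
  qed
  obtain x where x: "x \<in> chain_of n s t" "card (blocks s x) = 2"
    using maximal_chain_of assms unfolding maximal_chain_iff[OF n] by blast
  have xv: "x \<in> vparts n s" using x by (simp add: chain_of_def)
  have "vcovers n s x (vtop n s)" using vcoversI[OF n xv top(1) vle_vtop[OF n xv]] x(2) top(2) by simp
  hence "(\<exists>x\<in>chain_of n s t. vcovers n s x (vtop n s) \<and> (\<exists>k j. edge_label n s x (vtop n s) = (k, int i, j))) \<longleftrightarrow>
      (\<exists>k j. lbl t = (k, int i, j))"
    using label x(1) by metis
  also have "\<dots> \<longleftrightarrow> lidx t = i" by (simp add: lr lbl.simps)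
  finally show ?thesis using decr_chain_of by (simp add: decr_max_chains_top_def)
qed

end

section \<open>Recovering a tree from the blocks of its chain\<close>

primrec nodes :: "tree \<Rightarrow> block set" where
  "nodes (Leaf b) = {b}"
| "nodes (Node l r) = insert (blk (Node l r)) (nodes l \<union> nodes r)"

lemma cut_subset_nodes: "cut \<theta> t \<subseteq> nodes t"
  by (induction t) auto

text \<open>The block of an inner node appears in the cut at its own label. The strict bound on
  \<theta>' strengthens the induction: a threshold above the label of the root leaves the root
  unmerged, so cuts of the subtrees are visible.\<close>

lemma nodes_cut:
  "valid s t \<Longrightarrow> b \<in> nodes t \<Longrightarrow> \<forall>\<mu>\<in>labels t. \<theta> < \<mu> \<Longrightarrow> \<exists>\<theta>'. \<theta> < \<theta>' \<and> b \<in> cut \<theta>' t"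
proof (induction t arbitrary: \<theta>)
  case (Leaf b')
  have "\<theta> < (fst \<theta> + 1, 0, 0)" by (cases \<theta>) auto
  thus ?case using Leaf by auto
next
  case (Node l r)
  show ?case
  proof (cases "b = blk (Node l r)")
    case True
    moreover have "\<theta> < lbl (Node l r)" using Node.prems(3) by simp
    ultimately show ?thesis by (intro exI[of _ "lbl (Node l r)"]) (simp add: sup_fun_def)
  next
    case False
    hence b: "b \<in> nodes l \<or> b \<in> nodes r" using Node.prems(2) by simp
    have "\<forall>\<mu>\<in>labels l \<union> labels r. lbl (Node l r) < \<mu>" using lbl_less[OF Node.prems(1)] by blast
    hence "\<exists>\<theta>'. lbl (Node l r) < \<theta>' \<and> b \<in> cut \<theta>' l \<union> cut \<theta>' r"
      using b Node.IH(1)[of "lbl (Node l r)"] Node.IH(2)[of "lbl (Node l r)"] Node.prems(1) by auto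
    then obtain \<theta>' where \<theta>': "lbl (Node l r) < \<theta>'" "b \<in> cut \<theta>' l \<union> cut \<theta>' r" by blast
    moreover have "\<theta> < lbl (Node l r)" using Node.prems(3) by simp
    ultimately show ?thesis by (intro exI[of _ \<theta>']) (auto intro: less_trans)
  qed
qed

lemma nodes_le_blk: "b \<in> nodes t \<Longrightarrow> b \<le> blk t"
  by (induction t) (auto intro: le_supI1 le_supI2)

lemma blk_in_nodes: "blk t \<in> nodes t"
  by (cases t) auto

lemma nodes_nonempty: "valid s t \<Longrightarrow> b \<in> nodes t \<Longrightarrow> b 0 \<noteq> {}"
proof (induction t)
  case (Node l r)
  thus ?case using valid_block[of s l] by (auto simp: is_block_def)
qed (simp add: is_block_def)

lemma nodes_split:
  assumes "valid s (Node l r)"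
  shows "{b\<in>nodes (Node l r). b \<le> blk l} = nodes l" "{b\<in>nodes (Node l r). b \<le> blk r} = nodes r"
    "blk (Node l r) \<notin> nodes l" "blk (Node l r) \<notin> nodes r"
proof -
  have v: "valid s l" "valid s r" "blk l 0 \<inter> blk r 0 = {}" using assms by auto
  have ne: "blk l 0 \<noteq> {}" "blk r 0 \<noteq> {}" using v valid_block by (auto simp: is_block_def)
  have l0: "b 0 \<subseteq> blk l 0" if "b \<le> blk l" for b using that by (simp add: le_fun_def)
  have r0: "b 0 \<subseteq> blk r 0" if "b \<le> blk r" for b using that by (simp add: le_fun_def)
  have nl: "\<not> blk (Node l r) \<le> blk l" using l0[of "blk (Node l r)"] ne v(3) by auto
  have nr: "\<not> blk (Node l r) \<le> blk r" using r0[of "blk (Node l r)"] ne v(3) by auto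
  have "\<not> b \<le> blk l" if "b \<in> nodes r" for b
    using l0[of b] r0[OF nodes_le_blk[OF that]] nodes_nonempty[OF v(2) that] v(3) by blast
  thus "{b\<in>nodes (Node l r). b \<le> blk l} = nodes l" using nl nodes_le_blk[of _ l] by auto
  have "\<not> b \<le> blk r" if "b \<in> nodes l" for b
    using r0[of b] l0[OF nodes_le_blk[OF that]] nodes_nonempty[OF v(1) that] v(3) by blast
  thus "{b\<in>nodes (Node l r). b \<le> blk r} = nodes r" using nr nodes_le_blk[of _ r] by auto
  show "blk (Node l r) \<notin> nodes l" "blk (Node l r) \<notin> nodes r" using nl nr nodes_le_blk by blast+
qed

text \<open>The left child is the one whose part contains the minimum of the whole part. So
  \<open>blk l\<close> is neither the root nor a node on the right of the other tree.\<close>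

lemma blk_left_le:
  assumes v: "valid s (Node l r)" "valid s (Node l' r')" and eq: "nodes (Node l r) = nodes (Node l' r')"
    and b: "blk (Node l r) = blk (Node l' r')"
  shows "blk l \<le> blk l'"
proof -
  have m: "Min (blk (Node l r) 0) \<in> blk l 0" if "valid s (Node l r)" for l r
    using that Min_blk_Node[OF that, of 0] valid_block[of s l] by (auto simp: is_block_def intro!: Min_in)
  have "blk l \<in> nodes (Node l' r')" unfolding eq[symmetric] using blk_in_nodes by simp
  moreover have "blk l \<noteq> blk (Node l' r')" using nodes_split(3)[OF v(1)] b blk_in_nodes by metis
  moreover have "blk l \<notin> nodes r'"
  proof
    assume "blk l \<in> nodes r'"
    hence "blk l 0 \<subseteq> blk r' 0" using nodes_le_blk by (metis le_funD)
    hence "Min (blk (Node l r) 0) \<in> blk r' 0" using m[OF v(1)] by blast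
    moreover have "Min (blk (Node l r) 0) \<in> blk l' 0" using m[OF v(2)] b by simp
    ultimately show False using v(2) by auto
  qed
  ultimately have "blk l \<in> nodes l'" by simp
  thus ?thesis by (rule nodes_le_blk)
qed

text \<open>The root is the greatest node, the left child is fixed by \<open>blk_left_le\<close> in
  both directions, the right child is its complement, and the nodes of a child are those below
  it.\<close>

lemma nodes_inj:
  "valid s t \<Longrightarrow> valid s t' \<Longrightarrow> nodes t = nodes t' \<Longrightarrow> t = t'"
proof (induction t arbitrary: t')
  case (Leaf b)
  show ?case
  proof (cases t')
    case (Node l r)
    have "blk l \<in> nodes t'" "blk t' \<in> nodes t'" using Node blk_in_nodes by auto
    hence "blk l = blk t'" using Leaf.prems(3) by (metis nodes.simps(1) singletonD)
    moreover have "blk t' \<notin> nodes l" using nodes_split(3) Leaf.prems(2) Node by blast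
    ultimately show ?thesis using blk_in_nodes by metis
  qed (use Leaf in auto)
next
  case (Node l r)
  note eq = Node.prems(3)
  show ?case
  proof (cases t')
    case (Leaf b)
    have "blk l \<in> nodes (Node l r)" "blk (Node l r) \<in> nodes (Node l r)" using blk_in_nodes by auto
    hence "blk l = blk (Node l r)" using eq Leaf by (metis nodes.simps(1) singletonD)
    moreover have "blk (Node l r) \<notin> nodes l" using nodes_split(3) Node.prems(1) by blast
    ultimately show ?thesis using blk_in_nodes by metis
  next
    case t': (Node l' r')
    have v: "valid s (Node l r)" "valid s (Node l' r')" using Node.prems t' by auto
    have e: "nodes (Node l r) = nodes (Node l' r')" using eq t' by simp
    have b: "blk (Node l r) = blk (Node l' r')"
      using e blk_in_nodes nodes_le_blk by (metis antisym)
    have bl: "blk l = blk l'"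
      using blk_left_le[OF v e b] blk_left_le[OF v(2,1) e[symmetric] b[symmetric]] by (rule antisym)
    have vb: "is_block s (blk r)" "is_block s (blk r')" using v valid_block by auto
    have br: "blk r = blk r'"
    proof (rule is_block_eqI[OF vb])
      fix i assume i: "i \<le> s"
      have "blk l i \<inter> blk r i = {}" "blk l i \<inter> blk r' i = {}" using v i bl by auto
      moreover have "blk l i \<union> blk r i = blk l i \<union> blk r' i" using fun_cong[OF b, of i] bl by simp
      ultimately show "blk r i = blk r' i" by blast
    qed
    have "nodes l = nodes l'" "nodes r = nodes r'"
      using nodes_split(1,2)[OF v(1)] nodes_split(1,2)[OF v(2)] e bl br by auto
    thus ?thesis using Node.IH v t' by auto
  qed
qed

lemma chain_of_inj:
  assumes "0 < n" shows "inj_on (chain_of n s) (trees s (full s n))"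
proof (rule inj_onI)
  have sub: "nodes t \<subseteq> nodes t'"
    if t: "t \<in> trees s (full s n)" and eq: "chain_of n s t = chain_of n s t'" for t t'
  proof
    fix b assume b: "b \<in> nodes t"
    have v: "valid s t" using t by (simp add: trees_def)
    \<comment> \<open>Below all labels, whose first coordinates are natural numbers, so that
      \<open>nodes_cut\<close> applies to the whole tree.\<close>
    have "\<forall>\<mu>\<in>labels t. (-1, 0, 0) < \<mu>" using labels_bounds[OF v] by fastforce
    then obtain \<theta> where \<theta>: "b \<in> cut \<theta> t" using nodes_cut[OF v b] by blast
    obtain x where x: "x \<in> chain_of n s t" "x \<noteq> Zero_hat" "blocks s x = cut \<theta> t"
      using ex_chain_of_cut[OF assms t] by blast
    have "x \<in> chain_of n s t'" using x(1) eq by simp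
    then obtain \<theta>' where "blocks s x = cut \<theta>' t'" using x(2) unfolding chain_of_def by blast
    thus "b \<in> nodes t'" using \<theta> x(3) cut_subset_nodes by blast
  qed
  fix t t' assume *: "t \<in> trees s (full s n)" "t' \<in> trees s (full s n)" "chain_of n s t = chain_of n s t'"
  hence "nodes t = nodes t'" using sub[of t t'] sub[of t' t] by auto
  thus "t = t'" using nodes_inj * by (auto simp: trees_def)
qed

section \<open>Every decreasing chain comes from a tree\<close>

lemma lex_fst_mono: "\<mu> \<le> \<nu> \<Longrightarrow> fst \<mu> \<le> fst \<nu>" for \<mu> \<nu> :: "int \<times> int \<times> int"
  by (cases \<mu>; cases \<nu>) auto

lemma state_le_eq:
  assumes "is_state s W X" "b \<in> X" "c \<in> X" "b \<le> c" shows "b = c"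
proof -
  obtain k where k: "k \<in> b 0" using is_state_block[OF assms(1,2)] by (auto simp: is_block_def)
  hence "k \<in> c 0" using assms(4) by (auto simp: le_fun_def)
  thus ?thesis using is_state_unique[OF assms(1-3) le0 k] by blast
qed

text \<open>Were no minimum to drop, \<open>edge_label_late\<close> would contradict
  \<open>ln\<close> for a leaf \<open>l\<close>, and \<open>le\<close> for an inner node
  \<open>l\<close>, whose label starts with \<open>Min (blk l 0)\<close>. Given a drop,
  \<open>le\<close> compares labels with equal first coordinates and so yields the index condition
  of \<open>valid\<close>.\<close>

lemma Node_merge:
  assumes n: "0 < n" and cov: "vcovers n s x y" "x \<noteq> Zero_hat"
    and v: "valid s l" "valid s r" and bc: "blk l \<in> blocks s x" "blk r \<in> blocks s x"
    and lt: "Min (blk l 0) < Min (blk r 0)" and Y: "blocks s y = merge (blk l) (blk r) (blocks s x)"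
    and le: "\<not> is_leaf l \<Longrightarrow> edge_label n s x y \<le> lbl l" and ln: "fst (edge_label n s x y) < int n"
  shows "valid s (Node l r) \<and> lbl (Node l r) = edge_label n s x y"
proof -
  have xy: "x \<in> vparts n s" "y \<in> vparts n s" using cov(1) by (auto simp: vcovers_def)
  have fst_lbl: "fst (lbl l) = int (Min (blk l 0))" if nl: "\<not> is_leaf l"
  proof -
    obtain a b where l: "l = Node a b" using nl by (cases l) auto
    thus ?thesis using v(1) Min_blk_Node[of s a b 0] by (simp add: lbl.simps)
  qed
  have ex: "\<exists>i\<in>{1..s}. Min (blk r i) < Min (blk l i)"
  proof (rule ccontr)
    assume "\<not> ?thesis"
    hence no: "\<And>i. i \<in> {1..s} \<Longrightarrow> \<not> Min (blk r i) < Min (blk l i)" by blast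
    note late = edge_label_late[OF n xy(1) cov(2) xy(2) bc lt Y no]
    show False
    proof (cases "is_leaf l")
      case True
      hence "card (blk l 0) = 1" using v(1) by (cases l) auto
      thus False using late(2) ln by simp
    next
      case False
      thus False using late(1) lex_fst_mono[OF le[OF False]] fst_lbl[OF False] by simp
    qed
  qed
  define i where "i = lidx (Node l r)"
  let ?P = "\<lambda>i. 1 \<le> i \<and> Min (blk r i) < Min (blk l i)"
  obtain j where j: "j \<in> {1..s}" "Min (blk r j) < Min (blk l j)" using ex by blast
  hence "?P j" by simp
  hence "?P i" "i \<le> j" unfolding i_def lidx.simps by (rule LeastI, rule Least_le)
  moreover have "\<not> Min (blk r j) < Min (blk l j)" if "j \<in> {1..<i}" for j
    using not_less_Least[of j ?P] that unfolding i_def lidx.simps by auto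
  ultimately have lab: "edge_label n s x y = (int (Min (blk l 0)), int i, int (Min (blk r i)))"
    using j by (intro edge_label_merge[OF n xy(1) cov(2) xy(2) bc lt Y]) auto
  hence lbl: "lbl (Node l r) = edge_label n s x y" by (simp add: lbl.simps i_def)
  have "i \<le> lidx l" if nl: "\<not> is_leaf l"
  proof -
    obtain a b where l: "l = Node a b" using nl by (cases l) auto
    thus ?thesis using le[OF nl] fst_lbl[OF nl] unfolding lab by (auto simp: lbl.simps)
  qed
  moreover have "\<forall>i\<le>s. blk l i \<inter> blk r i = {}"
    using blocks_state[OF xy(1) cov(2)] bc lt unfolding is_state_def by (metis less_irrefl)
  ultimately show ?thesis using v lt ex lbl i_def by auto
qed

lemma decr_chain_tree:
  assumes n: "0 < n" and C: "C \<in> decr_max_chains n s"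
  shows "\<exists>t\<in>trees s (full s n). C = chain_of n s t"
proof -
  have mx: "maximal_chain n s C" and dec: "decreasing_chain n s C" using C by (auto simp: decr_max_chains_def)
  have Cv: "C \<subseteq> vparts n s" and comp: "\<And>x y. x \<in> C \<Longrightarrow> y \<in> C \<Longrightarrow> vcomp s x y"
    and lev: "\<And>m. m \<le> n \<Longrightarrow> \<exists>x\<in>C. card (blocks s x) = m" using mx unfolding maximal_chain_iff[OF n] by auto
  obtain X where X: "\<And>m. m \<le> n \<Longrightarrow> X m \<in> C \<and> card (blocks s (X m)) = m" using lev by metis
  have XC: "X m \<in> C" "X m \<in> vparts n s" "card (blocks s (X m)) = m" if "m \<le> n" for m using X[OF that] Cv by auto
  have X0: "X m \<noteq> Zero_hat" if "m \<le> n" "1 \<le> m" for m using card_blocks_eq_0_iff[OF n XC(2)[OF that(1)]] XC(3) that by auto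
  have Xst: "is_state s (full s n) (blocks s (X m))" if "m \<le> n" "1 \<le> m" for m
    using blocks_state XC(2) X0 that by blast
  have Xle: "vle s (X m') (X m)" if "1 \<le> m" "m \<le> m'" "m' \<le> n" for m m'
    using that XC X0 by (intro card_comparable[OF n]) (auto intro: comp)
  have cov: "vcovers n s (X (Suc m)) (X m)" if "1 \<le> m" "m < n" for m
    using that XC Xle by (intro vcoversI[OF n]) auto
  \<comment> \<open>\<open>th m\<close> is the label of the merge that leads to \<open>m\<close>
    blocks. The value at \<open>n\<close> stands for no merge and exceeds all others.\<close>
  define th where "th m = (if m < n then edge_label n s (X (Suc m)) (X m) else (int n, 0, 0))" for m
  have th_step: "th m \<le> th (Suc m)" if "1 \<le> m" "Suc m < n" for m
    using that dec cov[of m] cov[of "Suc m"] XC(1) unfolding th_def decreasing_chain_def by simp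
  \<comment> \<open>The edge into the atom \<open>X n\<close> starts with \<open>n - 1\<close>, and
    the labels after it can only decrease. So no edge of the form \<open>(n, _, 0)\<close>
    occurs.\<close>
  have fst_th: "fst (th m) < int n" if "1 \<le> m" "m < n" for m
    using that(2,1)
  proof (induction rule: strict_inc_induct)
    case (base i)
    have at: "X n \<in> vatoms n s" using vatoms_iff[OF n] XC[of n] by simp
    have z: "Zero_hat \<in> C"
    proof -
      obtain x where "x \<in> C" "card (blocks s x) = 0" using lev[of 0] by auto
      thus ?thesis using card_blocks_eq_0_iff[OF n] Cv by (metis subset_iff)
    qed
    have "th i \<le> edge_label n s Zero_hat (X n)"
      using dec vcovers_Zero_hatI[OF n at] cov[of i] z XC(1)[of n] XC(1)[of i] base unfolding th_def decreasing_chain_def by auto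
    from lex_fst_mono[OF this] show ?case by (simp add: edge_label_def)
  next
    case (step i)
    have "fst (th i) \<le> fst (th (Suc i))" by (rule lex_fst_mono[OF th_step]) (use step in auto)
    thus ?case using step by simp
  qed
  have lt: "th m < th (Suc m)" if m: "1 \<le> m" "m < n" for m
  proof (cases "Suc m < n")
    case True
    have "th m \<noteq> th (Suc m)"
    proof
      assume "th m = th (Suc m)"
      hence "edge_label n s (X (Suc (Suc m))) (X (Suc m)) = edge_label n s (X (Suc m)) (X m)"
        using True m by (simp add: th_def)
      from edge_label_repeat[OF n _ _ this] have "fst (th (Suc m)) = int n"
        using True m XC(2) X0[of m] X0[of "Suc m"] X0[of "Suc (Suc m)"] by (simp add: th_def)
      thus False using fst_th[of "Suc m"] True by simp
    qed
    thus ?thesis using th_step[OF m(1) True] by (rule le_neq_trans[rotated])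
  next
    case False
    hence "th (Suc m) = (int n, 0, 0)" by (simp add: th_def)
    thus ?thesis using fst_th[OF m] by (cases "th m") auto
  qed
  have th_less: "th m < th m'" if "1 \<le> m" "m < m'" "m' \<le> n" for m m'
    using that(2,3)
  proof (induction m')
    case (Suc k)
    show ?case
    proof (cases "m = k")
      case True thus ?thesis using lt[of k] that(1) Suc.prems by simp
    next
      case False
      hence "th m < th k" using Suc by simp
      also have "th k < th (Suc k)" using lt[of k] that(1) Suc.prems by simp
      finally show ?thesis .
    qed
  qed simp
  \<comment> \<open>Trees are built upwards from the atom, with \<open>m\<close> going down from
    \<open>n\<close>. The invariant keeps the whole past of the chain: cutting the tree of
    \<open>b\<close> at an earlier threshold gives back the blocks of that state inside
    \<open>b\<close>.\<close>
  have "\<forall>b\<in>blocks s (X m). \<exists>t. valid s t \<and> blk t = b \<and> (\<forall>\<mu>\<in>labels t. th m \<le> \<mu>) \<and>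
      (\<forall>m'\<in>{m..n}. cut (th m') t = {b'\<in>blocks s (X m'). b' \<le> b})" if "1 \<le> m" "m \<le> n" for m
    using that(2,1)
  proof (induction m rule: inc_induct)
    case base
    show ?case
    proof
      fix b assume b: "b \<in> blocks s (X n)"
      note st = Xst[OF order_refl base]
      have "card (b 0) = 1"
        using is_state_card_eq_iff[OF st full_simps(2)] XC(3)[of n] b by (simp add: full_simps)
      hence "valid s (Leaf b)" using is_state_block[OF st b] by simp
      moreover have "{b'\<in>blocks s (X n). b' \<le> b} = {b}" using state_le_eq[OF st _ b] b by blast
      ultimately show "\<exists>t. valid s t \<and> blk t = b \<and> (\<forall>\<mu>\<in>labels t. th n \<le> \<mu>) \<and>
          (\<forall>m'\<in>{n..n}. cut (th m') t = {b'\<in>blocks s (X m'). b' \<le> b})"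
        by (intro exI[of _ "Leaf b"]) simp
    qed
  next
    case (step k)
    have k: "1 \<le> k" "k < n" "1 \<le> Suc k" "Suc k \<le> n" "k \<le> n" using step.hyps step.prems by auto
    note IH = step.IH[OF k(3)]
    note st = Xst[OF k(4,3)] and st' = Xst[OF k(5,1)]
    have kk: "{k..n} = insert k {Suc k..n}" using k by auto
    obtain b c where bc: "b \<in> blocks s (X (Suc k))" "c \<in> blocks s (X (Suc k))" "Min (b 0) < Min (c 0)"
      and Y: "blocks s (X k) = merge b c (blocks s (X (Suc k)))"
      using vcovers_merge[OF n cov[OF k(1,2)] X0[OF k(4,3)]] by blast
    have thk: "th k < th (Suc k)" by (rule lt[OF k(1,2)])
    have self: "{b'\<in>blocks s (X k). b' \<le> d} = {d}" if "d \<in> blocks s (X k)" for d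
      using state_le_eq[OF st' _ that] that by blast
    show ?case
    proof
      fix d assume d: "d \<in> blocks s (X k)"
      show "\<exists>t. valid s t \<and> blk t = d \<and> (\<forall>\<mu>\<in>labels t. th k \<le> \<mu>) \<and>
          (\<forall>m'\<in>{k..n}. cut (th m') t = {b'\<in>blocks s (X m'). b' \<le> d})"
      proof (cases "d \<in> blocks s (X (Suc k))")
        case True
        then obtain t where t: "valid s t" "blk t = d" "\<forall>\<mu>\<in>labels t. th (Suc k) \<le> \<mu>"
          "\<forall>m'\<in>{Suc k..n}. cut (th m') t = {b'\<in>blocks s (X m'). b' \<le> d}" using IH by blast
        have th: "\<forall>\<mu>\<in>labels t. th k \<le> \<mu>" using t(3) less_le_trans[OF thk] less_imp_le by blast
        have "cut (th k) t = {b'\<in>blocks s (X k). b' \<le> d}" using cut_all[OF th] self[OF d] t(2) by simp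
        thus ?thesis using t th unfolding kk by blast
      next
        case False
        hence dd: "d = sup b c" using d Y by (auto simp: merge_def)
        obtain l where l: "valid s l" "blk l = b" "\<forall>\<mu>\<in>labels l. th (Suc k) \<le> \<mu>"
          "\<forall>m'\<in>{Suc k..n}. cut (th m') l = {b'\<in>blocks s (X m'). b' \<le> b}" using IH bc(1) by blast
        obtain r where r: "valid s r" "blk r = c" "\<forall>\<mu>\<in>labels r. th (Suc k) \<le> \<mu>"
          "\<forall>m'\<in>{Suc k..n}. cut (th m') r = {b'\<in>blocks s (X m'). b' \<le> c}" using IH bc(2) by blast
        have ek: "edge_label n s (X (Suc k)) (X k) = th k" using k by (simp add: th_def)
        have lab: "th k \<le> \<mu>" if "\<mu> \<in> labels l \<union> labels r" for \<mu>
          using that l(3) r(3) less_le_trans[OF thk] less_imp_le by blast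
        have "valid s (Node l r) \<and> lbl (Node l r) = edge_label n s (X (Suc k)) (X k)"
        proof (rule Node_merge[OF n cov[OF k(1,2)] X0[OF k(4,3)] l(1) r(1)])
          show "blk l \<in> blocks s (X (Suc k))" "blk r \<in> blocks s (X (Suc k))" "Min (blk l 0) < Min (blk r 0)"
            "blocks s (X k) = merge (blk l) (blk r) (blocks s (X (Suc k)))" using bc Y l(2) r(2) by auto
          show "edge_label n s (X (Suc k)) (X k) \<le> lbl l" if "\<not> is_leaf l"
            unfolding ek by (rule lab) (use that in \<open>cases l; simp\<close>)
          show "fst (edge_label n s (X (Suc k)) (X k)) < int n" unfolding ek by (rule fst_th[OF k(1,2)])
        qed
        hence v: "valid s (Node l r)" and lb: "lbl (Node l r) = th k" using ek by auto
        have bk: "blk (Node l r) = d" using dd l(2) r(2) by simp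
        have th: "\<forall>\<mu>\<in>labels (Node l r). th k \<le> \<mu>" using lab lb by auto
        have "cut (th k) (Node l r) = {b'\<in>blocks s (X k). b' \<le> d}" using cut_all[OF th] self[OF d] bk by simp
        \<comment> \<open>For earlier states the new root is still pending, so its cut is the union
          of those of the children.\<close>
        moreover have "cut (th m') (Node l r) = {b'\<in>blocks s (X m'). b' \<le> d}" if m': "m' \<in> {Suc k..n}" for m'
        proof -
          have "th k < th m'" using th_less[OF k(1)] m' by auto
          hence "cut (th m') (Node l r) = cut (th m') l \<union> cut (th m') r" using lb by (simp add: not_le[symmetric])
          also have "\<dots> = {b'\<in>blocks s (X m'). b' \<le> b \<or> b' \<le> c}" using l(4) r(4) m' by blast
          also have "\<dots> = {b'\<in>blocks s (X m'). b' \<le> d}"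
          proof -
            \<comment> \<open>An element of \<open>b' 0\<close> lies in the part of \<open>b\<close>
              or of \<open>c\<close>; as \<open>X m'\<close> refines \<open>X (Suc k)\<close>, the
              whole of \<open>b'\<close> lies below that block.\<close>
            have "b' \<le> b \<or> b' \<le> c" if b': "b' \<in> blocks s (X m')" "b' \<le> d" for b'
            proof -
              have m'n: "m' \<le> n" "1 \<le> m'" using m' by auto
              note st'' = Xst[OF m'n]
              obtain j where j: "j \<in> b' 0" using is_state_block[OF st'' b'(1)] by (auto simp: is_block_def)
              hence "j \<in> d 0" using b'(2) by (auto simp: le_fun_def)
              then obtain e where e: "e \<in> {b, c}" "j \<in> e 0" using dd by auto
              have "vle s (X m') (X (Suc k))" using Xle[OF k(3)] m' by simp
              hence "refines (blocks s (X m')) (blocks s (X (Suc k)))"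
                using vle_iff_refines[OF XC(2)[OF m'n(1)] XC(2)[OF k(4)] n] by blast
              moreover have "e \<in> blocks s (X (Suc k))" using e(1) bc by blast
              ultimately have "b' \<le> e"
                using refines_below[where b = b' and d = e and i = 0 and x = j, OF st'' st _ b'(1) _ le0 j e(2)] by blast
              thus ?thesis using e(1) by blast
            qed
            thus ?thesis unfolding dd using le_supI1 le_supI2 by blast
          qed
          finally show ?thesis .
        qed
        ultimately show ?thesis using v bk th unfolding kk by blast
      qed
    qed
  qed
  note claim = this
  have X1: "X 1 = vtop n s"
    using vle_card_eq[OF n XC(2) vtop_props(1)[OF n] vle_vtop[OF n XC(2)]] XC(3)[of 1] n vtop_props(2)[OF n] by simp
  have one: "1 \<le> n" using n by simp
  obtain t where t: "valid s t" "blk t = full s n"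
    "\<forall>m'\<in>{1..n}. cut (th m') t = {b'\<in>blocks s (X m'). b' \<le> full s n}"
    using claim[OF order_refl one] unfolding X1 vtop_props(2)[OF n] by blast
  hence tt: "t \<in> trees s (full s n)" by (simp add: trees_def)
  have "C \<subseteq> chain_of n s t"
  proof
    fix x assume x: "x \<in> C"
    hence xv: "x \<in> vparts n s" using Cv by blast
    define m where "m = card (blocks s x)"
    have m: "m \<le> n" using card_blocks_le[OF n xv] by (simp add: m_def)
    have "x = Zero_hat \<or> blocks s x = cut (th m) t"
    proof (cases "m = 0")
      case True thus ?thesis using card_blocks_eq_0_iff[OF n xv] by (simp add: m_def)
    next
      case False
      have eq: "card (blocks s (X m)) = card (blocks s x)" using XC(3)[OF m] unfolding m_def .
      have "vle s x (X m) \<or> vle s (X m) x" using comp[OF x XC(1)[OF m]] unfolding vcomp_def .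
      hence "X m = x"
        using vle_card_eq[OF n XC(2)[OF m] xv _ eq] vle_card_eq[OF n xv XC(2)[OF m] _ eq[symmetric]] by blast
      moreover have "cut (th m) t = blocks s (X m)"
        using t(3) m False state_le_full[OF Xst[OF m] full_is_block[OF n]] by auto
      ultimately show ?thesis by simp
    qed
    thus "x \<in> chain_of n s t" using xv unfolding chain_of_def by blast
  qed
  moreover have ch: "pred_on.chain (vparts n s) (vless s) (chain_of n s t)"
    using maximal_chain_of[OF n tt] by (simp add: maximal_chain_def pred_on.maxchain_def)
  \<comment> \<open>One inclusion is enough, since \<open>C\<close> is a maximal chain and the other
    set is a chain.\<close>
  moreover have "\<not> C \<subset> chain_of n s t"
    using mx ch unfolding maximal_chain_def pred_on.maxchain_def by metis
  ultimately have "C = chain_of n s t" by (metis psubsetI)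
  thus ?thesis using tt by blast
qed

lemma decr_max_chains_eq: "0 < n \<Longrightarrow> decr_max_chains n s = chain_of n s ` trees s (full s n)"
  using decr_chain_tree decr_chain_of by blast

lemma card_decr_max_chains: "0 < n \<Longrightarrow> card (decr_max_chains n s) = card (trees s (full s n))"
  unfolding decr_max_chains_eq by (rule card_image[OF chain_of_inj])

lemma card_decr_max_chains_top:
  assumes "2 \<le> n"
  shows "card (decr_max_chains_top n s i) = card {t\<in>trees s (full s n). lidx t = i}"
proof -
  have n: "0 < n" using assms by simp
  have "decr_max_chains_top n s i \<subseteq> decr_max_chains n s" by (auto simp: decr_max_chains_top_def)
  hence "decr_max_chains_top n s i = chain_of n s ` {t\<in>trees s (full s n). lidx t = i}"
    using chain_of_top_iff[OF n _ assms] unfolding decr_max_chains_eq[OF n] by (intro equalityI subsetI) auto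
  thus ?thesis using card_image[OF inj_on_subset[OF chain_of_inj[OF n]]] by (metis (no_types, lifting) mem_Collect_eq subsetI)
qed

section \<open>Counting merge trees\<close>

lemma card_subsets_notin:
  assumes "finite A" "a \<in> A"
  shows "card {V. V \<subseteq> A \<and> card V = k \<and> a \<notin> V} = (card A - 1) choose k"
proof -
  have "{V. V \<subseteq> A \<and> card V = k \<and> a \<notin> V} = {V. V \<subseteq> A - {a} \<and> card V = k}" by auto
  thus ?thesis using n_subsets[of "A - {a}" k] assms by simp
qed

lemma card_subsets_in:
  assumes "finite A" "a \<in> A" "1 \<le> k"
  shows "card {V. V \<subseteq> A \<and> card V = k \<and> a \<in> V} = (card A - 1) choose (k - 1)"
proof -
  let ?S = "{V. V \<subseteq> A - {a} \<and> card V = k - 1}"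
  have "{V. V \<subseteq> A \<and> card V = k \<and> a \<in> V} = insert a ` ?S"
  proof (intro equalityI subsetI)
    fix V assume V: "V \<in> {V. V \<subseteq> A \<and> card V = k \<and> a \<in> V}"
    have "V - {a} \<in> ?S" using V by auto
    moreover have "V = insert a (V - {a})" using V by auto
    ultimately show "V \<in> insert a ` ?S" by (rule image_eqI[rotated])
  next
    fix V assume "V \<in> insert a ` ?S"
    then obtain U where U: "V = insert a U" "U \<subseteq> A - {a}" "card U = k - 1" by auto
    have "finite U" "a \<notin> U" using U assms(1) finite_subset[of U "A - {a}"] by auto
    thus "V \<in> {V. V \<subseteq> A \<and> card V = k \<and> a \<in> V}" using U assms by auto
  qed
  moreover have "inj_on (insert a) ?S" by (rule inj_onI) (auto dest: insert_ident[THEN iffD1, rotated 2])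
  ultimately show ?thesis using n_subsets[of "A - {a}" "k - 1"] assms by (simp add: card_image)
qed

text \<open>The possible blocks of the left child of a root with index \<open>i\<close>. The part,
  at index 0, falls under \<open>j < i\<close>, since the left child has to contain its
  minimum.\<close>

definition choices :: "nat \<Rightarrow> block \<Rightarrow> nat \<Rightarrow> nat \<Rightarrow> block set" where
  "choices s W \<alpha> i = (\<Pi>\<^sub>E j\<in>{..s}. {V. V \<subseteq> W j \<and> card V = \<alpha> \<and>
     (if j < i then Min (W j) \<in> V else j = i \<longrightarrow> Min (W j) \<notin> V)})"

definition complement :: "nat \<Rightarrow> block \<Rightarrow> block \<Rightarrow> block" where
  "complement s W V = (\<lambda>j\<in>{..s}. W j - V j)"

lemma card_choices:
  assumes W: "is_block s W" and n: "card (W 0) = n" and "1 \<le> \<alpha>" and i: "i \<le> s"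
  shows "card (choices s W \<alpha> i) =
    ((n - 1) choose (\<alpha> - 1)) ^ i * ((n - 1) choose \<alpha>) * (n choose \<alpha>) ^ (s - i)"
proof -
  let ?T = "\<lambda>j. {V. V \<subseteq> W j \<and> card V = \<alpha> \<and> (if j < i then Min (W j) \<in> V else j = i \<longrightarrow> Min (W j) \<notin> V)}"
  have Wj: "finite (W j)" "Min (W j) \<in> W j" "card (W j) = n" if "j \<le> s" for j
    using is_block_finite[OF W that] is_block_nonempty[OF W that] is_block_card[OF W that] n by auto
  have lt: "card (?T j) = (n - 1) choose (\<alpha> - 1)" if "j < i" for j
    using card_subsets_in[OF Wj(1,2) assms(3), of j] Wj(3)[of j] that i by simp
  have eq: "card (?T i) = (n - 1) choose \<alpha>"
    using card_subsets_notin[OF Wj(1,2)[OF i], of \<alpha>] Wj(3)[OF i] by simp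
  have gt: "card (?T j) = n choose \<alpha>" if "i < j" "j \<le> s" for j
    using n_subsets[OF Wj(1)[OF that(2)], of \<alpha>] Wj(3)[OF that(2)] that by simp
  have "card (choices s W \<alpha> i) = (\<Prod>j\<in>{..s}. card (?T j))"
    unfolding choices_def by (rule card_PiE) simp
  \<comment> \<open>Minimum forced below \<open>i\<close>, forbidden at \<open>i\<close>, free
    above. The indices below \<open>i\<close> include 0, which gives the exponent
    \<open>i\<close>.\<close>
  also have "{..s} = {..<i} \<union> insert i {i<..s}" using i by auto
  also have "(\<Prod>j\<in>{..<i} \<union> insert i {i<..s}. card (?T j)) =
      (\<Prod>j\<in>{..<i}. card (?T j)) * (card (?T i) * (\<Prod>j\<in>{i<..s}. card (?T j)))"
    by (subst prod.union_disjoint) auto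
  also have "(\<Prod>j\<in>{..<i}. card (?T j)) = ((n - 1) choose (\<alpha> - 1)) ^ i" using lt by simp
  also have "(\<Prod>j\<in>{i<..s}. card (?T j)) = (n choose \<alpha>) ^ (s - i)" using gt by simp
  finally show ?thesis unfolding eq by (simp add: mult.assoc)
qed

text \<open>The subtrees admissible as left child of a root with index \<open>i\<close>.\<close>

definition left_trees :: "nat \<Rightarrow> block \<Rightarrow> nat \<Rightarrow> tree set" where
  "left_trees s V i = {l \<in> trees s V. is_leaf l \<or> i \<le> lidx l}"

lemma choicesD:
  assumes "V \<in> choices s W \<alpha> i" "j \<le> s"
  shows "V j \<subseteq> W j" "card (V j) = \<alpha>" "j < i \<Longrightarrow> Min (W j) \<in> V j" "j = i \<Longrightarrow> Min (W j) \<notin> V j"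
proof -
  have "V j \<in> {V. V \<subseteq> W j \<and> card V = \<alpha> \<and> (if j < i then Min (W j) \<in> V else j = i \<longrightarrow> Min (W j) \<notin> V)}"
    using assms unfolding choices_def by (auto dest: PiE_mem)
  thus "V j \<subseteq> W j" "card (V j) = \<alpha>" "j < i \<Longrightarrow> Min (W j) \<in> V j" "j = i \<Longrightarrow> Min (W j) \<notin> V j"
    by (auto split: if_splits)
qed

lemma choices_block:
  assumes W: "is_block s W" and "1 \<le> \<alpha>" "\<alpha> < card (W 0)" and V: "V \<in> choices s W \<alpha> i"
  shows "is_block s V" "card (V 0) = \<alpha>" "is_block s (complement s W V)"
    "card (complement s W V 0) = card (W 0) - \<alpha>"
proof -
  have fin: "finite (V j)" if "j \<le> s" for j
    using choicesD(1)[OF V that] is_block_finite[OF W that] finite_subset by blast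
  have cV: "card (V j) = \<alpha>" if "j \<le> s" for j using choicesD(2)[OF V that] .
  show "card (V 0) = \<alpha>" using cV by simp
  have "V \<in> extensional {..s}" using V unfolding choices_def by (simp add: PiE_def)
  moreover have "V 0 \<noteq> {}" using cV[of 0] assms(2) by auto
  ultimately show "is_block s V" using fin cV by (simp add: is_block_def)
  have cc: "card (complement s W V j) = card (W 0) - \<alpha>" if "j \<le> s" for j
    using card_Diff_subset[OF fin[OF that] choicesD(1)[OF V that]] cV[OF that] is_block_card[OF W that] that
    by (simp add: complement_def)
  show "card (complement s W V 0) = card (W 0) - \<alpha>" using cc by simp
  have "complement s W V 0 \<noteq> {}" using cc[of 0] assms(3) by auto
  moreover have "finite (complement s W V j)" if "j \<le> s" for j
    using is_block_finite[OF W that] that by (simp add: complement_def)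
  moreover have "complement s W V \<in> extensional {..s}" by (simp add: complement_def)
  ultimately show "is_block s (complement s W V)" using cc by (simp add: is_block_def)
qed

section \<open>Splitting a tree at its root\<close>

lemma trees_decomp:
  assumes W: "is_block s W" and i: "1 \<le> i" "i \<le> s"
  shows "{t\<in>trees s W. lidx t = i} = (\<lambda>(\<alpha>, V, l, r). Node l r) `
    (SIGMA \<alpha>:{1..card (W 0) - 1}. SIGMA V:choices s W \<alpha> i. left_trees s V i \<times> trees s (complement s W V))"
    (is "?L = ?f ` ?R")
proof (intro equalityI subsetI)
  fix t assume t: "t \<in> ?L"
  then obtain l r where lr: "t = Node l r" using i by (cases t) auto
  have v: "valid s (Node l r)" and b: "W = sup (blk l) (blk r)" and li: "lidx (Node l r) = i"
    using t lr by (auto simp: trees_def)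
  have vl: "valid s l" "valid s r" "is_block s (blk l)" "is_block s (blk r)" using v valid_block by auto
  have dis: "blk l j \<inter> blk r j = {}" if "j \<le> s" for j using v that by simp
  have Wj: "W j = blk l j \<union> blk r j" for j using b by simp
  have comp: "complement s W (blk l) = blk r"
  proof
    fix j show "complement s W (blk l) j = blk r j"
      using dis[of j] is_block_undefined[OF vl(4), of j] Wj[of j] by (cases "j \<le> s") (auto simp: complement_def)
  qed
  define \<alpha> where "\<alpha> = card (blk l 0)"
  have "finite (blk l 0)" "finite (blk r 0)" "blk l 0 \<noteq> {}" "blk r 0 \<noteq> {}" using vl by (auto simp: is_block_def)
  moreover from this have "card (W 0) = card (blk l 0) + card (blk r 0)"
    using dis[of 0] Wj[of 0] by (simp add: card_Un_disjoint)
  moreover from calculation have "0 < card (blk l 0)" "0 < card (blk r 0)" by (simp_all add: card_gt_0_iff)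
  ultimately have \<alpha>: "\<alpha> \<in> {1..card (W 0) - 1}" by (simp add: \<alpha>_def)
  have "blk l j \<in> {V. V \<subseteq> W j \<and> card V = \<alpha> \<and> (if j < i then Min (W j) \<in> V else j = i \<longrightarrow> Min (W j) \<notin> V)}"
    if j: "j \<le> s" for j
  proof -
    have ml: "Min (blk l j) \<in> blk l j" "Min (blk r j) \<in> blk r j"
      using is_block_finite[OF vl(3) j] is_block_finite[OF vl(4) j] is_block_nonempty[OF vl(3) j]
        is_block_nonempty[OF vl(4) j] by auto
    have m: "Min (W j) = min (Min (blk l j)) (Min (blk r j))"
      using Min_blk_Node[OF v j] b by simp
    have "Min (W j) \<in> blk l j" if "j < i"
    proof -
      have "\<not> Min (blk r j) < Min (blk l j)"
        \<comment> \<open>For \<open>j = 0\<close> the claim is the orientation of the node, not the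
          minimality of its index.\<close>
        using lidx_props(3)[OF v, of j] that li v by (cases "j = 0") auto
      thus ?thesis using m ml by (simp add: min_def)
    qed
    moreover have "Min (W j) \<notin> blk l j" if "j = i"
    proof -
      have "Min (blk r j) < Min (blk l j)" using lidx_props(2)[OF v] li that by simp
      hence "Min (W j) \<in> blk r j" using m ml by (simp add: min_def)
      thus ?thesis using dis[OF j] by blast
    qed
    moreover have "card (blk l j) = \<alpha>" using is_block_card[OF vl(3) j] by (simp add: \<alpha>_def)
    ultimately show ?thesis using Wj by auto
  qed
  hence "blk l \<in> choices s W \<alpha> i" using vl(3) unfolding choices_def
    by (intro PiE_I) (auto simp: is_block_undefined)
  moreover have "l \<in> left_trees s (blk l) i" using v li vl(1) by (auto simp: left_trees_def trees_def)
  moreover have "r \<in> trees s (complement s W (blk l))" using vl(2) comp by (simp add: trees_def)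
  ultimately have "(\<alpha>, blk l, l, r) \<in> ?R" using \<alpha> by blast
  thus "t \<in> ?f ` ?R" by (rule rev_image_eqI) (simp add: lr)
next
  fix t assume "t \<in> ?f ` ?R"
  then obtain \<alpha> V l r where \<alpha>: "\<alpha> \<in> {1..card (W 0) - 1}" and V: "V \<in> choices s W \<alpha> i"
    and l: "l \<in> left_trees s V i" and r: "r \<in> trees s (complement s W V)" and t: "t = Node l r" by auto
  have vl: "valid s l" "valid s r" "blk l = V" "blk r = complement s W V" "is_leaf l \<or> i \<le> lidx l"
    using l r by (auto simp: left_trees_def trees_def)
  have bV: "is_block s V" "is_block s (blk r)"
    using valid_block[OF vl(1)] valid_block[OF vl(2)] unfolding vl(3) by blast+
  have rj: "blk r j = W j - V j" if "j \<le> s" for j using that vl(4) by (simp add: complement_def)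
  have mem: "Min (V j) \<in> V j" "Min (blk r j) \<in> W j" "Min (blk r j) \<notin> V j" "Min (W j) \<in> W j" if j: "j \<le> s" for j
  proof -
    show "Min (V j) \<in> V j" using is_block_finite[OF bV(1) j] is_block_nonempty[OF bV(1) j] by simp
    have "Min (blk r j) \<in> blk r j" using is_block_finite[OF bV(2) j] is_block_nonempty[OF bV(2) j] by simp
    thus "Min (blk r j) \<in> W j" "Min (blk r j) \<notin> V j" using rj[OF j] by auto
    show "Min (W j) \<in> W j" using is_block_finite[OF W j] is_block_nonempty[OF W j] by simp
  qed
  have less: "Min (V j) < Min (blk r j)" if j: "j < i" for j
  proof -
    have js: "j \<le> s" using j i by simp
    have "Min (W j) \<in> V j" using choicesD(3)[OF V js j] .
    hence "Min (V j) \<le> Min (W j)" using is_block_finite[OF bV(1) js] by simp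
    also have "Min (W j) \<le> Min (blk r j)" using is_block_finite[OF W js] mem(2)[OF js] by simp
    finally show ?thesis using mem(1,3)[OF js] by (metis le_neq_implies_less)
  qed
  have gr: "Min (blk r i) < Min (V i)"
  proof -
    have n: "Min (W i) \<notin> V i" using choicesD(4)[OF V i(2)] by simp
    hence "Min (W i) \<in> blk r i" using rj[OF i(2)] mem(4)[OF i(2)] by simp
    hence "Min (blk r i) \<le> Min (W i)" using is_block_finite[OF bV(2) i(2)] by simp
    also have "Min (W i) < Min (V i)"
    proof -
      have "Min (V i) \<in> W i" using mem(1)[OF i(2)] choicesD(1)[OF V i(2)] by blast
      hence "Min (W i) \<le> Min (V i)" using is_block_finite[OF W i(2)] by simp
      moreover have "Min (W i) \<noteq> Min (V i)" using n mem(1)[OF i(2)] by metis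
      ultimately show ?thesis by simp
    qed
    finally show ?thesis .
  qed
  have li: "lidx (Node l r) = i"
    using gr less vl(3) i(1) by (intro lidx_eqI) (auto dest: less_asym)
  have "valid s (Node l r)"
    using vl li gr less[of 0] i rj by auto
  moreover have "blk (Node l r) = W"
  proof
    fix j show "blk (Node l r) j = W j"
      using rj[of j] vl(3) choicesD(1)[OF V, of j] is_block_undefined[OF W, of j]
        is_block_undefined[OF bV(1), of j] is_block_undefined[OF bV(2), of j] by (cases "j \<le> s") auto
  qed
  ultimately show "t \<in> ?L" using t li by (simp add: trees_def)
qed

text \<open>The left subtree determines \<open>V\<close> as its block and \<alpha> as the size of
  that block.\<close>

lemma trees_decomp_inj:
  "inj_on (\<lambda>(\<alpha>, V, l, r). Node l r)
    (SIGMA \<alpha>:{1..n}. SIGMA V:choices s W \<alpha> i. left_trees s V i \<times> trees s (complement s W V))"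
  by (rule inj_onI) (auto simp: left_trees_def trees_def dest: choicesD(2)[OF _ le0])

lemma trees_single:
  assumes "is_block s W" "card (W 0) = 1" shows "trees s W = {Leaf W}"
proof -
  have "t = Leaf W" if "t \<in> trees s W" for t
  proof (cases t)
    case (Node l r)
    have "card (labels t) = 0" using card_labels[of s t] that assms(2) by (simp add: trees_def)
    thus ?thesis using finite_labels[of t] Node by simp
  qed (use that in \<open>auto simp: trees_def\<close>)
  thus ?thesis using assms by (auto simp: trees_def)
qed

lemma trees_lidx:
  assumes "t \<in> trees s W" "card (W 0) \<noteq> 1" shows "lidx t \<in> {1..s}" "\<not> is_leaf t"
proof -
  show "\<not> is_leaf t" using assms by (cases t) (auto simp: trees_def)
  then obtain l r where "t = Node l r" by (cases t) auto
  thus "lidx t \<in> {1..s}" using assms(1) lidx_props(1) by (auto simp: trees_def)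
qed

lemma trees_Union:
  assumes "card (W 0) \<noteq> 1" shows "trees s W = (\<Union>i\<in>{1..s}. {t\<in>trees s W. lidx t = i})"
  using trees_lidx(1)[where W = W, OF _ assms] by blast

lemma left_trees_Union:
  assumes "card (V 0) \<noteq> 1" shows "left_trees s V i = (\<Union>i'\<in>{i..s}. {t\<in>trees s V. lidx t = i'})"
  using trees_lidx[where W = V, OF _ assms] by (fastforce simp: left_trees_def)

lemma finite_choices: "is_block s W \<Longrightarrow> finite (choices s W \<alpha> i)"
  unfolding choices_def by (intro finite_PiE) (auto simp: is_block_finite)

text \<open>Both children are smaller than the whole, because \<alpha> stays strictly between 0 and
  the size of the part.\<close>

lemma finite_trees: "is_block s W \<Longrightarrow> finite (trees s W)"
proof (induction "card (W 0)" arbitrary: W rule: less_induct)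
  case less
  note W = less.prems
  show ?case
  proof (cases "card (W 0) = 1")
    case True thus ?thesis using trees_single[OF W] by simp
  next
    case False
    have "finite {t\<in>trees s W. lidx t = i}" if i: "i \<in> {1..s}" for i
    proof -
      have fin: "finite (left_trees s V i \<times> trees s (complement s W V))"
        if "\<alpha> \<in> {1..card (W 0) - 1}" "V \<in> choices s W \<alpha> i" for \<alpha> V
      proof -
        have a: "1 \<le> \<alpha>" "\<alpha> < card (W 0)" using that(1) by auto
        note cb = choices_block[OF W a that(2)]
        have "finite (trees s V)" "finite (trees s (complement s W V))"
          using less.hyps[OF _ cb(1)] less.hyps[OF _ cb(3)] cb(2,4) a by auto
        thus ?thesis by (simp add: left_trees_def)
      qed
      have "1 \<le> i" "i \<le> s" using i by auto
      show ?thesis unfolding trees_decomp[OF W \<open>1 \<le> i\<close> \<open>i \<le> s\<close>]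
        by (rule finite_imageI, rule finite_SigmaI[OF finite_atLeastAtMost],
            rule finite_SigmaI[OF finite_choices[OF W]], rule fin)
    qed
    thus ?thesis by (subst trees_Union[where W = W, OF False]) auto
  qed
qed

section \<open>The count depends only on the size\<close>

definition num_trees :: "nat \<Rightarrow> nat \<Rightarrow> nat" where
  "num_trees s n = card (trees s (full s n))"

definition num_trees_top :: "nat \<Rightarrow> nat \<Rightarrow> nat \<Rightarrow> nat" where
  "num_trees_top s n i = card {t \<in> trees s (full s n). lidx t = i}"

definition num_trees_rec :: "nat \<Rightarrow> nat \<Rightarrow> nat \<Rightarrow> nat" where
  "num_trees_rec s n i = (\<Sum>\<alpha>=1..n-1.
     (if \<alpha> = 1 then 1 else (\<Sum>i'=i..s. num_trees_top s \<alpha> i')) * num_trees s (n - \<alpha>) *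
     ((n - 1) choose (\<alpha> - 1)) ^ i * ((n - 1) choose \<alpha>) * (n choose \<alpha>) ^ (s - i))"

text \<open>Children live on arbitrary subsets, while the recursion is stated for
  \<open>full\<close>; this property transfers the counts between them.\<close>

definition equinumerous_trees :: "nat \<Rightarrow> nat \<Rightarrow> bool" where
  "equinumerous_trees s n \<longleftrightarrow> (\<forall>W. is_block s W \<longrightarrow> card (W 0) = n \<longrightarrow>
     card (trees s W) = num_trees s n \<and>
     (\<forall>i\<in>{1..s}. card {t\<in>trees s W. lidx t = i} = num_trees_top s n i))"

text \<open>For fixed \<alpha> every choice of \<open>V\<close> admits the same number of pairs of
  subtrees, by the hypothesis for smaller sizes. The result no longer mentions
  \<open>W\<close>.\<close>

lemma card_trees_rec:
  assumes W: "is_block s W" "card (W 0) = n" and i: "1 \<le> i" "i \<le> s"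
    and IH: "\<And>m. m < n \<Longrightarrow> equinumerous_trees s m"
  shows "card {t\<in>trees s W. lidx t = i} = num_trees_rec s n i"
proof -
  let ?g = "\<lambda>\<alpha>. (if \<alpha> = 1 then 1 else (\<Sum>i'=i..s. num_trees_top s \<alpha> i')) * num_trees s (n - \<alpha>)"
  have fin: "finite (left_trees s V i \<times> trees s (complement s W V))"
    and card: "card (left_trees s V i \<times> trees s (complement s W V)) = ?g \<alpha>"
    if "\<alpha> \<in> {1..n - 1}" "V \<in> choices s W \<alpha> i" for \<alpha> V
  proof -
    have a: "1 \<le> \<alpha>" "\<alpha> < card (W 0)" using that(1) W(2) by auto
    note cb = choices_block[OF W(1) a that(2)]
    have ft: "finite (trees s V)" "finite (trees s (complement s W V))" using finite_trees cb by auto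
    thus "finite (left_trees s V i \<times> trees s (complement s W V))" by (simp add: left_trees_def)
    have "card (trees s (complement s W V)) = num_trees s (n - \<alpha>)"
      using IH[of "n - \<alpha>"] cb(3,4) a W(2) by (simp add: equinumerous_trees_def)
    moreover have "card (left_trees s V i) = (if \<alpha> = 1 then 1 else (\<Sum>i'=i..s. num_trees_top s \<alpha> i'))"
    proof (cases "\<alpha> = 1")
      case True
      \<comment> \<open>A leaf is admissible whatever \<open>i\<close> is, so the sum over indices
        of the left child is replaced by 1.\<close>
      have "card (V 0) = 1" by (rule trans[OF cb(2) True])
      from trees_single[OF cb(1) this] have "left_trees s V i = {Leaf V}"
        unfolding left_trees_def by (simp add: conj_commute Collect_conv_if)
      thus ?thesis using True by simp
    next
      case False
      hence "card (left_trees s V i) = (\<Sum>i'=i..s. card {t\<in>trees s V. lidx t = i'})"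
        using ft(1) cb(2) unfolding left_trees_Union[where V = V, unfolded cb(2), OF False]
        by (intro card_UN_disjoint) auto
      also have "\<dots> = (\<Sum>i'=i..s. num_trees_top s \<alpha> i')"
        using IH[of \<alpha>] cb(1,2) a W(2) i by (intro sum.cong refl) (simp add: equinumerous_trees_def)
      finally show ?thesis using False by simp
    qed
    ultimately show "card (left_trees s V i \<times> trees s (complement s W V)) = ?g \<alpha>"
      by (simp add: card_cartesian_product)
  qed
  let ?S = "\<lambda>\<alpha>. SIGMA V:choices s W \<alpha> i. left_trees s V i \<times> trees s (complement s W V)"
  have S: "finite (?S \<alpha>)" "card (?S \<alpha>) = card (choices s W \<alpha> i) * ?g \<alpha>" if "\<alpha> \<in> {1..n - 1}" for \<alpha>
  proof -
    show "finite (?S \<alpha>)" by (rule finite_SigmaI[OF finite_choices[OF W(1)] fin[OF that]])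
    have "card (?S \<alpha>) = (\<Sum>V\<in>choices s W \<alpha> i. card (left_trees s V i \<times> trees s (complement s W V)))"
      by (rule card_SigmaI[OF finite_choices[OF W(1)]]) (use fin[OF that] in blast)
    also have "\<dots> = (\<Sum>V\<in>choices s W \<alpha> i. ?g \<alpha>)" by (rule sum.cong[OF refl card[OF that]])
    finally show "card (?S \<alpha>) = card (choices s W \<alpha> i) * ?g \<alpha>" by simp
  qed
  have "card {t\<in>trees s W. lidx t = i} = card (SIGMA \<alpha>:{1..n - 1}. ?S \<alpha>)"
    unfolding trees_decomp[OF W(1) i] W(2) by (rule card_image[OF trees_decomp_inj])
  also have "\<dots> = (\<Sum>\<alpha>=1..n-1. card (?S \<alpha>))" by (rule card_SigmaI) (use S(1) in blast)+
  also have "\<dots> = num_trees_rec s n i" unfolding num_trees_rec_def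
    using S(2) card_choices[OF W _ i(2)] by (intro sum.cong refl) (simp add: ac_simps)
  finally show ?thesis .
qed

lemma full_block: "1 \<le> n \<Longrightarrow> is_block s (full s n) \<and> card (full s n 0) = n"
  using full_is_block by (simp add: full_simps)

lemma card_trees_sum:
  assumes "is_block s W" "card (W 0) \<noteq> 1"
  shows "card (trees s W) = (\<Sum>i=1..s. card {t\<in>trees s W. lidx t = i})"
proof -
  have "card (\<Union>i\<in>{1..s}. {t\<in>trees s W. lidx t = i}) = (\<Sum>i=1..s. card {t\<in>trees s W. lidx t = i})"
    using finite_trees[OF assms(1)] by (intro card_UN_disjoint) auto
  thus ?thesis using trees_Union[where W = W, OF assms(2)] by metis
qed

text \<open>\<open>W\<close> and \<open>full s n\<close> satisfy the same recursion with the same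
  right-hand side. Size 1 is separate, since the sum over root indices does not see a leaf.\<close>

lemma equinumerous_trees: "equinumerous_trees s n"
proof (induction n rule: less_induct)
  case (less n)
  show ?case unfolding equinumerous_trees_def
  proof (intro allI impI)
    fix W assume W: "is_block s W" "card (W 0) = n"
    have "W 0 \<noteq> {}" "finite (W 0)" using W(1) by (auto simp: is_block_def)
    hence "1 \<le> n" using W(2) by (metis One_nat_def Suc_leI card_gt_0_iff)
    hence full: "is_block s (full s n)" "card (full s n 0) = n" using full_block by auto
    have top: "card {t\<in>trees s W. lidx t = i} = card {t\<in>trees s (full s n). lidx t = i}"
      if "i \<in> {1..s}" for i
      using card_trees_rec[OF W _ _ less.IH] card_trees_rec[OF full _ _ less.IH] that by simp
    moreover have "card (trees s W) = card (trees s (full s n))"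
    proof (cases "n = 1")
      case True thus ?thesis using trees_single[OF W(1)] trees_single[OF full(1)] W(2) full(2) by simp
    next
      case False
      hence "card (W 0) \<noteq> 1" "card (full s n 0) \<noteq> 1" using W(2) full(2) by simp_all
      thus ?thesis using card_trees_sum[OF W(1)] card_trees_sum[OF full(1)] top by simp
    qed
    ultimately show "card (trees s W) = num_trees s n \<and>
        (\<forall>i\<in>{1..s}. card {t\<in>trees s W. lidx t = i} = num_trees_top s n i)"
      by (simp add: num_trees_def num_trees_top_def)
  qed
qed

theorem theorem4p8:
  fixes s n i :: nat
  assumes "s \<ge> 1" and "n \<ge> 2" and "1 \<le> i" and "i \<le> s"
  shows "card (decr_max_chains 1 s) = 1 \<and>
    card (decr_max_chains_top n s i) =
      (\<Sum>\<alpha>=1..n-1.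
         (if \<alpha> = 1 then card (decr_max_chains 1 s)
          else (\<Sum>i'=i..s. card (decr_max_chains_top \<alpha> s i'))) *
         card (decr_max_chains (n - \<alpha>) s) *
         ((n - 1) choose (\<alpha> - 1)) ^ i * ((n - 1) choose \<alpha>) * (n choose \<alpha>) ^ (s - i))"
proof -
  have one: "card (decr_max_chains 1 s) = 1"
    using card_decr_max_chains[of 1 s] trees_single[of s "full s 1"] full_block[of 1 s] by simp
  have "card (decr_max_chains_top n s i) = num_trees_rec s n i"
    using card_decr_max_chains_top[OF assms(2)] full_block[of n s] assms
      card_trees_rec[of s "full s n" n i] equinumerous_trees by simp
  also have "\<dots> = (\<Sum>\<alpha>=1..n-1.
         (if \<alpha> = 1 then card (decr_max_chains 1 s)
          else (\<Sum>i'=i..s. card (decr_max_chains_top \<alpha> s i'))) *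
         card (decr_max_chains (n - \<alpha>) s) *
         ((n - 1) choose (\<alpha> - 1)) ^ i * ((n - 1) choose \<alpha>) * (n choose \<alpha>) ^ (s - i))"
    unfolding num_trees_rec_def
  proof (rule sum.cong[OF refl])
    fix \<alpha> assume \<alpha>: "\<alpha> \<in> {1..n-1}"
    have "num_trees s (n - \<alpha>) = card (decr_max_chains (n - \<alpha>) s)"
      unfolding num_trees_def by (rule card_decr_max_chains[symmetric]) (use \<alpha> assms(2) in auto)
    \<comment> \<open>With \<alpha> at least 1 and different from 1, the size is at least 2, as the
      correspondence for the top edge requires.\<close>
    moreover have "num_trees_top s \<alpha> i' = card (decr_max_chains_top \<alpha> s i')" if "\<alpha> \<noteq> 1" for i'
      unfolding num_trees_top_def by (rule card_decr_max_chains_top[symmetric]) (use \<alpha> that in auto)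
    ultimately show "(if \<alpha> = 1 then 1 else (\<Sum>i'=i..s. num_trees_top s \<alpha> i')) * num_trees s (n - \<alpha>) *
         ((n - 1) choose (\<alpha> - 1)) ^ i * ((n - 1) choose \<alpha>) * (n choose \<alpha>) ^ (s - i) =
        (if \<alpha> = 1 then card (decr_max_chains 1 s) else (\<Sum>i'=i..s. card (decr_max_chains_top \<alpha> s i'))) *
         card (decr_max_chains (n - \<alpha>) s) *
         ((n - 1) choose (\<alpha> - 1)) ^ i * ((n - 1) choose \<alpha>) * (n choose \<alpha>) ^ (s - i)"
      using one by simp
  qed
  finally show ?thesis using one by blast
qed

end
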